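(* Let $(X,*,R_1,R_2)$ be a singquandle. Let $D$ and $D'$ be diagrams of (unoriented) singular knots or links such that $D'$ is obtained from $D$ by a single move of one of the types RI, RII, RIII, RIVa, RIVb, RV (or the inverse of such a move), performed inside a disk $\Delta$ in the plane. Then the set of colorings by $(X,*,R_1,R_2)$ does not change: for every coloring of $D$ there is exactly one coloring of $D'$ which assigns the same colors as the given coloring on the part of the diagram outside $\Delta$, and this gives a bijection between the set of colorings of $D$ by $(X,*,R_1,R_2)$ and the set of colorings of $D'$ by $(X,*,R_1,R_2)$.
   Context: **Quandles.** A quandle is a set $X$ with a binary operation $*$ such that (i) for every $x\in X$ the map $y\mapsto y*x$ is a bijection of $X$; (ii) $(x*y)*z=(x*z)*(y*z)$ for all $x,y,z\in X$; (iii) $x*x=x$ for all $x\in X$. It is involutive if $(x*y)*y=x$ for all $x,y\in X$. **Singquandles.** A singquandle is a quadruple $(X,*,R_1,R_2)$ where $(X,* )$ is an involutive quandle and $R_1,R_2:X\times X\to X$ are maps such that for all $x,y,z\in X$: 1. $x=R_1(y,R_2(x,y))=R_2(R_2(x,y),R_1(x,y))$; 2. $y=R_2(R_1(x,y),x)=R_1(R_2(x,y),R_1(x,y))$; 3. $R_1(x,y)=R_2(y,R_2(x,y))$ and $R_2(x,y)=R_1(R_1(x,y),x)$; 4. $(y*z)*R_2(x,z)=(y*x)*R_1(x,z)$; 5. $R_1(x,y)=R_2(y*x,x)$; 6. $R_2(x,y)=R_1(y*x,x)*R_2(y*x,x)$; 7. $R_1(x*y,z)*y=R_1(x,z*y)$;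 8. $R_2(x*y,z)=R_2(x,z*y)*y$. **Singular link diagrams and colorings.** A singular knot or link diagram is a planar diagram of unoriented curves with finitely many transverse double points, each of which is either a regular crossing (with over/under information) or a singular crossing (a 4-valent vertex). The arcs of the diagram are the pieces obtained by cutting the curves at each under-passage of a regular crossing and cutting both strands at each singular crossing. (A closed component that is nowhere cut is a single arc.) A coloring of a diagram by $(X,*,R_1,R_2)$ assigns an element of $X$ to each arc such that: - at each regular crossing with over-arc colored $x$, if one under-arc is colored $y$ then the other is colored $y*x$; - at each singular crossing, if the crossing is rotated in the plane so that its four ends are at the top left, top right, bottom left and bottom right, and the top left and top right ends are colored $x$ and $y$, then the bottom left end is colored $R_1(x,y)$ and the bottom right end is colored $R_2(x,y)$. (By axioms 1–3 this condition does not depend on which of the four rotations is used.) **Moves.** Read tangles from top to bottom, with strand positions numbered from left to right, and write composition of tangles as a product, the left factor being on top. Let $\sigma_i$ denote the regular crossing between positions $i,i+1$ in which the over-strand runs from top left to bottom right. Let $\bar\sigma_i$ denote the regular crossing in which the over-strand runs from top right to bottom left. Let $\tau_i$ denote the singular crossing between positions $i,i+1$. Moves replace, inside a disk (up to planar isotopy, including rotation of the disk), one tangle by another: - RI, RII, RIII: the usual unoriented Reidemeister moves, involving regular crossings only: RI adds or removes a kink with one regular crossing of either type; RII is $\bar\sigma_1\sigma_1\leftrightarrow$ trivial two-strand tangle and $\sigma_1\bar\sigma_1\leftrightarrow$ trivial two-strand tangle; RIII is $\sigma_1\bar\sigma_2\bar\sigma_1\leftrightarrow\bar\sigma_2\bar\sigma_1\sigma_2$;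 - RIVa (a strand slides under a singular crossing): $\sigma_1\tau_2\bar\sigma_1\leftrightarrow\bar\sigma_2\tau_1\sigma_2$; - RIVb (a strand slides over a singular crossing): $\bar\sigma_1\tau_2\sigma_1\leftrightarrow\sigma_2\tau_1\bar\sigma_2$; - RV: $\bar\sigma_1\tau_1\sigma_1\leftrightarrow\tau_1$. *)

theory Defs
  imports "HOL-Analysis.Analysis"
begin

locale quandle =
  fixes X :: "'a set" and qop :: "'a \<Rightarrow> 'a \<Rightarrow> 'a" (infixl "\<star>" 70)
  assumes right_bij: "x \<in> X \<Longrightarrow> bij_betw (\<lambda>y. y \<star> x) X X"
    and right_distrib:
      "x \<in> X \<Longrightarrow> y \<in> X \<Longrightarrow> z \<in> X \<Longrightarrow> (x \<star> y) \<star> z = (x \<star> z) \<star> (y \<star> z)"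
    and idem: "x \<in> X \<Longrightarrow> x \<star> x = x"

locale involutive_quandle = quandle +
  assumes involutive: "x \<in> X \<Longrightarrow> y \<in> X \<Longrightarrow> (x \<star> y) \<star> y = x"

locale singquandle = involutive_quandle +
  fixes R1 R2 :: "'a \<Rightarrow> 'a \<Rightarrow> 'a"
  assumes R1_closed: "x \<in> X \<Longrightarrow> y \<in> X \<Longrightarrow> R1 x y \<in> X"
    and R2_closed: "x \<in> X \<Longrightarrow> y \<in> X \<Longrightarrow> R2 x y \<in> X"
    and ax1a: "x \<in> X \<Longrightarrow> y \<in> X \<Longrightarrow> x = R1 y (R2 x y)"
    and ax1b: "x \<in> X \<Longrightarrow> y \<in> X \<Longrightarrow> x = R2 (R2 x y) (R1 x y)"
    and ax2a: "x \<in> X \<Longrightarrow> y \<in> X \<Longrightarrow> y = R2 (R1 x y) x"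
    and ax2b: "x \<in> X \<Longrightarrow> y \<in> X \<Longrightarrow> y = R1 (R2 x y) (R1 x y)"
    and ax3a: "x \<in> X \<Longrightarrow> y \<in> X \<Longrightarrow> R1 x y = R2 y (R2 x y)"
    and ax3b: "x \<in> X \<Longrightarrow> y \<in> X \<Longrightarrow> R2 x y = R1 (R1 x y) x"
    and ax4: "x \<in> X \<Longrightarrow> y \<in> X \<Longrightarrow> z \<in> X \<Longrightarrow>
                (y \<star> z) \<star> R2 x z = (y \<star> x) \<star> R1 x z"
    and ax5: "x \<in> X \<Longrightarrow> y \<in> X \<Longrightarrow> R1 x y = R2 (y \<star> x) x"
    and ax6: "x \<in> X \<Longrightarrow> y \<in> X \<Longrightarrow> R2 x y = R1 (y \<star> x) x \<star> R2 (y \<star> x) x"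
    and ax7: "x \<in> X \<Longrightarrow> y \<in> X \<Longrightarrow> z \<in> X \<Longrightarrow> R1 (x \<star> y) z \<star> y = R1 x (z \<star> y)"
    and ax8: "x \<in> X \<Longrightarrow> y \<in> X \<Longrightarrow> z \<in> X \<Longrightarrow> R2 (x \<star> y) z = R2 x (z \<star> y) \<star> y"


text \<open>
  A diagram is stored as the subset of the plane that it draws, its regular and its singular
  crossings and, for each regular crossing, the pair of opposite unit tangent vectors of the
  over-strand. The same record is used for tangles. Values of \<open>over\<close> outside \<open>reg\<close> are irrelevant.
\<close>

record diagram =
  curve :: "complex set"
  reg :: "complex set"
  sng :: "complex set"
  over :: "complex \<Rightarrow> complex set"

definition crossings :: "diagram \<Rightarrow> complex set" where
  "crossings D = reg D \<union> sng D"

text \<open>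
  The end of the diagram that leaves \<open>p\<close> in the unit direction \<open>u\<close>, as a germ: the filter of points
  of the curve that tend to \<open>p\<close> while their direction as seen from \<open>p\<close> tends to \<open>u\<close>.
\<close>

definition end_at :: "diagram \<Rightarrow> complex \<Rightarrow> complex \<Rightarrow> complex filter" where
  "end_at D p u = inf (at p within curve D) (filtercomap (\<lambda>z. sgn (z - p)) (nhds u))"

definition directions :: "diagram \<Rightarrow> complex \<Rightarrow> complex set" where
  "directions D p = {u. end_at D p u \<noteq> bot}"

text \<open>\<open>v\<close> lies to the left of \<open>u\<close>; equivalently, the real determinant of \<open>(u, v)\<close> is positive.\<close>

definition ccw :: "complex \<Rightarrow> complex \<Rightarrow> bool" where
  "ccw u v \<longleftrightarrow> Im (cnj u * v) > 0"

definition simple_point :: "complex set \<Rightarrow> complex \<Rightarrow> bool" where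
  "simple_point K z \<longleftrightarrow> (\<exists>g \<epsilon>. arc g \<and> g (1/2) = z \<and> \<epsilon> > 0 \<and>
     K \<inter> ball z \<epsilon> = path_image g \<inter> ball z \<epsilon>)"

definition transverse_double_point :: "complex set \<Rightarrow> complex \<Rightarrow> bool" where
  "transverse_double_point K p \<longleftrightarrow> (\<exists>g1 g2 u v \<epsilon>.
     arc g1 \<and> arc g2 \<and> g1 (1/2) = p \<and> g2 (1/2) = p \<and> path_image g1 \<inter> path_image g2 = {p} \<and>
     (g1 has_vector_derivative u) (at (1/2)) \<and> (g2 has_vector_derivative v) (at (1/2)) \<and>
     ccw u v \<and> \<epsilon> > 0 \<and> K \<inter> ball p \<epsilon> = (path_image g1 \<union> path_image g2) \<inter> ball p \<epsilon>)"

text \<open>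
  Compactness together with the two local conditions says that the curve is a finite union of
  closed curves in the plane, with no multiple points except the transverse double points listed.
  Transversality means linearly independent tangent vectors; \<open>ccw u v\<close> is then no restriction,
  since the two branches can be interchanged.
\<close>

definition singular_link_diagram :: "diagram \<Rightarrow> bool" where
  "singular_link_diagram D \<longleftrightarrow>
     compact (curve D) \<and> finite (crossings D) \<and> crossings D \<subseteq> curve D \<and> reg D \<inter> sng D = {} \<and>
     (\<forall>z \<in> curve D - crossings D. simple_point (curve D) z) \<and>
     (\<forall>p \<in> crossings D. transverse_double_point (curve D) p) \<and>
     (\<forall>p \<in> reg D. \<exists>w \<in> directions D p. over D p = {w, - w})"


text \<open>
  Removing all crossings from the curve leaves the edges. An arc runs on through a regular crossing
  along the over-strand, so the arcs are obtained by gluing the two edges of each over-passage. As a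
  set of points, an arc does not contain the crossings over which it passes.
\<close>

definition edges :: "diagram \<Rightarrow> complex set set" where
  "edges D = components (curve D - crossings D)"

definition end_edge :: "diagram \<Rightarrow> complex \<Rightarrow> complex \<Rightarrow> complex set" where
  "end_edge D p u = (THE E. E \<in> edges D \<and> (\<forall>\<^sub>F z in end_at D p u. z \<in> E))"

definition arc_step :: "diagram \<Rightarrow> (complex \<times> complex) set" where
  "arc_step D = (\<Union>E \<in> edges D. E \<times> E) \<union>
     (\<Union>p \<in> reg D. \<Union>w \<in> over D p. end_edge D p w \<times> end_edge D p (- w))"

definition arc_of :: "diagram \<Rightarrow> complex \<Rightarrow> complex set" where
  "arc_of D z = (arc_step D)\<^sup>* `` {z}"

definition arcs :: "diagram \<Rightarrow> complex set set" where
  "arcs D = arc_of D ` (curve D - crossings D)"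

definition end_arc :: "diagram \<Rightarrow> complex \<Rightarrow> complex \<Rightarrow> complex set" where
  "end_arc D p u = (THE A. A \<in> arcs D \<and> (\<forall>\<^sub>F z in end_at D p u. z \<in> A))"

text \<open>
  At a singular crossing, each of the four rotations is a choice of consecutive directions
  \<open>u\<close> (top right) and \<open>v\<close> (top left); then \<open>- u\<close> is bottom left and \<open>- v\<close> is bottom right.
\<close>

definition colorings ::
  "'a set \<Rightarrow> ('a \<Rightarrow> 'a \<Rightarrow> 'a) \<Rightarrow> ('a \<Rightarrow> 'a \<Rightarrow> 'a) \<Rightarrow> ('a \<Rightarrow> 'a \<Rightarrow> 'a) \<Rightarrow>
   diagram \<Rightarrow> (complex set \<Rightarrow> 'a) set"
where
  "colorings X qop R1 R2 D = {c \<in> arcs D \<rightarrow>\<^sub>E X.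
     (\<forall>p \<in> reg D. \<forall>w \<in> over D p. \<forall>u \<in> directions D p - over D p.
        c (end_arc D p (- u)) = qop (c (end_arc D p u)) (c (end_arc D p w))) \<and>
     (\<forall>p \<in> sng D. \<forall>u \<in> directions D p. \<forall>v \<in> directions D p. ccw u v \<longrightarrow>
        c (end_arc D p (- u)) = R1 (c (end_arc D p v)) (c (end_arc D p u)) \<and>
        c (end_arc D p (- v)) = R2 (c (end_arc D p v)) (c (end_arc D p u)))}"


text \<open>
  Layers of tangle words: \<open>Sigma i\<close>, \<open>Sigma_bar i\<close>, \<open>Tau i\<close> are the crossings of positions
  \<open>i\<close> and \<open>i + 1\<close>; \<open>Cap i\<close> joins the bottom ends and \<open>Cup i\<close> the top ends at these positions (both
  are only used at the two rightmost positions); \<open>Straight\<close> is the trivial layer.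
  Layer \<open>k\<close> is drawn piecewise linearly in the strip \<open>- (k + 1) \<le> Im z \<le> - k\<close>,
  with position \<open>i\<close> at \<open>Re z = i\<close>.
\<close>

datatype layer = Straight | Sigma nat | Sigma_bar nat | Tau nat | Cap nat | Cup nat

definition node :: "nat \<Rightarrow> nat \<Rightarrow> complex" where
  "node i k = Complex (real i) (- real k)"

definition center :: "nat \<Rightarrow> nat \<Rightarrow> complex" where
  "center i k = Complex (real i + 1/2) (- real k - 1/2)"

definition verticals :: "nat set \<Rightarrow> nat \<Rightarrow> complex set" where
  "verticals I k = (\<Union>j \<in> I. closed_segment (node j k) (node j (k + 1)))"

definition cross_at :: "nat \<Rightarrow> nat \<Rightarrow> complex set" where
  "cross_at i k = closed_segment (node i k) (node (i + 1) (k + 1)) \<union>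
                  closed_segment (node (i + 1) k) (node i (k + 1))"

fun draw :: "nat \<Rightarrow> nat \<Rightarrow> layer \<Rightarrow> complex set" where
  "draw n k Straight = verticals {1..n} k"
| "draw n k (Sigma i) = verticals ({1..n} - {i, i + 1}) k \<union> cross_at i k"
| "draw n k (Sigma_bar i) = verticals ({1..n} - {i, i + 1}) k \<union> cross_at i k"
| "draw n k (Tau i) = verticals ({1..n} - {i, i + 1}) k \<union> cross_at i k"
| "draw n k (Cap i) = verticals ({1..n} - {i, i + 1}) k \<union>
     closed_segment (node i (k + 1)) (center i k) \<union>
     closed_segment (center i k) (node (i + 1) (k + 1))"
| "draw n k (Cup i) = verticals ({1..n} - {i, i + 1}) k \<union>
     closed_segment (node i k) (center i k) \<union>
     closed_segment (center i k) (node (i + 1) k)"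

definition tangle :: "nat \<Rightarrow> layer list \<Rightarrow> diagram" where
  "tangle n ls = \<lparr>
     curve = (\<Union>k < length ls. draw n k (ls ! k)),
     reg = {center i k | i k. k < length ls \<and> ls ! k \<in> {Sigma i, Sigma_bar i}},
     sng = {center i k | i k. k < length ls \<and> ls ! k = Tau i},
     over = (\<lambda>z. if \<exists>i k. k < length ls \<and> ls ! k = Sigma i \<and> z = center i k
                 then {sgn (1 - \<i>), - sgn (1 - \<i>)}
                 else {sgn (1 + \<i>), - sgn (1 + \<i>)})\<rparr>"

text \<open>
  All words are padded with trivial layers to height 3, so that the two sides of every move are
  drawn in the same box and have the same boundary points. Rotating the box exchanges kinks whose
  loop is on the right with kinks whose loop is on the left.
\<close>

definition box :: "complex set" where
  "box = cbox (Complex 0 (- 3)) (Complex 4 0)"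

inductive local_move :: "diagram \<Rightarrow> diagram \<Rightarrow> bool" where
  RI: "local_move (tangle 3 [Cap 2, Sigma 1, Cup 2])
                  (tangle 1 [Straight, Straight, Straight])"
| RI_bar: "local_move (tangle 3 [Cap 2, Sigma_bar 1, Cup 2])
                      (tangle 1 [Straight, Straight, Straight])"
| RII: "local_move (tangle 2 [Sigma_bar 1, Sigma 1, Straight])
                   (tangle 2 [Straight, Straight, Straight])"
| RII_bar: "local_move (tangle 2 [Sigma 1, Sigma_bar 1, Straight])
                       (tangle 2 [Straight, Straight, Straight])"
| RIII: "local_move (tangle 3 [Sigma 1, Sigma_bar 2, Sigma_bar 1])
                    (tangle 3 [Sigma_bar 2, Sigma_bar 1, Sigma 2])"
| RIVa: "local_move (tangle 3 [Sigma 1, Tau 2, Sigma_bar 1])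
                    (tangle 3 [Sigma_bar 2, Tau 1, Sigma 2])"
| RIVb: "local_move (tangle 3 [Sigma_bar 1, Tau 2, Sigma 1])
                    (tangle 3 [Sigma 2, Tau 1, Sigma_bar 2])"
| RV: "local_move (tangle 2 [Sigma_bar 1, Tau 1, Sigma 1])
                  (tangle 2 [Straight, Tau 1, Straight])"

definition planar_isotopy :: "(complex \<Rightarrow> complex) \<Rightarrow> bool" where
  "planar_isotopy h \<longleftrightarrow>
     homotopic_with_canon (\<lambda>f. \<exists>g. homeomorphism UNIV UNIV f g) UNIV UNIV id h"

text \<open>
  \<open>placed h T D \<Delta>\<close>: the disk \<open>\<Delta>\<close> is the image of the box under \<open>h\<close>, and the part of \<open>D\<close> in \<open>\<Delta>\<close> is
  the image of \<open>T\<close>. To carry tangent directions over, \<open>h\<close> has to have an orientation-preserving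
  derivative at the crossings.
\<close>

definition placed :: "(complex \<Rightarrow> complex) \<Rightarrow> diagram \<Rightarrow> diagram \<Rightarrow> complex set \<Rightarrow> bool" where
  "placed h T D \<Delta> \<longleftrightarrow> planar_isotopy h \<and> \<Delta> = h ` box \<and>
     curve D \<inter> \<Delta> = h ` curve T \<and> reg D \<inter> \<Delta> = h ` reg T \<and> sng D \<inter> \<Delta> = h ` sng T \<and>
     (\<forall>q \<in> crossings T. \<exists>h'. (h has_derivative h') (at q) \<and> ccw (h' 1) (h' \<i>) \<and>
        (q \<in> reg T \<longrightarrow> over D (h q) = (\<lambda>w. sgn (h' w)) ` over T q))"

definition equal_outside :: "complex set \<Rightarrow> diagram \<Rightarrow> diagram \<Rightarrow> bool" where
  "equal_outside \<Delta> D D' \<longleftrightarrow>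
     curve D - \<Delta> = curve D' - \<Delta> \<and> reg D - \<Delta> = reg D' - \<Delta> \<and> sng D - \<Delta> = sng D' - \<Delta> \<and>
     (\<forall>p \<in> reg D - \<Delta>. over D p = over D' p)"

definition single_move :: "complex set \<Rightarrow> diagram \<Rightarrow> diagram \<Rightarrow> bool" where
  "single_move \<Delta> D D' \<longleftrightarrow> equal_outside \<Delta> D D' \<and>
     (\<exists>T T' h h'. (local_move T T' \<or> local_move T' T) \<and>
        placed h T D \<Delta> \<and> placed h' T' D' \<Delta> \<and> (\<forall>z \<in> frontier box. h z = h' z))"

definition same_colors_outside ::
  "complex set \<Rightarrow> diagram \<Rightarrow> diagram \<Rightarrow> (complex set \<Rightarrow> 'a) \<Rightarrow> (complex set \<Rightarrow> 'a) \<Rightarrow> bool"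
where
  "same_colors_outside \<Delta> D D' c c' \<longleftrightarrow>
     (\<forall>z \<in> curve D - crossings D - \<Delta>. c (arc_of D z) = c' (arc_of D' z))"

end

theory Submission
  imports Defs
begin

text \<open>
  A coloring is the same as a function on the non-crossing points of the curve that is locally
  constant and whose germs at the ends of each crossing satisfy the crossing relations. These
  conditions are local, so a coloring of the diagram splits into its part outside the disk and a
  coloring of the tangle inside, which have to agree at the boundary points of the tangle. In a tangle
  word without caps and cups, the colors at the top determine the colors of every level, and the
  singquandle axioms say that the two words of a move send every top coloring to the same bottom
  coloring. The two sides of RI have only constant colorings.
\<close>

section \<open>Ends of the curve at a crossing\<close>

text \<open>Arcs are global: one arc may enter the disk several times, and a move changes which
  edges are glued to an arc, even outside the disk. Edges with germs at their ends avoid this, at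
  the price of turning the gluing along an over-passage into a condition on colors. The obstacle is
  then geometric. A placement is only a homeomorphism of the plane that is differentiable at the
  crossings, so tangent directions can be carried over there and nowhere else; all other facts rest
  on continuity, connectedness and compactness. The two placements of a move agree on the frontier
  of the box only, hence their interiors cannot be compared point by point, and the colors at the
  boundary points are the only link between the two tangles. For uniqueness these colors have to be
  forced by the coloring outside the disk, although the boundary of the disk belongs to the disk.
  This holds because a diagram is locally an arc and cannot stop at a boundary point.\<close>

definition germ_value :: "diagram \<Rightarrow> (complex \<Rightarrow> 'a) \<Rightarrow> complex \<Rightarrow> complex \<Rightarrow> 'a \<Rightarrow> bool" where
  "germ_value D f p u x \<longleftrightarrow> (\<forall>\<^sub>F z in end_at D p u. f z = x)"

lemma sgn_tendsto_end_at: "((\<lambda>z. sgn (z - p)) \<longlongrightarrow> u) (end_at D p u)"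
  unfolding end_at_def by (rule filterlim_mono[OF filterlim_filtercomap]) auto

lemma eventually_end_at:
  "\<forall>\<^sub>F z in at p within curve D. P z \<Longrightarrow> \<forall>\<^sub>F z in end_at D p u. P z"
  unfolding end_at_def by (erule filter_leD[rotated]) simp

lemma norm_direction:
  assumes "u \<in> directions D p"
  shows "norm u = 1"
proof -
  have nb: "end_at D p u \<noteq> bot" using assms by (simp add: directions_def)
  have "\<forall>\<^sub>F z in end_at D p u. norm (sgn (z - p)) = 1"
    by (rule eventually_end_at) (auto simp: eventually_at_filter norm_sgn)
  moreover have "((\<lambda>z. norm (sgn (z - p))) \<longlongrightarrow> norm u) (end_at D p u)"
    by (intro tendsto_intros sgn_tendsto_end_at)
  ultimately have "((\<lambda>z. 1) \<longlongrightarrow> norm u) (end_at D p u)"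
    using tendsto_cong by force
  then show ?thesis using nb tendsto_const_iff by metis
qed

lemma end_at_local:
  assumes "open U" "p \<in> U" "curve D \<inter> U = curve D' \<inter> U"
  shows "end_at D p = end_at D' p"
proof -
  have "at p within curve D = at p within curve D'"
    by (rule at_within_nhd[of p U]) (use assms in auto)
  then show ?thesis by (auto simp: end_at_def)
qed

text \<open>Points whose direction is close to \<open>d j\<close> cannot lie on a branch with
  another limit direction, because distinct directions have disjoint neighbourhoods;
  \<open>cover\<close> then leaves only \<open>B j\<close>. It does not matter how the branches
  arise: transverse double points and the centers of drawn crossings are both treated this
  way.\<close>

lemma star_directions:
  fixes B :: "'i \<Rightarrow> complex set" and d :: "'i \<Rightarrow> complex"
  assumes fin: "finite J" and inj: "inj_on d J"
    and sub: "\<And>j. j \<in> J \<Longrightarrow> B j \<subseteq> curve D"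
    and nb: "\<And>j. j \<in> J \<Longrightarrow> at p within B j \<noteq> bot"
    and lim: "\<And>j. j \<in> J \<Longrightarrow> ((\<lambda>z. sgn (z - p)) \<longlongrightarrow> d j) (at p within B j)"
    and cover: "\<forall>\<^sub>F z in at p within curve D. z \<in> (\<Union>j\<in>J. B j)"
  shows "directions D p = d ` J"
    and "j \<in> J \<Longrightarrow> \<forall>\<^sub>F z in end_at D p (d j). z \<in> B j"
proof -
  have le: "at p within B j \<le> end_at D p (d j)" if "j \<in> J" for j
    unfolding end_at_def using sub[OF that] lim[OF that]
    by (simp add: at_le filterlim_iff_le_filtercomap)
  have avoid: "\<forall>\<^sub>F z in end_at D p u. z \<notin> B j" if "j \<in> J" "u \<noteq> d j" for u j
  proof -
    obtain U V where UV: "open U" "open V" "u \<in> U" "d j \<in> V" "U \<inter> V = {}"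
      using hausdorff[OF \<open>u \<noteq> d j\<close>] by blast
    have "\<forall>\<^sub>F z in at p within B j. sgn (z - p) \<in> V"
      using lim[OF that(1)] UV by (auto intro: topological_tendstoD)
    then have "\<forall>\<^sub>F z in at p within curve D. z \<in> B j \<longrightarrow> sgn (z - p) \<in> V"
      unfolding eventually_at_filter by eventually_elim auto
    then have "\<forall>\<^sub>F z in end_at D p u. z \<in> B j \<longrightarrow> sgn (z - p) \<in> V"
      by (rule eventually_end_at)
    moreover have "\<forall>\<^sub>F z in end_at D p u. sgn (z - p) \<in> U"
      by (rule topological_tendstoD[OF sgn_tendsto_end_at UV(1,3)])
    ultimately show ?thesis by eventually_elim (use UV in auto)
  qed
  \<comment> \<open>Finitely many exclusions hold simultaneously close to \<open>p\<close>. If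
    \<open>u\<close> is none of the \<open>d j\<close>, nothing is left and the filter is
    trivial.\<close>
  have ev: "\<forall>\<^sub>F z in end_at D p u. \<exists>j\<in>J. z \<in> B j \<and> u = d j" for u
  proof -
    have "\<forall>\<^sub>F z in end_at D p u. \<forall>j\<in>J. u \<noteq> d j \<longrightarrow> z \<notin> B j"
      using fin avoid by (intro eventually_ball_finite) (auto simp: eventually_mono)
    with eventually_end_at[OF cover] show ?thesis by eventually_elim auto
  qed
  show "directions D p = d ` J"
  proof
    show "directions D p \<subseteq> d ` J"
    proof
      fix u assume "u \<in> directions D p"
      then have "end_at D p u \<noteq> bot" by (simp add: directions_def)
      from eventually_happens'[OF this ev] show "u \<in> d ` J" by auto
    qed
    show "d ` J \<subseteq> directions D p"
      using le nb by (fastforce simp: directions_def bot_unique)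
  qed
  show "\<forall>\<^sub>F z in end_at D p (d j). z \<in> B j" if "j \<in> J"
    using ev[of "d j"] by eventually_elim (use inj that in \<open>auto dest: inj_onD\<close>)
qed

section \<open>Arcs near their midpoint and the tangents of half-branches\<close>

lemma arc_neighbourhood:
  fixes g :: "real \<Rightarrow> complex"
  assumes "arc g" "open U" "g (1/2) \<in> U"
  obtains \<delta> where "0 < \<delta>" "\<delta> < 1/2" "g ` {1/2-\<delta>..1/2+\<delta>} \<subseteq> U"
    "\<forall>\<^sub>F z in nhds (g (1/2)). z \<in> path_image g \<longrightarrow> z \<in> g ` {1/2-\<delta><..<1/2+\<delta>}"
proof -
  have cont: "continuous_on {0..1} g" and inj: "inj_on g {0..1}"
    using assms by (auto simp: arc_def path_def)
  obtain e where e: "e > 0" "ball (g (1/2)) e \<subseteq> U"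
    using assms open_contains_ball by blast
  obtain d where d: "d > 0" "\<And>t. t \<in> {0..1} \<Longrightarrow> dist t (1/2) < d \<Longrightarrow> dist (g t) (g (1/2)) < e"
    using cont[unfolded continuous_on_iff, rule_format, of "1/2" e] e by auto
  \<comment> \<open>The bound \<open>1/4\<close> keeps the closed interval inside
    \<open>{0..1}\<close>, and \<open>d/2\<close> keeps the distance below \<open>d\<close> at the
    end points as well.\<close>
  define \<delta> where "\<delta> = min (d/2) (1/4)"
  have \<delta>: "0 < \<delta>" "\<delta> < 1/2" "\<delta> < d" using d by (auto simp: \<delta>_def)
  have 1: "g ` {1/2-\<delta>..1/2+\<delta>} \<subseteq> U"
  proof
    fix y assume "y \<in> g ` {1/2-\<delta>..1/2+\<delta>}"
    then obtain t where t: "t \<in> {1/2-\<delta>..1/2+\<delta>}" "y = g t" by auto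
    then have "t \<in> {0..1}" "dist t (1/2) < d" using \<delta> by (auto simp: dist_real_def)
    then show "y \<in> U" using d(2) e t by (auto simp: dist_commute)
  qed
  \<comment> \<open>The remaining parameters form a compact set whose image misses the midpoint by
    injectivity, so points of the arc near the midpoint come from parameters near
    \<open>1/2\<close>.\<close>
  define S where "S = {0..1} - {1/2-\<delta><..<1/2+\<delta>}"
  have "compact (g ` S)"
    using cont by (intro compact_continuous_image) (auto simp: S_def intro: continuous_on_subset compact_diff)
  moreover have "g (1/2) \<notin> g ` S"
    using inj \<delta> by (auto simp: S_def dest!: inj_onD)
  ultimately have "\<forall>\<^sub>F z in nhds (g (1/2)). z \<in> - (g ` S)"
    by (intro eventually_nhds_in_open) (auto simp: compact_imp_closed)
  then have "\<forall>\<^sub>F z in nhds (g (1/2)). z \<in> path_image g \<longrightarrow> z \<in> g ` {1/2-\<delta><..<1/2+\<delta>}"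
    by eventually_elim (auto simp: S_def path_image_def)
  with \<delta> 1 show ?thesis by (intro that) auto
qed

text \<open>The quotient of \<open>f z - f q\<close> by \<open>norm (z - q)\<close> tends to
  \<open>f' u\<close>, and \<open>sgn\<close> ignores positive factors and is continuous away from
  0. The domain is kept general: the lemma is applied to real parameters of arcs and to plane
  homeomorphisms.\<close>

lemma sgn_difference_tendsto:
  fixes f :: "'a::real_normed_vector \<Rightarrow> 'b::real_normed_vector"
  assumes der: "(f has_derivative f') (at q)" and F: "F \<le> at q"
    and lim: "((\<lambda>z. sgn (z - q)) \<longlongrightarrow> u) F" and nz: "f' u \<noteq> 0"
  shows "((\<lambda>z. sgn (f z - f q)) \<longlongrightarrow> sgn (f' u)) F"
proof -
  have bl: "bounded_linear f'" using der by (rule has_derivative_bounded_linear)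
  interpret bounded_linear f' by (rule bl)
  have "((\<lambda>z. norm (f z - f q - f' (z - q)) / norm (z - q)) \<longlongrightarrow> 0) F"
    using der F by (auto simp: has_derivative_iff_norm intro: filterlim_mono)
  then have "((\<lambda>z. norm ((f z - f q - f' (z - q)) /\<^sub>R norm (z - q))) \<longlongrightarrow> 0) F"
    by (simp add: divide_inverse mult.commute)
  then have "((\<lambda>z. (f z - f q - f' (z - q)) /\<^sub>R norm (z - q)) \<longlongrightarrow> 0) F"
    by (rule tendsto_norm_zero_cancel)
  then have "((\<lambda>z. (f z - f q - f' (z - q)) /\<^sub>R norm (z - q) + f' (sgn (z - q))) \<longlongrightarrow> 0 + f' u) F"
    by (intro tendsto_add tendsto lim)
  then have "((\<lambda>z. (f z - f q) /\<^sub>R norm (z - q)) \<longlongrightarrow> f' u) F"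
    by (simp add: sgn_div_norm scale flip: scaleR_add_right)
  then have *: "((\<lambda>z. sgn ((f z - f q) /\<^sub>R norm (z - q))) \<longlongrightarrow> sgn (f' u)) F"
    using nz by (rule tendsto_sgn)
  have "\<forall>\<^sub>F z in at q. sgn ((f z - f q) /\<^sub>R norm (z - q)) = sgn (f z - f q)"
    by (auto simp: eventually_at_filter sgn_scaleR)
  then have "\<forall>\<^sub>F z in F. sgn ((f z - f q) /\<^sub>R norm (z - q)) = sgn (f z - f q)"
    using F by (rule filter_leD[rotated])
  then show ?thesis using * tendsto_cong by fast
qed

text \<open>Only parameters above \<open>1/2\<close> are considered, so that the tangent has a
  definite sign; the other half of the arc is reached through the reversed arc.\<close>

lemma branch_direction:
  fixes g :: "real \<Rightarrow> complex"
  assumes "arc g" "g (1/2) = p" "(g has_vector_derivative u) (at (1/2))" "u \<noteq> 0"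
    and \<delta>: "0 < \<delta>" "\<delta> < 1/2"
  shows "at p within g ` {1/2<..<1/2+\<delta>} \<noteq> bot"
    and "((\<lambda>z. sgn (z - p)) \<longlongrightarrow> sgn u) (at p within g ` {1/2<..<1/2+\<delta>})"
proof -
  let ?B = "g ` {1/2<..<1/2+\<delta>}"
  have inj: "inj_on g {0..1}" using assms by (auto simp: arc_def)
  have ev: "\<forall>\<^sub>F t in at_right (1/2). t \<in> {1/2<..<1/2+\<delta>}"
    using \<delta> by (intro eventually_at_right_real) auto
  have ne: "g t \<noteq> p" if "t \<in> {1/2<..<1/2+\<delta>}" for t
    using inj_onD[OF inj, of t "1/2"] that \<delta> assms(2) by auto
  have "isCont g (1/2)" using assms(3) by (rule has_vector_derivative_continuous)
  then have "(g \<longlongrightarrow> p) (at (1/2))" using assms(2) by (simp add: isCont_def)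
  then have "(g \<longlongrightarrow> p) (at_right (1/2))" by (rule filterlim_mono) (auto simp: at_le)
  moreover have "\<forall>\<^sub>F t in at_right (1/2). g t \<in> ?B \<and> g t \<noteq> p"
    using ev by eventually_elim (use ne in auto)
  ultimately have "filterlim g (at p within ?B) (at_right (1/2))"
    by (simp add: filterlim_at)
  then show "at p within ?B \<noteq> bot"
    using filterlim_iff_le_filtercomap trivial_limit_at_right_real[of "1/2::real"]
    by (metis filtercomap_bot bot_unique)
  have right: "((\<lambda>t. sgn (g t - p)) \<longlongrightarrow> sgn u) (at_right (1/2))"
  proof -
    have "\<forall>\<^sub>F t::real in at_right (1/2). sgn (t - 1/2) = 1"
      by (auto simp: eventually_at_filter)
    then have "((\<lambda>t::real. sgn (t - 1/2)) \<longlongrightarrow> 1) (at_right (1/2))"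
      by (simp add: tendsto_eventually)
    from sgn_difference_tendsto[OF assms(3)[unfolded has_vector_derivative_def] _ this] assms
    show ?thesis by (auto simp: at_le)
  qed
  show "((\<lambda>z. sgn (z - p)) \<longlongrightarrow> sgn u) (at p within ?B)"
  proof (rule topological_tendstoI)
    fix V assume V: "open V" "sgn u \<in> V"
    have "\<forall>\<^sub>F t in at_right (1/2). sgn (g t - p) \<in> V"
      using right V by (rule topological_tendstoD)
    then obtain b where b: "b > 1/2" "\<And>t. 1/2 < t \<Longrightarrow> t < b \<Longrightarrow> sgn (g t - p) \<in> V"
      by (auto simp: eventually_at_right_field)
    \<comment> \<open>The compact image of the late parameters misses \<open>p\<close>. Near
      \<open>p\<close> the half-branch therefore consists of parameters below \<open>b\<close>,
      where the direction is already in \<open>V\<close>.\<close>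
    define U where "U = - g ` {b..1}"
    have "continuous_on {b..1} g"
      using assms(1) b by (auto simp: arc_def path_def intro: continuous_on_subset)
    then have "open U" unfolding U_def
      by (metis open_Compl compact_imp_closed compact_continuous_image compact_Icc)
    moreover have "p \<in> U" using inj b assms(2) by (auto simp: U_def dest: inj_onD)
    ultimately have "\<forall>\<^sub>F z in nhds p. z \<in> U" by (rule eventually_nhds_in_open)
    then show "\<forall>\<^sub>F z in at p within ?B. sgn (z - p) \<in> V"
      unfolding eventually_at_filter
    proof eventually_elim
      case (elim z)
      show ?case
      proof (intro impI)
        assume "z \<in> ?B"
        then obtain t where t: "t \<in> {1/2<..<1/2+\<delta>}" "z = g t" by auto
        with elim \<delta> have "t < b" by (force simp: U_def)
        with t b show "sgn (z - p) \<in> V" by auto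
      qed
    qed
  qed
qed

text \<open>Each of the two arcs gives two half-branches with opposite tangents, and transversality
  makes all four directions distinct, as \<open>star_directions\<close> demands. The open set
  \<open>U\<close> allows the branches to be kept away from other crossings.\<close>

lemma double_point_branches:
  assumes "transverse_double_point (curve D) p" "open U" "p \<in> U"
  obtains J :: "nat set" and B d where "finite J" "inj_on d J"
    "\<And>j. j \<in> J \<Longrightarrow> B j \<subseteq> curve D \<inter> U - {p}" "\<And>j. j \<in> J \<Longrightarrow> connected (B j)"
    "\<And>j. j \<in> J \<Longrightarrow> at p within B j \<noteq> bot"
    "\<And>j. j \<in> J \<Longrightarrow> ((\<lambda>z. sgn (z - p)) \<longlongrightarrow> d j) (at p within B j)"
    "\<forall>\<^sub>F z in at p within curve D. z \<in> (\<Union>j\<in>J. B j)"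
    "\<And>j. j \<in> J \<Longrightarrow> - d j \<in> d ` J"
proof -
  obtain g1 g2 u v \<epsilon> where
    arcs: "arc g1" "arc g2" "g1 (1/2) = p" "g2 (1/2) = p" "path_image g1 \<inter> path_image g2 = {p}"
    and der: "(g1 has_vector_derivative u) (at (1/2))" "(g2 has_vector_derivative v) (at (1/2))"
    and uv: "ccw u v" and \<epsilon>: "\<epsilon> > 0"
    and K: "curve D \<inter> ball p \<epsilon> = (path_image g1 \<union> path_image g2) \<inter> ball p \<epsilon>"
    using assms(1) unfolding transverse_double_point_def by auto
  have op: "open (U \<inter> ball p \<epsilon>)" "p \<in> U \<inter> ball p \<epsilon>" using assms \<epsilon> by auto
  obtain \<delta>1 where \<delta>1: "0 < \<delta>1" "\<delta>1 < 1/2" "g1 ` {1/2-\<delta>1..1/2+\<delta>1} \<subseteq> U \<inter> ball p \<epsilon>"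
    "\<forall>\<^sub>F z in nhds p. z \<in> path_image g1 \<longrightarrow> z \<in> g1 ` {1/2-\<delta>1<..<1/2+\<delta>1}"
    by (rule arc_neighbourhood[OF arcs(1) op(1), unfolded arcs(3), OF op(2)])
  obtain \<delta>2 where \<delta>2: "0 < \<delta>2" "\<delta>2 < 1/2" "g2 ` {1/2-\<delta>2..1/2+\<delta>2} \<subseteq> U \<inter> ball p \<epsilon>"
    "\<forall>\<^sub>F z in nhds p. z \<in> path_image g2 \<longrightarrow> z \<in> g2 ` {1/2-\<delta>2<..<1/2+\<delta>2}"
    by (rule arc_neighbourhood[OF arcs(2) op(1), unfolded arcs(4), OF op(2)])
  \<comment> \<open>Four branches: each arc and its reversal, with tangents \<open>u\<close>,
    \<open>- u\<close>, \<open>v\<close>, \<open>- v\<close>, all read for parameters above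
    \<open>1/2\<close>.\<close>
  define G where "G = (\<lambda>j::nat. [g1, reversepath g1, g2, reversepath g2] ! j)"
  define e where "e = (\<lambda>j::nat. [u, - u, v, - v] ! j)"
  define \<delta> where "\<delta> = (\<lambda>j::nat. [\<delta>1, \<delta>1, \<delta>2, \<delta>2] ! j)"
  define B where "B = (\<lambda>j. G j ` {1/2<..<1/2 + \<delta> j})"
  define J where "J = {0,1,2,3::nat}"
  have rev: "((reversepath g) has_vector_derivative - w) (at (1/2))"
    if "(g has_vector_derivative w) (at (1/2))" for g :: "real \<Rightarrow> complex" and w
  proof -
    have "((\<lambda>t. 1 - t) has_vector_derivative - 1) (at (1/2::real))"
      by (auto intro!: derivative_eq_intros)
    from vector_diff_chain_at[OF this, of g w] that show ?thesis
      by (simp add: reversepath_def o_def)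
  qed
  define Q where "Q = (\<lambda>g w t. arc g \<and> g (1/2) = p \<and> (g has_vector_derivative w) (at (1/2)) \<and>
    g ` {1/2-t..1/2+t} \<subseteq> U \<inter> ball p \<epsilon> \<and> 0 < t \<and> t < 1/2 \<and>
    (path_image g = path_image g1 \<or> path_image g = path_image g2))"
  have Q_rev: "Q (reversepath g) (- w) t" if "Q g w t" for g w t
  proof -
    have "reversepath g (1/2) = g (1/2)"
      by (simp add: reversepath_def)
    moreover have "(\<lambda>x. 1 - x) ` {1/2-t..1/2+t} = {1/2-t..1/2+t}"
      by (auto simp: image_iff intro!: bexI[of _ "1 - _"])
    then have "reversepath g ` {1/2-t..1/2+t} = g ` {1/2-t..1/2+t}"
      unfolding reversepath_def by (metis image_image)
    ultimately show ?thesis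
      using that rev[of g w] unfolding Q_def by (metis arc_reversepath path_image_reversepath)
  qed
  have "Q g1 u \<delta>1" "Q g2 v \<delta>2" using arcs der \<delta>1 \<delta>2 by (auto simp: Q_def)
  then have "Q (G j) (e j) (\<delta> j)" if "j \<in> J" for j
    using that Q_rev by (auto simp: J_def G_def e_def \<delta>_def)
  then have G: "arc (G j)" "G j (1/2) = p" "(G j has_vector_derivative e j) (at (1/2))"
    "G j ` {1/2-\<delta> j..1/2+\<delta> j} \<subseteq> U \<inter> ball p \<epsilon>" "0 < \<delta> j" "\<delta> j < 1/2"
    "path_image (G j) = path_image g1 \<or> path_image (G j) = path_image g2"
    if "j \<in> J" for j
    using that unfolding Q_def by blast+
  have nz: "u \<noteq> 0" "v \<noteq> 0" using uv by (auto simp: ccw_def)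
  then have e0: "e j \<noteq> 0" if "j \<in> J" for j using that by (auto simp: J_def e_def)
  \<comment> \<open>A linear relation would make the real determinant of \<open>u\<close> and
    \<open>v\<close> vanish.\<close>
  have indep: "a *\<^sub>R u \<noteq> b *\<^sub>R v" if "a \<noteq> 0" for a b
  proof
    assume eq: "a *\<^sub>R u = b *\<^sub>R v"
    have "a * Im (cnj u * v) = Im (cnj (a *\<^sub>R u) * v)" by (simp add: algebra_simps)
    also have "\<dots> = 0" unfolding eq by simp
    finally show False using uv that by (simp add: ccw_def)
  qed
  have "sgn u \<noteq> sgn v" "sgn u \<noteq> - sgn v"
    using indep[of "inverse (norm u)" "inverse (norm v)"] indep[of "inverse (norm u)" "- inverse (norm v)"] nz
    by (auto simp: sgn_div_norm)
  moreover have "w \<noteq> - w" if "w \<noteq> 0" for w :: complex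
    using that by (auto simp: complex_eq_iff)
  then have "sgn u \<noteq> - sgn u" "sgn v \<noteq> - sgn v" using nz by (simp_all add: sgn_zero_iff)
  ultimately have ne: "sgn u \<noteq> sgn v" "sgn u \<noteq> - sgn v" "sgn u \<noteq> - sgn u" "sgn v \<noteq> - sgn v"
    "- sgn u \<noteq> sgn v" by (auto, metis minus_minus)
  have "inj_on (\<lambda>j. sgn (e j)) J"
    using ne ne[symmetric] by (auto simp: inj_on_def J_def e_def sgn_minus)
  moreover have "\<And>j. j \<in> J \<Longrightarrow> B j \<subseteq> curve D \<inter> U - {p}"
  proof -
    fix j assume j: "j \<in> J"
    note Gj = G[OF j]
    have sub: "{1/2<..<1/2 + \<delta> j} \<subseteq> {0..1}" "{1/2<..<1/2 + \<delta> j} \<subseteq> {1/2-\<delta> j..1/2+\<delta> j}"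
      using Gj(5,6) by auto
    have "p \<notin> B j"
    proof
      assume "p \<in> B j"
      then obtain t where t: "t \<in> {1/2<..<1/2 + \<delta> j}" "G j t = G j (1/2)"
        using Gj(2) by (auto simp: B_def)
      moreover have "t \<in> {0..1}" using t sub(1) by blast
      ultimately show False using Gj(1) by (auto simp: arc_def dest!: inj_onD)
    qed
    moreover have "B j \<subseteq> path_image (G j)" using sub(1) by (auto simp: B_def path_image_def)
    moreover have "B j \<subseteq> U \<inter> ball p \<epsilon>" using sub(2) Gj(4) by (auto simp: B_def)
    ultimately show "B j \<subseteq> curve D \<inter> U - {p}" using Gj(7) K by blast
  qed
  moreover have "connected (B j)" if "j \<in> J" for j
    unfolding B_def using G[OF that]
    by (intro connected_continuous_image) (auto simp: arc_def path_def elim!: continuous_on_subset)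
  moreover have "at p within B j \<noteq> bot"
    "((\<lambda>z. sgn (z - p)) \<longlongrightarrow> sgn (e j)) (at p within B j)" if "j \<in> J" for j
    unfolding B_def using branch_direction[OF G(1,2,3)[OF that] e0 G(5,6)] that by auto
  moreover have "\<forall>\<^sub>F z in at p within curve D. z \<in> (\<Union>j\<in>J. B j)"
  proof -
    \<comment> \<open>The parameter \<open>1 - s\<close> of the reversed arc moves the lower half of
      the interval to the upper half.\<close>
    have half: "g ` {1/2-t<..<1/2+t} - {g (1/2)}
      \<subseteq> g ` {1/2<..<1/2+t} \<union> reversepath g ` {1/2<..<1/2+t}"
      for g :: "real \<Rightarrow> complex" and t
    proof
      fix z assume z: "z \<in> g ` {1/2-t<..<1/2+t} - {g (1/2)}"
      then obtain s where s: "s \<in> {1/2-t<..<1/2+t}" "z = g s" by auto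
      have "s \<noteq> 1/2" using z s by blast
      note s = s this
      show "z \<in> g ` {1/2<..<1/2+t} \<union> reversepath g ` {1/2<..<1/2+t}"
      proof (cases "s > 1/2")
        case False
        then have "z = reversepath g (1 - s)" "1 - s \<in> {1/2<..<1/2+t}"
          using s by (auto simp: reversepath_def)
        then show ?thesis by blast
      qed (use s in auto)
    qed
    have BJ: "(\<Union>j\<in>J. B j) = B 0 \<union> B 1 \<union> B 2 \<union> B 3" by (auto simp: J_def)
    have "\<forall>\<^sub>F z in nhds p. z \<in> ball p \<epsilon>" using \<epsilon> by (intro eventually_nhds_in_open) auto
    with \<delta>1(4) \<delta>2(4) show ?thesis unfolding eventually_at_filter
    proof eventually_elim
      case (elim z)
      show ?case
      proof (intro impI)
        assume z: "z \<noteq> p" "z \<in> curve D"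
        then have "z \<in> path_image g1 \<or> z \<in> path_image g2" using K elim by blast
        then have "z \<in> g1 ` {1/2-\<delta>1<..<1/2+\<delta>1} - {g1 (1/2)} \<or> z
          \<in> g2 ` {1/2-\<delta>2<..<1/2+\<delta>2} - {g2 (1/2)}"
          using elim z arcs by auto
        with half[of g1 \<delta>1] half[of g2 \<delta>2] show "z \<in> (\<Union>j\<in>J. B j)"
          unfolding BJ by (auto simp: B_def G_def \<delta>_def numeral_2_eq_2 numeral_3_eq_3)
      qed
    qed
  qed
  moreover have "- sgn (e j) \<in> (\<lambda>j. sgn (e j)) ` J" if "j \<in> J" for j
    using that by (auto simp: J_def e_def sgn_minus)
  ultimately show ?thesis by (intro that[of J "\<lambda>j. sgn (e j)" B]) (auto simp: J_def)
qed

section \<open>Colorings as locally constant functions\<close>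

text \<open>With all other crossings removed from the neighbourhood, the half-branch in direction
  \<open>u\<close> is a connected set free of crossings, so it lies in one edge. This is what gives
  meaning to the definite descriptions \<open>end_edge\<close> and \<open>end_arc\<close>.\<close>

lemma crossing_germ:
  assumes D: "singular_link_diagram D" "p \<in> crossings D" and u: "u \<in> directions D p"
  shows "- u \<in> directions D p"
    and "\<exists>C. connected C \<and> C \<subseteq> curve D - crossings D \<and> (\<forall>\<^sub>F z in end_at D p u. z \<in> C)"
proof -
  have "transverse_double_point (curve D) p" using D by (auto simp: singular_link_diagram_def)
  moreover have "open (- (crossings D - {p}))"
    using D by (intro open_Compl finite_imp_closed) (auto simp: singular_link_diagram_def)
  ultimately obtain J :: "nat set" and B d where J: "finite J" "inj_on d J"
    "\<And>j. j \<in> J \<Longrightarrow> B j \<subseteq> curve D \<inter> - (crossings D - {p}) - {p}" "\<And>j. j \<in> J \<Longrightarrow> connected (B j)"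
    "\<And>j. j \<in> J \<Longrightarrow> at p within B j \<noteq> bot"
    "\<And>j. j \<in> J \<Longrightarrow> ((\<lambda>z. sgn (z - p)) \<longlongrightarrow> d j) (at p within B j)"
    "\<forall>\<^sub>F z in at p within curve D. z \<in> (\<Union>j\<in>J. B j)"
    "\<And>j. j \<in> J \<Longrightarrow> - d j \<in> d ` J"
    by (rule double_point_branches) auto
  have sub: "\<And>j. j \<in> J \<Longrightarrow> B j \<subseteq> curve D" using J(3) by blast
  have star: "directions D p = d ` J" "\<And>j. j \<in> J \<Longrightarrow> \<forall>\<^sub>F z in end_at D p (d j). z \<in> B j"
    using star_directions[OF J(1,2) sub J(5,6,7)] by blast+
  obtain j where j: "j \<in> J" "u = d j" using star(1) u by blast
  show "- u \<in> directions D p" using star(1) J(8) j by auto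
  show "\<exists>C. connected C \<and> C \<subseteq> curve D - crossings D \<and> (\<forall>\<^sub>F z in end_at D p u. z \<in> C)"
    using star(2)[OF j(1)] J(3,4)[OF j(1)] j(2) by (intro exI[of _ "B j"]) auto
qed

lemma end_edge:
  assumes D: "singular_link_diagram D" "p \<in> crossings D" and u: "u \<in> directions D p"
  shows "end_edge D p u \<in> edges D" and "\<forall>\<^sub>F z in end_at D p u. z \<in> end_edge D p u"
proof -
  have nb: "end_at D p u \<noteq> bot" using u by (simp add: directions_def)
  obtain C where C: "connected C" "C \<subseteq> curve D - crossings D" "\<forall>\<^sub>F z in end_at D p u. z \<in> C"
    using crossing_germ(2)[OF assms] by blast
  obtain z where z: "z \<in> C" using eventually_happens'[OF nb C(3)] by blast
  define E where "E = connected_component_set (curve D - crossings D) z"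
  have "E \<in> edges D" using C z by (auto simp: E_def edges_def components_def)
  moreover have "C \<subseteq> E" using C z unfolding E_def by (intro connected_component_maximal)
  then have evE: "\<forall>\<^sub>F z in end_at D p u. z \<in> E" using C(3) by (auto elim: eventually_mono)
  \<comment> \<open>Two edges that both eventually contain the points of a nontrivial filter meet,
    and components are equal or disjoint.\<close>
  moreover have "F = E" if "F \<in> edges D" "\<forall>\<^sub>F z in end_at D p u. z \<in> F" for F
  proof -
    have "\<forall>\<^sub>F z in end_at D p u. z \<in> F \<and> z \<in> E"
      using that(2) evE by eventually_elim auto
    then obtain y where "y \<in> F" "y \<in> E" using eventually_happens'[OF nb] by blast
    then show ?thesis using that(1) \<open>E \<in> edges D\<close> unfolding edges_def
      by (metis components_eq disjoint_iff)
  qed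
  ultimately have "\<exists>!E. E \<in> edges D \<and> (\<forall>\<^sub>F z in end_at D p u. z \<in> E)" by blast
  from theI'[OF this] show "end_edge D p u \<in> edges D" "\<forall>\<^sub>F z in end_at D p u. z \<in> end_edge D p u"
    unfolding end_edge_def by auto
qed

lemma edge_subset: "E \<in> edges D \<Longrightarrow> E \<subseteq> curve D - crossings D"
  unfolding edges_def by (rule in_components_subset)

lemma over_directions:
  assumes "singular_link_diagram D" "p \<in> reg D" "w \<in> over D p"
  shows "w \<in> directions D p" "- w \<in> directions D p" "- w \<in> over D p"
proof -
  obtain v where "v \<in> directions D p" "over D p = {v, - v}"
    using assms unfolding singular_link_diagram_def by blast
  moreover have "- v \<in> directions D p"
    using crossing_germ(1)[OF assms(1)] assms(2) calculation by (auto simp: crossings_def)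
  ultimately show "w \<in> directions D p" "- w \<in> directions D p" "- w \<in> over D p"
    using assms(3) by auto
qed

lemma arc_step_cases:
  assumes "singular_link_diagram D" "(y, z) \<in> arc_step D"
  obtains E where "E \<in> edges D" "y \<in> E" "z \<in> E"
  | p w where "p \<in> reg D" "w \<in> over D p" "y \<in> end_edge D p w" "z \<in> end_edge D p (- w)"
  using assms unfolding arc_step_def by blast

text \<open>\<open>over D p\<close> contains \<open>- w\<close> along with \<open>w\<close>, so a
  passage over a crossing can be walked back. Hence \<open>arc_of\<close> yields equivalence
  classes.\<close>

lemma sym_arc_step:
  assumes D: "singular_link_diagram D"
  shows "sym ((arc_step D)\<^sup>*)"
proof (intro sym_rtrancl symI)
  fix y z assume "(y, z) \<in> arc_step D"
  then show "(z, y) \<in> arc_step D"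
  proof (rule arc_step_cases[OF D])
    fix p w assume pw: "p \<in> reg D" "w \<in> over D p" "y \<in> end_edge D p w" "z \<in> end_edge D p (- w)"
    then have "(z, y) \<in> end_edge D p (- w) \<times> end_edge D p (- (- w))" by simp
    then show ?thesis
      unfolding arc_step_def using over_directions(3)[OF D pw(1,2)] pw(1) by blast
  qed (auto simp: arc_step_def)
qed

lemma arc_of_eq:
  assumes D: "singular_link_diagram D" and y: "y \<in> arc_of D z"
  shows "arc_of D y = arc_of D z"
proof -
  have yz: "(z, y) \<in> (arc_step D)\<^sup>*" using y by (simp add: arc_of_def)
  then have "(y, z) \<in> (arc_step D)\<^sup>*" using sym_arc_step[OF D] by (meson symD)
  with yz show ?thesis by (auto simp: arc_of_def intro: rtrancl_trans)
qed

lemma arc_of_self: "z \<in> arc_of D z"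
  by (simp add: arc_of_def)

lemma arc_of_edge:
  assumes D: "singular_link_diagram D" and E: "E \<in> edges D" "y \<in> E" "z \<in> E"
  shows "arc_of D y = arc_of D z"
proof -
  have "(z, y) \<in> arc_step D" using E by (auto simp: arc_step_def)
  then show ?thesis by (intro arc_of_eq[OF D]) (auto simp: arc_of_def)
qed

lemma end_arc:
  assumes D: "singular_link_diagram D" "p \<in> crossings D" and u: "u \<in> directions D p"
  shows "end_arc D p u \<in> arcs D"
    and "\<forall>\<^sub>F z in end_at D p u. arc_of D z = end_arc D p u"
    and "z \<in> end_edge D p u \<Longrightarrow> arc_of D z = end_arc D p u"
proof -
  have nb: "end_at D p u \<noteq> bot" using u by (simp add: directions_def)
  note E = end_edge[OF assms]
  obtain y where y: "y \<in> end_edge D p u" using eventually_happens'[OF nb E(2)] by blast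
  define A where "A = arc_of D y"
  have EA: "z \<in> A" "arc_of D z = A" if "z \<in> end_edge D p u" for z
    using arc_of_edge[OF D(1) E(1) that y] arc_of_self[of z D] by (auto simp: A_def)
  have A: "A \<in> arcs D" using y edge_subset[OF E(1)] by (auto simp: A_def arcs_def)
  have evA: "\<forall>\<^sub>F z in end_at D p u. z \<in> A" using E(2) by eventually_elim (rule EA)
  moreover have "B = A" if B: "B \<in> arcs D" "\<forall>\<^sub>F z in end_at D p u. z \<in> B" for B
  proof -
    have "\<forall>\<^sub>F z in end_at D p u. z \<in> B \<and> z \<in> A"
      using that(2) evA by eventually_elim auto
    then obtain x where "x \<in> B" "x \<in> A" using eventually_happens'[OF nb] by blast
    moreover obtain a where "B = arc_of D a" using B(1) by (auto simp: arcs_def)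
    ultimately show ?thesis using arc_of_eq[OF D(1)] by (metis A_def)
  qed
  ultimately have "end_arc D p u = A" unfolding end_arc_def using A by (intro the_equality) (blast intro: A evA)+
  then show "end_arc D p u \<in> arcs D" "\<forall>\<^sub>F z in end_at D p u. arc_of D z = end_arc D p u"
    "z \<in> end_edge D p u \<Longrightarrow> arc_of D z = end_arc D p u"
    using A EA E(2) by (auto elim: eventually_mono)
qed

text \<open>A small piece of the curve through \<open>z\<close> avoids the finitely many crossings
  and is connected, so it stays in the edge of \<open>z\<close>.\<close>

lemma arc_of_locally_constant:
  assumes D: "singular_link_diagram D" and z: "z \<in> curve D - crossings D"
  shows "\<forall>\<^sub>F y in at z within curve D. arc_of D y = arc_of D z"
proof -
  obtain g \<epsilon> where g: "arc g" "g (1/2) = z" "\<epsilon> > 0"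
    "curve D \<inter> ball z \<epsilon> = path_image g \<inter> ball z \<epsilon>"
    using D z unfolding singular_link_diagram_def simple_point_def by blast
  define U where "U = ball z \<epsilon> - crossings D"
  have "open U" unfolding U_def using D
    by (intro open_Diff finite_imp_closed) (auto simp: singular_link_diagram_def)
  moreover have "z \<in> U" using g z by (auto simp: U_def)
  ultimately obtain \<delta> where \<delta>: "0 < \<delta>" "\<delta> < 1/2" "g ` {1/2-\<delta>..1/2+\<delta>} \<subseteq> U"
    "\<forall>\<^sub>F y in nhds z. y \<in> path_image g \<longrightarrow> y \<in> g ` {1/2-\<delta><..<1/2+\<delta>}"
    by (rule arc_neighbourhood[OF g(1), unfolded g(2)])
  define C where "C = g ` {1/2-\<delta>..1/2+\<delta>}"
  have sub: "{1/2-\<delta>..1/2+\<delta>} \<subseteq> {0..1}" using \<delta> by auto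
  have "connected C" unfolding C_def using g(1) sub
    by (intro connected_continuous_image) (auto simp: arc_def path_def elim!: continuous_on_subset)
  moreover have C: "C \<subseteq> curve D - crossings D"
  proof -
    have "C \<subseteq> path_image g" unfolding C_def path_image_def using sub by (rule image_mono)
    then show ?thesis using \<delta>(3) g(4) by (auto simp: C_def U_def)
  qed
  moreover have zC: "z \<in> C" using g(2) \<delta> by (auto simp: C_def)
  ultimately have CE: "C \<subseteq> connected_component_set (curve D - crossings D) z"
    by (intro connected_component_maximal)
  have E: "connected_component_set (curve D - crossings D) z \<in> edges D"
    using z by (auto simp: edges_def components_def)
  have "\<forall>\<^sub>F y in nhds z. y \<in> ball z \<epsilon>" using g(3) by (intro eventually_nhds_in_open) auto
  with \<delta>(4) have "\<forall>\<^sub>F y in at z within curve D. y \<in> C"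
    unfolding eventually_at_filter
  proof eventually_elim
    case (elim y)
    then show ?case using g(4) by (force simp: C_def)
  qed
  then show ?thesis
    by eventually_elim (use arc_of_edge[OF D E] CE zC in blast)
qed

text \<open>For a coloring of arcs the two over-ends have the same color automatically, because they
  lie on one arc. A function on points only sees edges, so the common germ \<open>x\<close> becomes
  part of the condition. The values are asserted to exist, since germs of an arbitrary function need
  not be constant.\<close>

definition regular_condition ::
  "('a \<Rightarrow> 'a \<Rightarrow> 'a) \<Rightarrow> diagram \<Rightarrow> (complex \<Rightarrow> 'a) \<Rightarrow> complex \<Rightarrow> bool" where
  "regular_condition qop D f p \<longleftrightarrow> (\<forall>w \<in> over D p. \<exists>x.
     germ_value D f p w x \<and> germ_value D f p (- w) x \<and>
     (\<forall>u \<in> directions D p - over D p. \<exists>y.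
        germ_value D f p u y \<and> germ_value D f p (- u) (qop y x)))"

definition singular_condition ::
  "('a \<Rightarrow> 'a \<Rightarrow> 'a) \<Rightarrow> ('a \<Rightarrow> 'a \<Rightarrow> 'a) \<Rightarrow> diagram \<Rightarrow> (complex \<Rightarrow> 'a) \<Rightarrow> complex \<Rightarrow> bool" where
  "singular_condition R1 R2 D f p \<longleftrightarrow>
     (\<forall>u \<in> directions D p. \<forall>v \<in> directions D p. ccw u v \<longrightarrow> (\<exists>x y.
        germ_value D f p v x \<and> germ_value D f p u y \<and>
        germ_value D f p (- u) (R1 x y) \<and> germ_value D f p (- v) (R2 x y)))"

text \<open>
  Colors are attached to points instead of arcs. All conditions are local in the plane, so such
  colorings can be restricted, transported and glued.
\<close>

definition point_coloring ::
  "'a set \<Rightarrow> ('a \<Rightarrow> 'a \<Rightarrow> 'a) \<Rightarrow> ('a \<Rightarrow> 'a \<Rightarrow> 'a) \<Rightarrow> ('a \<Rightarrow> 'a \<Rightarrow> 'a) \<Rightarrow> diagram \<Rightarrow>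
   (complex \<Rightarrow> 'a) \<Rightarrow> bool" where
  "point_coloring X qop R1 R2 D f \<longleftrightarrow>
     (\<forall>z \<in> curve D - crossings D. f z \<in> X \<and> (\<forall>\<^sub>F y in at z within curve D. f y = f z)) \<and>
     (\<forall>p \<in> reg D. regular_condition qop D f p) \<and>
     (\<forall>p \<in> sng D. singular_condition R1 R2 D f p)"

lemma coloring_point_coloring:
  assumes D: "singular_link_diagram D" and c: "c \<in> colorings X qop R1 R2 D"
  shows "point_coloring X qop R1 R2 D (\<lambda>z. c (arc_of D z))"
proof -
  let ?f = "\<lambda>z. c (arc_of D z)"
  have germ: "germ_value D ?f p u (c (end_arc D p u))" if "p \<in> crossings D" "u \<in> directions D p" for p u
    using end_arc(2)[OF D that] unfolding germ_value_def by eventually_elim simp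
  have "?f z \<in> X \<and> (\<forall>\<^sub>F y in at z within curve D. ?f y = ?f z)"
    if z: "z \<in> curve D - crossings D" for z
  proof
    have "arc_of D z \<in> arcs D" using z by (auto simp: arcs_def)
    then show "?f z \<in> X" using c by (auto simp: colorings_def)
    show "\<forall>\<^sub>F y in at z within curve D. ?f y = ?f z"
      using arc_of_locally_constant[OF D z] by eventually_elim simp
  qed
  moreover have "regular_condition qop D ?f p" if p: "p \<in> reg D" for p
    unfolding regular_condition_def
  proof
    fix w assume w: "w \<in> over D p"
    have cr: "p \<in> crossings D" using p by (simp add: crossings_def)
    note od = over_directions[OF D p w]
    have "end_edge D p w \<noteq> {}" "end_edge D p (- w) \<noteq> {}"
      using end_edge(1)[OF D cr] od unfolding edges_def by (auto dest: in_components_nonempty)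
    then obtain y z where yz: "y \<in> end_edge D p w" "z \<in> end_edge D p (- w)" by blast
    \<comment> \<open>The two over-ends lie on one arc, which supplies the common value
      \<open>x\<close>.\<close>
    then have "(y, z) \<in> arc_step D" using p w by (auto simp: arc_step_def)
    then have "arc_of D z = arc_of D y" by (intro arc_of_eq[OF D]) (auto simp: arc_of_def)
    then have eq: "end_arc D p (- w) = end_arc D p w"
      using end_arc(3)[OF D cr od(1) yz(1)] end_arc(3)[OF D cr od(2) yz(2)] by simp
    show "\<exists>x. germ_value D ?f p w x \<and> germ_value D ?f p (- w) x \<and>
      (\<forall>u \<in> directions D p - over D p. \<exists>y. germ_value D ?f p u y
        \<and> germ_value D ?f p (- u) (qop y x))"
    proof (intro exI conjI ballI)
      show "germ_value D ?f p w (c (end_arc D p w))" using germ[OF cr od(1)] .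
      show "germ_value D ?f p (- w) (c (end_arc D p w))" using germ[OF cr od(2)] eq by simp
      fix u assume u: "u \<in> directions D p - over D p"
      then have "c (end_arc D p (- u)) = qop (c (end_arc D p u)) (c (end_arc D p w))"
        using c p w by (auto simp: colorings_def)
      then show "germ_value D ?f p u (c (end_arc D p u))"
        "germ_value D ?f p (- u) (qop (c (end_arc D p u)) (c (end_arc D p w)))"
        using germ[OF cr, of u] germ[OF cr, of "- u"] u crossing_germ(1)[OF D cr, of u] by simp_all
    qed
  qed
  moreover have "singular_condition R1 R2 D ?f p" if p: "p \<in> sng D" for p
    unfolding singular_condition_def
  proof (intro ballI impI)
    fix u v assume uv: "u \<in> directions D p" "v \<in> directions D p" "ccw u v"
    have cr: "p \<in> crossings D" using p by (simp add: crossings_def)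
    have "c (end_arc D p (- u)) = R1 (c (end_arc D p v)) (c (end_arc D p u))"
      "c (end_arc D p (- v)) = R2 (c (end_arc D p v)) (c (end_arc D p u))"
      using c p uv by (auto simp: colorings_def)
    then show "\<exists>x y. germ_value D ?f p v x \<and> germ_value D ?f p u y \<and>
        germ_value D ?f p (- u) (R1 x y) \<and> germ_value D ?f p (- v) (R2 x y)"
      using germ[OF cr] uv crossing_germ(1)[OF D cr] by metis
  qed
  ultimately show ?thesis by (simp add: point_coloring_def)
qed

text \<open>Along a direction that the curve does not have, the filter is trivial and every color is
  a germ value; uniqueness is therefore tied to \<open>directions\<close>.\<close>

lemma germ_value_unique:
  assumes "u \<in> directions D p" "germ_value D f p u x" "germ_value D f p u y"
  shows "x = y"
proof -
  have "\<forall>\<^sub>F z in end_at D p u. f z = x \<and> f z = y"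
    using assms(2,3) unfolding germ_value_def by (rule eventually_conj)
  then show ?thesis using assms(1) eventually_happens'[of "end_at D p u"] by (fastforce simp: directions_def)
qed

section \<open>From functions on points back to arcs\<close>

lemma point_coloring_connected:
  assumes "point_coloring X qop R1 R2 D f" "connected C" "C \<subseteq> curve D - crossings D" "y \<in> C" "z \<in> C"
  shows "f y = f z"
proof (rule connected_local_const[OF assms(2,4,5)], intro ballI)
  fix a assume "a \<in> C"
  then have "\<forall>\<^sub>F b in at a within curve D. f b = f a"
    using assms(1,3) by (auto simp: point_coloring_def)
  moreover have "at a within C \<le> at a within curve D" using assms(3) by (intro at_le) auto
  ultimately have "\<forall>\<^sub>F b in at a within C. f b = f a" by (meson filter_leD)
  then show "\<forall>\<^sub>F b in at a within C. f a = f b" by eventually_elim simp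
qed

text \<open>Inside an edge, local constancy and connectedness suffice. Across a crossing, the common
  over-germ of \<open>regular_condition\<close> equals the colors of both edges.\<close>

lemma point_coloring_arc_step:
  assumes D: "singular_link_diagram D" and f: "point_coloring X qop R1 R2 D f"
    and yz: "(y, z) \<in> arc_step D"
  shows "f y = f z"
proof -
  have edge: "f y = f z" if "E \<in> edges D" "y \<in> E" "z \<in> E" for E y z
    using point_coloring_connected[OF f _ edge_subset that(2,3)] that(1)
    by (auto simp: edges_def in_components_connected)
  show ?thesis using yz
  proof (rule arc_step_cases[OF D])
    fix p w assume pw: "p \<in> reg D" "w \<in> over D p" "y \<in> end_edge D p w" "z \<in> end_edge D p (- w)"
    have p: "p \<in> crossings D" using pw by (simp add: crossings_def)
    note od = over_directions[OF D pw(1,2)]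
    have germ: "germ_value D f p v (f x)" if "v \<in> directions D p" "x \<in> end_edge D p v" for v x
      unfolding germ_value_def
      by (rule eventually_mono[OF end_edge(2)[OF D p that(1)]]) (use edge[OF end_edge(1)[OF D p
        that(1)] _ that(2)] in blast)
    obtain x where "germ_value D f p w x" "germ_value D f p (- w) x"
      using f pw unfolding point_coloring_def regular_condition_def by blast
    then show "f y = f z" using germ[OF od(1) pw(3)] germ[OF od(2) pw(4)] germ_value_unique od(1,2) by metis
  qed (use edge in blast)
qed

lemma point_coloring_arc:
  assumes D: "singular_link_diagram D" and f: "point_coloring X qop R1 R2 D f"
    and y: "y \<in> arc_of D z"
  shows "f y = f z"
proof -
  have "(z, y) \<in> (arc_step D)\<^sup>*" using y by (simp add: arc_of_def)
  then show ?thesis by induction (auto dest: point_coloring_arc_step[OF D f])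
qed

lemma point_coloring_coloring:
  assumes D: "singular_link_diagram D" and f: "point_coloring X qop R1 R2 D f"
  obtains c where "c \<in> colorings X qop R1 R2 D"
    "\<And>z. z \<in> curve D - crossings D \<Longrightarrow> c (arc_of D z) = f z"
proof -
  \<comment> \<open>Any representative of an arc gives the same color, by
    \<open>point_coloring_arc\<close>. The restriction supplies the default value outside
    \<open>arcs D\<close> that membership in \<open>\<rightarrow>\<^sub>E\<close> requires.\<close>
  define c where "c = restrict (\<lambda>A. f (SOME z. z \<in> A)) (arcs D)"
  have cf: "c (arc_of D z) = f z" if z: "z \<in> curve D - crossings D" for z
  proof -
    have "(SOME y. y \<in> arc_of D z) \<in> arc_of D z" using arc_of_self by (rule someI)
    then show ?thesis using point_coloring_arc[OF D f] z by (auto simp: c_def arcs_def)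
  qed
  have germ: "c (end_arc D p u) = x"
    if pu: "p \<in> crossings D" "u \<in> directions D p" "germ_value D f p u x" for p u x
  proof -
    have "\<forall>\<^sub>F z in end_at D p u. z \<in> end_edge D p u \<and> f z = x"
      using end_edge(2)[OF D pu(1,2)] pu(3) unfolding germ_value_def by eventually_elim auto
    then obtain z where z: "z \<in> end_edge D p u" "f z = x"
      using eventually_happens'[of "end_at D p u"] pu(2) unfolding directions_def by blast
    then have "z \<in> curve D - crossings D" using edge_subset[OF end_edge(1)[OF D pu(1,2)]] by blast
    then show ?thesis using cf z end_arc(3)[OF D pu(1,2) z(1)] by metis
  qed
  have "c \<in> arcs D \<rightarrow>\<^sub>E X"
  proof
    fix A assume "A \<in> arcs D"
    then obtain z where "z \<in> curve D - crossings D" "A = arc_of D z" by (auto simp: arcs_def)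
    then show "c A \<in> X" using cf f by (auto simp: point_coloring_def)
  qed (simp add: c_def)
  moreover have "c (end_arc D p (- u)) = qop (c (end_arc D p u)) (c (end_arc D p w))"
    if p: "p \<in> reg D" "w \<in> over D p" "u \<in> directions D p - over D p" for p w u
  proof -
    have cr: "p \<in> crossings D" using p by (simp add: crossings_def)
    have "regular_condition qop D f p" using f p by (simp add: point_coloring_def)
    then obtain x y where "germ_value D f p w x" "germ_value D f p u y" "germ_value D f p (- u) (qop y x)"
      using p unfolding regular_condition_def by blast
    moreover have "w \<in> directions D p" "u \<in> directions D p" "- u \<in> directions D p"
      using over_directions[OF D p(1,2)] crossing_germ(1)[OF D cr] p(3) by auto
    ultimately show ?thesis using germ[OF cr] by metis
  qed
  moreover have "c (end_arc D p (- u)) = R1 (c (end_arc D p v)) (c (end_arc D p u)) \<and>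
        c (end_arc D p (- v)) = R2 (c (end_arc D p v)) (c (end_arc D p u))"
    if p: "p \<in> sng D" "u \<in> directions D p" "v \<in> directions D p" "ccw u v" for p u v
  proof -
    have cr: "p \<in> crossings D" using p by (simp add: crossings_def)
    have "singular_condition R1 R2 D f p" using f p by (simp add: point_coloring_def)
    then obtain x y where "germ_value D f p v x" "germ_value D f p u y"
        "germ_value D f p (- u) (R1 x y)" "germ_value D f p (- v) (R2 x y)"
      using p unfolding singular_condition_def by blast
    moreover have "- u \<in> directions D p" "- v \<in> directions D p"
      using crossing_germ(1)[OF D cr] p by auto
    ultimately show ?thesis using germ[OF cr] p by metis
  qed
  ultimately have "c \<in> colorings X qop R1 R2 D" unfolding colorings_def by blast
  with cf show ?thesis using that by blast
qed

lemma coloring_eqI: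
  assumes "c \<in> colorings X qop R1 R2 D" "c' \<in> colorings X qop R1 R2 D"
    and "\<And>z. z \<in> curve D - crossings D \<Longrightarrow> c (arc_of D z) = c' (arc_of D z)"
  shows "c = c'"
proof (rule PiE_ext)
  show "c \<in> arcs D \<rightarrow>\<^sub>E X" "c' \<in> arcs D \<rightarrow>\<^sub>E X" using assms(1,2) by (auto simp: colorings_def)
  show "c A = c' A" if "A \<in> arcs D" for A using that assms(3) by (auto simp: arcs_def)
qed

section \<open>Transport of germs by plane homeomorphisms\<close>

text \<open>An end is an infimum of two filters, and each is respected: continuity and
  \<open>inc\<close> carry the points, \<open>sgn_difference_tendsto\<close> carries the
  directions.\<close>

lemma end_at_filterlim:
  assumes der: "(h has_derivative h') (at q)" and nz: "h' u \<noteq> 0"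
    and inc: "\<forall>\<^sub>F z in at q within curve T. h z \<in> curve D \<and> h z \<noteq> h q"
  shows "filterlim h (end_at D (h q) (sgn (h' u))) (end_at T q u)"
proof -
  have le: "end_at T q u \<le> at q within curve T" by (simp add: end_at_def)
  have le': "end_at T q u \<le> at q" using le at_le[of "curve T" UNIV q] by simp
  have "(h \<longlongrightarrow> h q) (at q)" using has_derivative_continuous[OF der] by (simp add: isCont_def)
  then have "filterlim h (at (h q) within curve D) (end_at T q u)"
    using le' filter_leD[OF le inc] by (auto simp: filterlim_at intro: filterlim_mono)
  moreover have "filterlim h (filtercomap (\<lambda>z. sgn (z - h q)) (nhds (sgn (h' u)))) (end_at T q u)"
    unfolding filterlim_filtercomap_iff o_def
    by (rule sgn_difference_tendsto[where f=h and f'=h', OF der le' sgn_tendsto_end_at nz])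
  ultimately show ?thesis unfolding end_at_def[of D] by (simp add: filterlim_inf)
qed

text \<open>The real determinant is multiplicative, and normalising the vectors divides it by a
  positive number. A linear map with positive determinant thus preserves the cyclic order of
  directions, on which the coloring rule at singular crossings depends.\<close>

lemma linear_image_ccw:
  fixes L :: "complex \<Rightarrow> complex"
  assumes "linear L" "ccw (L 1) (L \<i>)"
  shows "ccw (sgn (L u)) (sgn (L v)) \<longleftrightarrow> ccw u v" and "L u = 0 \<longleftrightarrow> u = 0"
proof -
  have L: "L w = Re w *\<^sub>R L 1 + Im w *\<^sub>R L \<i>" for w
  proof -
    have "w = Re w *\<^sub>R 1 + Im w *\<^sub>R \<i>" by (simp add: complex_eq_iff)
    then show ?thesis using assms(1) by (metis linear_add linear_scale)
  qed
  have det: "Im (cnj (L u) * L v) = Im (cnj u * v) * Im (cnj (L 1) * L \<i>)" for u v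
    unfolding L[of u] L[of v] by (simp add: algebra_simps)
  show 0: "L u = 0 \<longleftrightarrow> u = 0" for u
  proof
    assume "L u = 0"
    then have "Im (cnj u * v) = 0" for v using det[of u v] assms(2) by (simp add: ccw_def)
    from this[of 1] this[of \<i>] show "u = 0" by (simp add: complex_eq_iff)
  qed (simp add: linear_0[OF assms(1)])
  show "ccw (sgn (L u)) (sgn (L v)) \<longleftrightarrow> ccw u v"
  proof (cases "u = 0 \<or> v = 0")
    case True
    then have "u = 0 \<and> L u = 0 \<or> v = 0 \<and> L v = 0" using 0[of u] 0[of v] by blast
    then show ?thesis
      by (elim disjE conjE) (simp_all only: ccw_def sgn_zero complex_cnj_zero mult_zero_left mult_zero_right)
  next
    case False
    then have n: "norm (L u) > 0" "norm (L v) > 0" using 0[of u] 0[of v] by simp_all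
    have pos: "a * d / m > 0 \<longleftrightarrow> a > 0" if "m > 0" "d > 0" for a d m :: real
      using that by (simp add: zero_less_divide_iff zero_less_mult_iff)
    have "Im (cnj (sgn (L u)) * sgn (L v)) = Im (cnj (L u) * L v) / (norm (L u) * norm (L v))"
      by (simp add: sgn_div_norm field_simps)
    also have "\<dots> > 0 \<longleftrightarrow> Im (cnj u * v) > 0"
      unfolding det[of u v] using pos[OF mult_pos_pos[OF n] assms(2)[unfolded ccw_def]] .
    finally show ?thesis by (simp add: ccw_def)
  qed
qed

text \<open>Only \<open>h\<close> is given a derivative. It is invertible, having positive
  determinant, so the continuous inverse \<open>k\<close> is differentiable at \<open>h q\<close>
  too. Applying \<open>end_at_filterlim\<close> to \<open>h\<close> and to \<open>k\<close>
  identifies the germs at the two points.\<close>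

lemma homeomorphism_directions:
  assumes hom: "homeomorphism UNIV UNIV h k" and der: "(h has_derivative h') (at q)"
    and or: "ccw (h' 1) (h' \<i>)"
    and W: "open W" "h q \<in> W" "curve D \<inter> W = h ` curve T \<inter> W"
  shows "norm u = 1 \<Longrightarrow> (\<forall>\<^sub>F z in end_at D (h q) (sgn (h' u)). P z)
    \<longleftrightarrow> (\<forall>\<^sub>F z in end_at T q u. P (h z))"
    and "directions D (h q) = (\<lambda>u. sgn (h' u)) ` directions T q"
    and "inj_on (\<lambda>u. sgn (h' u)) (sphere 0 1)"
proof -
  have kh: "k (h z) = z" and hk: "h (k z) = z" for z using hom by (auto simp: homeomorphism_def)
  have conth: "continuous_on UNIV h" and contk: "continuous_on UNIV k"
    using hom by (auto simp: homeomorphism_def)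
  have lin: "linear h'" using der by (rule has_derivative_linear)
  note L = linear_image_ccw[OF lin or]
  have "inj h'" using L(2) lin by (simp add: linear_injective_0)
  then obtain k' where k': "linear k'" "\<And>x. k' (h' x) = x" "\<And>x. h' (k' x) = x"
    using linear_injective_isomorphism[OF lin] by blast
  have derk: "(k has_derivative k') (at (h q))"
  proof (rule has_derivative_inverse_basic[where f=h and f'=h' and T=UNIV])
    show "(h has_derivative h') (at (k (h q)))" using der by (simp add: kh)
    show "continuous (at (h q)) k" using contk by (simp add: continuous_on_eq_continuous_at)
  qed (use k' hk in \<open>auto simp: linear_linear fun_eq_iff\<close>)
  have k'0: "k' v = 0 \<longleftrightarrow> v = 0" for v using k' linear_0[OF lin] linear_0[OF k'(1)] by metis
  have sgn_k: "sgn (k' (sgn (h' u))) = u" if "norm u = 1" for u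
  proof -
    have "u \<noteq> 0" using that by auto
    then show ?thesis using that L(2)[of u]
      by (simp add: sgn_div_norm[of "h' u"] linear_scale[OF k'(1)] k'(2) sgn_scaleR) (simp add: sgn_div_norm)
  qed
  have sgn_h: "sgn (h' (sgn (k' v))) = v" if "norm v = 1" for v
  proof -
    have "v \<noteq> 0" using that by auto
    then show ?thesis using that k'0[of v]
      by (simp add: sgn_div_norm[of "k' v"] linear_scale[OF lin] k'(3) sgn_scaleR) (simp add: sgn_div_norm)
  qed
  show "inj_on (\<lambda>u. sgn (h' u)) (sphere 0 1)"
    by (rule inj_on_inverseI[of _ "\<lambda>v. sgn (k' v)"]) (simp add: sgn_k)
  show 1: "(\<forall>\<^sub>F z in end_at D (h q) (sgn (h' u)). P z) \<longleftrightarrow> (\<forall>\<^sub>F z in end_at T q u. P (h z))"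
    if u: "norm u = 1" for u P
  proof
    have u0: "u \<noteq> 0" using u by auto
    have "\<forall>\<^sub>F z in nhds q. z \<in> h -` W" using W conth
      by (intro eventually_nhds_in_open open_vimage) auto
    then have "\<forall>\<^sub>F z in at q within curve T. h z \<in> curve D \<and> h z \<noteq> h q"
      unfolding eventually_at_filter
    proof eventually_elim
      case (elim z)
      then show ?case using W(3) kh by (metis IntE IntI imageI vimageE)
    qed
    then have lim: "filterlim h (end_at D (h q) (sgn (h' u))) (end_at T q u)"
      using der L(2)[of u] u0 by (intro end_at_filterlim) auto
    show "\<forall>\<^sub>F z in end_at T q u. P (h z)" if "\<forall>\<^sub>F z in end_at D (h q) (sgn (h' u)). P z"
      using lim that by (simp add: filterlim_iff)
    have "\<forall>\<^sub>F z in nhds (h q). z \<in> W" using W by (intro eventually_nhds_in_open) auto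
    then have "\<forall>\<^sub>F z in at (h q) within curve D. k z \<in> curve T \<and> k z \<noteq> k (h q)"
      unfolding eventually_at_filter
    proof eventually_elim
      case (elim z)
      then show ?case using W(3) kh hk by (metis IntE IntI imageE)
    qed
    then have "filterlim k (end_at T (k (h q)) (sgn (k' (sgn (h' u))))) (end_at D (h q) (sgn (h' u)))"
      using derk L(2)[of u] u0 k'0 by (intro end_at_filterlim) (auto simp: sgn_zero_iff)
    then have limk: "filterlim k (end_at T q u) (end_at D (h q) (sgn (h' u)))"
      by (simp add: kh sgn_k u)
    show "\<forall>\<^sub>F z in end_at D (h q) (sgn (h' u)). P z" if "\<forall>\<^sub>F z in end_at T q u. P (h z)"
    proof -
      have "\<forall>\<^sub>F z in end_at D (h q) (sgn (h' u)). P (h (k z))"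
        using limk[unfolded filterlim_iff, rule_format, OF that] .
      then show ?thesis by (simp add: hk)
    qed
  qed
  have mem: "sgn (h' u) \<in> directions D (h q) \<longleftrightarrow> u \<in> directions T q" if "norm u = 1" for u
    using 1[OF that, of "\<lambda>_. False"] by (simp add: directions_def trivial_limit_def)
  show "directions D (h q) = (\<lambda>u. sgn (h' u)) ` directions T q"
  proof (intro equalityI subsetI)
    fix v assume v: "v \<in> directions D (h q)"
    then have n: "norm v = 1" by (rule norm_direction)
    then have "v \<noteq> 0" by auto
    then have "k' v \<noteq> 0" using k'0[of v] by blast
    then have "norm (sgn (k' v)) = 1" by (simp add: norm_sgn)
    then have "sgn (k' v) \<in> directions T q" using mem[of "sgn (k' v)"] v sgn_h[OF n] by simp
    then show "v \<in> (\<lambda>u. sgn (h' u)) ` directions T q" using sgn_h[OF n] by (metis imageI)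
  qed (use mem norm_direction in blast)
qed

text \<open>Both conditions are formulated through germs, opposite directions, \<open>over\<close>
  and \<open>ccw\<close>; the map \<open>\<phi>\<close> on unit vectors respects each of
  them.\<close>

lemma homeomorphism_conditions:
  assumes hom: "homeomorphism UNIV UNIV h k" and der: "(h has_derivative h') (at q)"
    and or: "ccw (h' 1) (h' \<i>)"
    and W: "open W" "h q \<in> W" "curve D \<inter> W = h ` curve T \<inter> W"
  shows "singular_condition R1 R2 D f (h q) \<longleftrightarrow> singular_condition R1 R2 T (f \<circ> h) q"
    and "over T q \<subseteq> sphere 0 1 \<Longrightarrow> over D (h q) = (\<lambda>w. sgn (h' w)) ` over T q \<Longrightarrow>
      regular_condition qop D f (h q) \<longleftrightarrow> regular_condition qop T (f \<circ> h) q"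
proof -
  note H = homeomorphism_directions[OF assms]
  have lin: "linear h'" using der by (rule has_derivative_linear)
  define \<phi> where "\<phi> = (\<lambda>u. sgn (h' u))"
  have minus: "- \<phi> u = \<phi> (- u)" for u by (simp add: \<phi>_def linear_neg[OF lin] sgn_minus)
  have germ: "germ_value D f (h q) (\<phi> u) x \<longleftrightarrow> germ_value T (f \<circ> h) q u x" if "norm u = 1" for u x
    unfolding germ_value_def \<phi>_def using H(1)[OF that] by simp
  have ccw: "ccw (\<phi> u) (\<phi> v) \<longleftrightarrow> ccw u v" for u v
    unfolding \<phi>_def by (rule linear_image_ccw[OF lin or])
  have dir: "directions D (h q) = \<phi> ` directions T q" unfolding \<phi>_def by (rule H(2))
  have nd: "u \<in> directions T q \<Longrightarrow> norm u = 1" for u by (rule norm_direction)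
  show "singular_condition R1 R2 D f (h q) \<longleftrightarrow> singular_condition R1 R2 T (f \<circ> h) q"
    unfolding singular_condition_def dir by (simp add: ccw minus germ nd)
  assume over: "over T q \<subseteq> sphere 0 1" "over D (h q) = (\<lambda>w. sgn (h' w)) ` over T q"
  have no: "w \<in> over T q \<Longrightarrow> norm w = 1" for w using over(1) by auto
  have "directions T q \<subseteq> sphere 0 1" using nd by auto
  then have diff: "directions D (h q) - over D (h q) = \<phi> ` (directions T q - over T q)"
    unfolding dir over(2) \<phi>_def using H(3) over(1)
      by (simp add: inj_on_image_set_diff Diff_subset_conv le_supI2)
  show "regular_condition qop D f (h q) \<longleftrightarrow> regular_condition qop T (f \<circ> h) q"
    unfolding regular_condition_def diff unfolding over(2) \<phi>_def[symmetric]
    by (simp add: minus germ nd no)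
qed

text \<open>The last clause requires that near a boundary point the tangle is a graph over the
  height and lies on one side of that point, as strands ending at the top or the bottom do. It is
  the source of \<open>frequently_outside\<close>.\<close>

definition box_tangle :: "diagram \<Rightarrow> bool" where
  "box_tangle T \<longleftrightarrow> curve T \<subseteq> box \<and> crossings T \<subseteq> curve T \<inter> interior box \<and>
     (\<forall>p \<in> reg T. over T p \<subseteq> sphere 0 1) \<and>
     (\<forall>z \<in> curve T \<inter> frontier box. \<exists>r > 0. inj_on Im (curve T \<inter> ball z r) \<and>
        ((\<forall>y \<in> curve T \<inter> ball z r. Im y \<le> Im z) \<or> (\<forall>y \<in> curve T \<inter> ball z r. Im z \<le> Im y)))"

section \<open>Placements of a tangle in a diagram\<close>

lemma placed_homeomorphism:
  assumes "placed h T D \<Delta>"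
  obtains k where "homeomorphism UNIV UNIV h k"
proof -
  have "homotopic_with_canon (\<lambda>f. \<exists>g. homeomorphism UNIV UNIV f g) UNIV UNIV id h"
    using assms by (simp add: placed_def planar_isotopy_def)
  then have "\<exists>k. homeomorphism UNIV UNIV h k" by (blast dest: homotopic_with_imp_property)
  then show ?thesis using that by blast
qed

lemma placedD:
  assumes "placed h T D \<Delta>"
  shows "\<Delta> = h ` box" "curve D \<inter> \<Delta> = h ` curve T" "reg D \<inter> \<Delta> = h ` reg T" "sng D \<inter> \<Delta> = h ` sng T"
  using assms unfolding placed_def by - (elim conjE; assumption)+

lemma placed_derivative:
  assumes "placed h T D \<Delta>" "q \<in> crossings T"
  obtains h' where "(h has_derivative h') (at q)" "ccw (h' 1) (h' \<i>)"
    "q \<in> reg T \<Longrightarrow> over D (h q) = (\<lambda>w. sgn (h' w)) ` over T q"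
proof -
  have "\<forall>q \<in> crossings T. \<exists>h'. (h has_derivative h') (at q) \<and> ccw (h' 1) (h' \<i>) \<and>
        (q \<in> reg T \<longrightarrow> over D (h q) = (\<lambda>w. sgn (h' w)) ` over T q)"
    using assms(1) unfolding placed_def by (elim conjE)
  from bspec[OF this assms(2)] obtain h' where h': "(h has_derivative h') (at q)" "ccw (h' 1) (h' \<i>)"
    "q \<in> reg T \<longrightarrow> over D (h q) = (\<lambda>w. sgn (h' w)) ` over T q" by (elim exE conjE)
  show ?thesis by (rule that[OF h'(1,2)]) (use h'(3) in simp)
qed

lemma placed_interior:
  assumes "placed h T D \<Delta>"
  shows "open (h ` interior box)" "h ` interior box \<subseteq> \<Delta>"
    "curve D \<inter> h ` interior box = h ` curve T \<inter> h ` interior box"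
proof -
  obtain k where hom: "homeomorphism UNIV UNIV h k" using placed_homeomorphism[OF assms] .
  have "openin (top_of_set UNIV) (h ` interior box)"
    by (rule homeomorphism_imp_open_map[OF hom]) simp
  then show "open (h ` interior box)" by simp
  have K: "curve D \<inter> \<Delta> = h ` curve T" using assms by (rule placedD)
  show "h ` interior box \<subseteq> \<Delta>" using assms interior_subset by (auto simp: placed_def)
  then show "curve D \<inter> h ` interior box = h ` curve T \<inter> h ` interior box"
    using K by blast
qed

text \<open>Crossings of the tangle lie in the interior of the box, whose image is an open set on
  which the diagram and the transported tangle coincide.\<close>

lemma placed_conditions:
  assumes pl: "placed h T D \<Delta>" and T: "box_tangle T"
  shows "q \<in> sng T \<Longrightarrow> singular_condition R1 R2 D f (h q) \<longleftrightarrow> singular_condition R1 R2 T (f \<circ> h) q"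
    and "q \<in> reg T \<Longrightarrow> regular_condition qop D f (h q) \<longleftrightarrow> regular_condition qop T (f \<circ> h) q"
proof -
  obtain k where hom: "homeomorphism UNIV UNIV h k" using placed_homeomorphism[OF pl] .
  note int = placed_interior[OF pl]
  show "singular_condition R1 R2 D f (h q) \<longleftrightarrow> singular_condition R1 R2 T (f \<circ> h) q" if "q \<in> sng T"
  proof -
    have q: "q \<in> crossings T" using that by (simp add: crossings_def)
    obtain h' where "(h has_derivative h') (at q)" "ccw (h' 1) (h' \<i>)"
      using placed_derivative[OF pl q] by metis
    moreover have "h q \<in> h ` interior box" using q T by (auto simp: box_tangle_def)
    ultimately show ?thesis using hom int by (intro homeomorphism_conditions(1)) auto
  qed
  show "regular_condition qop D f (h q) \<longleftrightarrow> regular_condition qop T (f \<circ> h) q" if "q \<in> reg T"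
  proof -
    have q: "q \<in> crossings T" using that by (simp add: crossings_def)
    obtain h' where "(h has_derivative h') (at q)" "ccw (h' 1) (h' \<i>)"
      "over D (h q) = (\<lambda>w. sgn (h' w)) ` over T q"
      using placed_derivative[OF pl q] \<open>q \<in> reg T\<close> by metis
    moreover have "h q \<in> h ` interior box" using q T by (auto simp: box_tangle_def)
    moreover have "over T q \<subseteq> sphere 0 1" using that T by (auto simp: box_tangle_def)
    ultimately show ?thesis using hom int by (intro homeomorphism_conditions(2)) auto
  qed
qed

lemma placed_crossings:
  assumes pl: "placed h T D \<Delta>" and T: "box_tangle T" and z: "z \<in> box"
  shows "h z \<in> curve D \<longleftrightarrow> z \<in> curve T" "h z \<in> reg D \<longleftrightarrow> z \<in> reg T" "h z \<in> sng D \<longleftrightarrow> z \<in> sng T"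
    "h z \<in> crossings D \<longleftrightarrow> z \<in> crossings T"
proof -
  obtain k where hom: "homeomorphism UNIV UNIV h k" using placed_homeomorphism[OF pl] .
  then have inj: "inj h" by (auto simp: homeomorphism_def intro: inj_on_inverseI)
  have "h z \<in> \<Delta>" using pl z by (auto simp: placed_def)
  moreover have "curve D \<inter> \<Delta> = h ` curve T" "reg D \<inter> \<Delta> = h ` reg T" "sng D \<inter> \<Delta> = h ` sng T"
    using placedD[OF pl] by blast+
  ultimately show "h z \<in> curve D \<longleftrightarrow> z \<in> curve T" "h z \<in> reg D \<longleftrightarrow> z \<in> reg T" "h z \<in> sng D \<longleftrightarrow> z \<in> sng T"
    using inj by (metis Int_iff inj_image_mem_iff)+
  then show "h z \<in> crossings D \<longleftrightarrow> z \<in> crossings T" by (simp add: crossings_def)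
qed

text \<open>Local constancy pulls back because \<open>h\<close> is continuous, injective and maps
  \<open>curve T\<close> into \<open>curve D\<close>; the crossing conditions pull back by
  \<open>placed_conditions\<close>.\<close>

lemma point_coloring_restrict:
  assumes pl: "placed h T D \<Delta>" and T: "box_tangle T"
    and f: "point_coloring X qop R1 R2 D f"
  shows "point_coloring X qop R1 R2 T (f \<circ> h)"
proof -
  obtain k where hom: "homeomorphism UNIV UNIV h k" using placed_homeomorphism[OF pl] .
  have conth: "continuous_on UNIV h" and inj: "\<And>y z. h y = h z \<Longrightarrow> y = z"
    using hom by (auto simp: homeomorphism_def) (metis)
  have box: "curve T \<subseteq> box" "crossings T \<subseteq> box"
    using T interior_subset[of box] by (auto simp: box_tangle_def)
  note mem = placed_crossings[OF pl T]
  have "(f \<circ> h) z \<in> X \<and> (\<forall>\<^sub>F y in at z within curve T. (f \<circ> h) y = (f \<circ> h) z)"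
    if z: "z \<in> curve T - crossings T" for z
  proof -
    have "h z \<in> curve D - crossings D" using mem z box by blast
    then have hz: "f (h z) \<in> X" "\<forall>\<^sub>F y in at (h z) within curve D. f y = f (h z)"
      using f by (auto simp: point_coloring_def)
    have "(h \<longlongrightarrow> h z) (at z within curve T)"
      using conth by (auto simp: continuous_on_eq_continuous_at isCont_def intro: tendsto_within_subset)
    moreover have "\<forall>\<^sub>F y in at z within curve T. h y \<in> curve D \<and> h y \<noteq> h z"
      unfolding eventually_at_filter using mem(1) box inj by (intro always_eventually) blast
    ultimately have "filterlim h (at (h z) within curve D) (at z within curve T)"
      by (simp add: filterlim_at)
    with hz show ?thesis by (auto simp: filterlim_iff)
  qed
  moreover have "regular_condition qop T (f \<circ> h) q" if "q \<in> reg T" for q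
  proof -
    have "q \<in> box" using that box(2) by (auto simp: crossings_def)
    then have "h q \<in> reg D" using mem(2) that by blast
    then have "regular_condition qop D f (h q)" using f by (simp add: point_coloring_def)
    then show ?thesis using placed_conditions(2)[OF pl T that] by blast
  qed
  moreover have "singular_condition R1 R2 T (f \<circ> h) q" if "q \<in> sng T" for q
  proof -
    have "q \<in> box" using that box(2) by (auto simp: crossings_def)
    then have "h q \<in> sng D" using mem(3) that by blast
    then have "singular_condition R1 R2 D f (h q)" using f by (simp add: point_coloring_def)
    then show ?thesis using placed_conditions(1)[OF pl T that] by blast
  qed
  ultimately show ?thesis by (simp add: point_coloring_def)
qed

text \<open>
  The curve does not end at a boundary point of the box: otherwise an arc through this point would
  locally lie on the tangle, where the height is injective and has an extremum at the boundary point.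
\<close>

lemma frequently_outside:
  assumes D: "singular_link_diagram D" and pl: "placed h T D \<Delta>" and T: "box_tangle T"
    and z: "z \<in> curve T \<inter> frontier box"
  shows "\<exists>\<^sub>F y in at (h z) within curve D. y \<notin> \<Delta>"
  unfolding frequently_def
proof
  assume "\<forall>\<^sub>F y in at (h z) within curve D. \<not> y \<notin> \<Delta>"
  then obtain U where U: "open U" "h z \<in> U" "\<And>y. y \<in> U \<Longrightarrow> y \<noteq> h z \<Longrightarrow> y \<in> curve D \<Longrightarrow> y \<in> \<Delta>"
    unfolding eventually_at_topological by blast
  obtain k where hom: "homeomorphism UNIV UNIV h k" using placed_homeomorphism[OF pl] .
  have kh: "k (h x) = x" and hk: "h (k x) = x" for x using hom by (auto simp: homeomorphism_def)
  have contk: "continuous_on UNIV k" using hom by (auto simp: homeomorphism_def)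
  have zb: "z \<in> box" "z \<notin> crossings T" using z T by (auto simp: box_tangle_def frontier_def)
  note mem = placed_crossings[OF pl T zb(1)]
  have hz: "h z \<in> \<Delta>" "h z \<in> curve D - crossings D" using zb pl mem z by (auto simp: placed_def)
  then obtain g \<epsilon> where g: "arc g" "g (1/2) = h z" "\<epsilon> > 0"
    "curve D \<inter> ball (h z) \<epsilon> = path_image g \<inter> ball (h z) \<epsilon>"
    using D unfolding singular_link_diagram_def simple_point_def by blast
  obtain r where r: "r > 0" "inj_on Im (curve T \<inter> ball z r)"
      "(\<forall>y \<in> curve T \<inter> ball z r. Im y \<le> Im z) \<or> (\<forall>y \<in> curve T \<inter> ball z r. Im z \<le> Im y)"
    using T z unfolding box_tangle_def by blast
  have "open (U \<inter> ball (h z) \<epsilon> \<inter> k -` ball z r)"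
    using U(1) contk by (intro open_Int open_vimage) auto
  moreover have "h z \<in> U \<inter> ball (h z) \<epsilon> \<inter> k -` ball z r" using U(2) g(3) r(1) kh by auto
  ultimately obtain \<delta> where \<delta>: "0 < \<delta>" "\<delta> < 1/2"
    "g ` {1/2-\<delta>..1/2+\<delta>} \<subseteq> U \<inter> ball (h z) \<epsilon> \<inter> k -` ball z r"
    by (rule arc_neighbourhood[OF g(1), unfolded g(2)])
  define I where "I = {1/2-\<delta>..1/2+\<delta>}"
  have I: "I \<subseteq> {0..1}" using \<delta> by (auto simp: I_def)
  have inT: "k (g t) \<in> curve T \<inter> ball z r" if "t \<in> I" for t
  proof -
    have gt: "g t \<in> U \<inter> ball (h z) \<epsilon> \<inter> k -` ball z r" using that \<delta>(3) unfolding I_def by blast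
    moreover have "g t \<in> path_image g" using that I by (auto simp: path_image_def)
    ultimately have gD: "g t \<in> curve D" using g(4) by blast
    have "g t \<in> \<Delta>"
    proof (cases "g t = h z")
      case False
      show ?thesis using gt by (intro U(3)[OF _ False gD]) blast
    qed (simp add: hz(1))
    with gD have "g t \<in> h ` curve T" using placedD(2)[OF pl] by blast
    then show ?thesis using gt kh by auto
  qed
  have "continuous_on I g" using g(1) I by (auto simp: arc_def path_def intro: continuous_on_subset)
  then have "continuous_on I (\<lambda>t. Im (k (g t)))"
    by (intro continuous_intros continuous_on_compose2[OF contk]) auto
  moreover have "inj_on (\<lambda>t. Im (k (g t))) I"
  proof (rule inj_onI)
    fix s t assume st: "s \<in> I" "t \<in> I" "Im (k (g s)) = Im (k (g t))"
    then have "k (g s) = k (g t)" using r(2) inT by (metis inj_onD)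
    then have "g s = g t" using hk by metis
    then show "s = t" using g(1) st I by (auto simp: arc_def dest: inj_onD)
  qed
  moreover have mid: "Im (k (g (1/2))) = Im z" using g(2) kh by simp
  ultimately have "Im (k (g (1/2-\<delta>))) < Im z \<and> Im z < Im (k (g (1/2+\<delta>))) \<or>
      Im (k (g (1/2+\<delta>))) < Im z \<and> Im z < Im (k (g (1/2-\<delta>)))"
    using continuous_inj_imp_mono[of "1/2-\<delta>" "1/2" "1/2+\<delta>" "\<lambda>t. Im (k (g t))"] \<delta>(1)
    unfolding I_def mid by simp
  moreover have "k (g (1/2-\<delta>)) \<in> curve T \<inter> ball z r" "k (g (1/2+\<delta>)) \<in> curve T \<inter> ball z r"
    using \<delta>(1) by (intro inT; simp add: I_def)+
  ultimately show False using r(3) by (metis less_le_not_le)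
qed

section \<open>Replacing a tangle\<close>

text \<open>All that a move has to provide. The relation is directed: existence leads from
  \<open>T\<close> to \<open>T'\<close>, and uniqueness concerns \<open>T'\<close> alone. It will be
  shown in both orders, which also covers inverse moves. Uniqueness speaks of non-crossing points,
  as values at crossings carry no meaning.\<close>

definition boundary_extends ::
  "'a set \<Rightarrow> ('a \<Rightarrow> 'a \<Rightarrow> 'a) \<Rightarrow> ('a \<Rightarrow> 'a \<Rightarrow> 'a) \<Rightarrow> ('a \<Rightarrow> 'a \<Rightarrow> 'a) \<Rightarrow> diagram \<Rightarrow> diagram \<Rightarrow> bool" where
  "boundary_extends X qop R1 R2 T T' \<longleftrightarrow>
     box_tangle T \<and> box_tangle T' \<and> curve T \<inter> frontier box = curve T' \<inter> frontier box \<and>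
     (\<forall>f. point_coloring X qop R1 R2 T f \<longrightarrow>
       (\<exists>f'. point_coloring X qop R1 R2 T' f' \<and> (\<forall>z \<in> curve T \<inter> frontier box. f' z = f z))) \<and>
     (\<forall>f f'. point_coloring X qop R1 R2 T' f \<longrightarrow> point_coloring X qop R1 R2 T' f' \<longrightarrow>
       (\<forall>z \<in> curve T' \<inter> frontier box. f z = f' z) \<longrightarrow> (\<forall>z \<in> curve T' - crossings T'. f z = f' z))"

section \<open>Locality of the crossing conditions\<close>

lemma germ_value_cong:
  assumes "\<And>z. z \<in> curve D \<Longrightarrow> f z = g z"
  shows "germ_value D f p u x \<longleftrightarrow> germ_value D g p u x"
proof -
  have "\<forall>\<^sub>F z in end_at D p u. f z = g z"
    by (intro eventually_end_at) (use assms in \<open>auto simp: eventually_at_filter intro: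
      always_eventually\<close>)
  then show ?thesis
    unfolding germ_value_def by (intro eventually_cong) (auto elim!: eventually_mono)
qed

lemma conditions_local:
  assumes U: "open U" "p \<in> U" "curve D \<inter> U = curve D' \<inter> U" and fg: "\<And>z. z \<in> U \<Longrightarrow> f z = g z"
  shows "singular_condition R1 R2 D f p \<longleftrightarrow> singular_condition R1 R2 D' g p"
    and "over D p = over D' p \<Longrightarrow> regular_condition qop D f p \<longleftrightarrow> regular_condition qop D' g p"
proof -
  have e: "end_at D p = end_at D' p" by (rule end_at_local[OF U])
  have "germ_value D f p u x \<longleftrightarrow> germ_value D' g p u x" for u x
  proof -
    have "\<forall>\<^sub>F z in nhds p. z \<in> U" using U by (intro eventually_nhds_in_open)
    then have "\<forall>\<^sub>F z in at p within curve D. f z = g z"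
      unfolding eventually_at_filter by eventually_elim (simp add: fg)
    then have "\<forall>\<^sub>F z in end_at D p u. f z = g z" by (rule eventually_end_at)
    then show ?thesis unfolding germ_value_def e[symmetric]
      by (intro eventually_cong) (auto elim!: eventually_mono)
  qed
  then show "singular_condition R1 R2 D f p \<longleftrightarrow> singular_condition R1 R2 D' g p"
    "over D p = over D' p \<Longrightarrow> regular_condition qop D f p \<longleftrightarrow> regular_condition qop D' g p"
    by (simp_all add: singular_condition_def regular_condition_def directions_def e)
qed

lemma conditions_cong:
  assumes "\<And>z. z \<in> curve D \<Longrightarrow> f z = g z"
  shows "singular_condition R1 R2 D f p \<longleftrightarrow> singular_condition R1 R2 D g p"
    and "regular_condition qop D f p \<longleftrightarrow> regular_condition qop D g p"
  using germ_value_cong[of D f g, OF assms] by (simp_all add: singular_condition_def regular_condition_def)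

text \<open>\<open>h\<close> and \<open>h'\<close> may differ everywhere inside the box;
  \<open>hh'\<close> is what makes a boundary point of the tangles the same point of the plane in
  both diagrams.\<close>

locale replaced_tangle =
  fixes X :: "'a set" and qop R1 R2 :: "'a \<Rightarrow> 'a \<Rightarrow> 'a"
    and D D' T T' :: diagram and \<Delta> :: "complex set" and h h' :: "complex \<Rightarrow> complex"
  assumes D: "singular_link_diagram D" and D': "singular_link_diagram D'"
    and out: "equal_outside \<Delta> D D'"
    and pl: "placed h T D \<Delta>" and pl': "placed h' T' D' \<Delta>"
    and hh': "\<And>z. z \<in> frontier box \<Longrightarrow> h z = h' z"
    and ext: "boundary_extends X qop R1 R2 T T'"
begin

lemma T: "box_tangle T" and T': "box_tangle T'"
  and boundary: "curve T \<inter> frontier box = curve T' \<inter> frontier box"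
  using ext by (auto simp: boundary_extends_def)

lemma compact_disk: "compact \<Delta>"
proof -
  obtain k where "homeomorphism UNIV UNIV h k" using placed_homeomorphism[OF pl] .
  then have "continuous_on box h" by (auto simp: homeomorphism_def intro: continuous_on_subset)
  then show ?thesis unfolding placedD(1)[OF pl] by (intro compact_continuous_image) (simp_all add: Defs.box_def)
qed

lemma outside: "open (- \<Delta>)" "curve D \<inter> - \<Delta> = curve D' \<inter> - \<Delta>"
  "reg D \<inter> - \<Delta> = reg D' \<inter> - \<Delta>" "sng D \<inter> - \<Delta> = sng D' \<inter> - \<Delta>" "crossings D \<inter> - \<Delta> = crossings D' \<inter> - \<Delta>"
  "\<And>p. p \<in> reg D - \<Delta> \<Longrightarrow> over D p = over D' p"
  using compact_imp_closed[OF compact_disk] out by (auto simp: equal_outside_def crossings_def)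

lemma frontier_not_crossing:
  assumes "z \<in> curve T \<inter> frontier box"
  shows "z \<in> box" "h z \<in> curve D - crossings D" "h' z = h z" "h z \<in> curve D' - crossings D'"
proof -
  show b: "z \<in> box" using assms T by (auto simp: box_tangle_def)
  have "z \<notin> crossings T" "z \<notin> crossings T'" using assms T T'
    by (auto simp: box_tangle_def frontier_def)
  then show "h z \<in> curve D - crossings D" "h' z = h z" "h z \<in> curve D' - crossings D'"
    using placed_crossings[OF pl T b] placed_crossings[OF pl' T' b] hh'[of z] assms boundary by auto
qed

lemma point_coloring_glue:
  assumes f: "point_coloring X qop R1 R2 D f"
  obtains f' where "point_coloring X qop R1 R2 D' f'" "\<And>z. z \<notin> \<Delta> \<Longrightarrow> f' z = f z"
proof -
  have "point_coloring X qop R1 R2 T (f \<circ> h)" by (rule point_coloring_restrict[OF pl T f])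
  then obtain F where F: "point_coloring X qop R1 R2 T' F"
    "\<And>z. z \<in> curve T \<inter> frontier box \<Longrightarrow> F z = f (h z)"
    using ext unfolding boundary_extends_def by (metis comp_apply)
  obtain k where hom: "homeomorphism UNIV UNIV h' k" using placed_homeomorphism[OF pl'] .
  have kh: "k (h' x) = x" and hk: "h' (k x) = x" for x using hom by (auto simp: homeomorphism_def)
  have contk: "continuous_on UNIV k" using hom by (auto simp: homeomorphism_def)
  \<comment> \<open>Boundary points of the disk belong to \<open>\<Delta>\<close> and get their
    color from \<open>F\<close>, which was chosen to agree with \<open>f\<close> there.\<close>
  define f' where "f' = (\<lambda>z. if z \<in> \<Delta> then F (k z) else f z)"
  have inside: "f' (h' z) = F z" if "z \<in> box" for z
    using that placedD(1)[OF pl'] by (auto simp: f'_def kh)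
  have T'box: "curve T' \<subseteq> box" "crossings T' \<subseteq> curve T' \<inter> interior box"
    using T' by (auto simp: box_tangle_def)
  have fF: "\<And>z. z \<in> curve T' \<Longrightarrow> (f' \<circ> h') z = F z" using inside T'box by auto
  have "f' z \<in> X \<and> (\<forall>\<^sub>F y in at z within curve D'. f' y = f' z)"
    if z: "z \<in> curve D' - crossings D'" for z
  proof (cases "z \<in> \<Delta>")
    case False
    then have zD: "z \<in> curve D - crossings D" using z outside by blast
    have "\<forall>\<^sub>F y in nhds z. y \<in> - \<Delta>" using outside(1) False by (intro eventually_nhds_in_open) auto
    moreover have "\<forall>\<^sub>F y in nhds z. y \<noteq> z \<longrightarrow> y \<in> curve D \<longrightarrow> f y = f z"
      using f zD by (auto simp: point_coloring_def eventually_at_filter)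
    ultimately have "\<forall>\<^sub>F y in at z within curve D'. f' y = f' z"
      unfolding eventually_at_filter
    proof eventually_elim
      case (elim y)
      have "y \<in> curve D" if "y \<in> curve D'" using elim(1) that outside(2) by blast
      then show ?case using elim False by (simp add: f'_def)
    qed
    moreover have "f z \<in> X" using f zD by (simp add: point_coloring_def)
    ultimately show ?thesis using False by (simp add: f'_def)
  next
    case True
    define q where "q = k z"
    have zq: "z = h' q" by (simp add: q_def hk)
    have qb: "q \<in> box" using True placedD(1)[OF pl'] by (auto simp: q_def kh)
    have q: "q \<in> curve T' - crossings T'" using z placed_crossings[OF pl' T' qb] by (simp add: zq)
    have f'z: "f' z = F q" using inside[OF qb] by (simp add: zq)
    have FX: "F q \<in> X" "\<forall>\<^sub>F y in at q within curve T'. F y = F q"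
      using F(1) q by (auto simp: point_coloring_def)
    have "isCont k z" using contk by (simp add: continuous_on_eq_continuous_at)
    then have "(k \<longlongrightarrow> q) (at z within curve D' \<inter> \<Delta>)"
      by (auto simp: q_def isCont_def intro: tendsto_within_subset)
    moreover have "k y \<in> curve T' \<and> k y \<noteq> q" if "y \<in> curve D' \<inter> \<Delta>" "y \<noteq> z" for y
      using that placedD(2)[OF pl'] kh hk unfolding q_def by (metis imageE)
    then have "\<forall>\<^sub>F y in at z within curve D' \<inter> \<Delta>. k y \<in> curve T' \<and> k y \<noteq> q"
      by (auto simp: eventually_at_filter intro: always_eventually)
    ultimately have "filterlim k (at q within curve T') (at z within curve D' \<inter> \<Delta>)"
      by (simp add: filterlim_at)
    then have "\<forall>\<^sub>F y in at z within curve D' \<inter> \<Delta>. F (k y) = F q"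
      using FX(2) unfolding filterlim_iff by blast
    \<comment> \<open>Near \<open>z\<close> the points of the curve inside and outside the disk are
      treated separately, since \<open>f'\<close> is defined by two different functions
      there.\<close>
    then have 1: "\<forall>\<^sub>F y in nhds z. y \<noteq> z \<longrightarrow> y \<in> curve D' \<longrightarrow> y \<in> \<Delta> \<longrightarrow> f' y = f' z"
      unfolding eventually_at_filter by eventually_elim (simp add: f'_def f'z[symmetric] True q_def)
    \<comment> \<open>Points outside the disk can accumulate at \<open>z\<close> only if
      \<open>q\<close> lies on the frontier; in that case \<open>z = h q\<close>, and
      \<open>f\<close> is locally constant at \<open>z\<close> with the value
      \<open>F q\<close>.\<close>
    have 2: "\<forall>\<^sub>F y in nhds z. y \<noteq> z \<longrightarrow> y \<in> curve D' \<longrightarrow> y \<notin> \<Delta> \<longrightarrow> f' y = f' z"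
    proof (cases "q \<in> frontier box")
      case True
      then have qT: "q \<in> curve T \<inter> frontier box" using q boundary by blast
      note fr = frontier_not_crossing[OF qT]
      have zh: "z = h q" using fr(3) zq by simp
      have "\<forall>\<^sub>F y in nhds z. y \<noteq> z \<longrightarrow> y \<in> curve D \<longrightarrow> f y = f z"
        using f fr(2) by (auto simp: point_coloring_def eventually_at_filter zh)
      then show ?thesis
      proof eventually_elim
        case (elim y)
        have "y \<in> curve D" if "y \<in> curve D'" "y \<notin> \<Delta>" using that outside(2) by blast
        then show ?case using elim F(2)[OF qT] f'z zh by (simp add: f'_def)
      qed
    next
      case False
      then have "q \<in> interior box" using qb by (auto simp: frontier_def Defs.box_def)
      then have "z \<in> h' ` interior box" by (auto simp: zq)
      then have "\<forall>\<^sub>F y in nhds z. y \<in> h' ` interior box"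
        using placed_interior(1)[OF pl'] by (intro eventually_nhds_in_open) auto
      then show ?thesis by eventually_elim (use placed_interior(2)[OF pl'] in blast)
    qed
    from 1 2 have "\<forall>\<^sub>F y in at z within curve D'. f' y = f' z"
      unfolding eventually_at_filter by eventually_elim blast
    with FX(1) f'z show ?thesis by simp
  qed
  moreover have "regular_condition qop D' f' p" if p: "p \<in> reg D'" for p
  proof (cases "p \<in> \<Delta>")
    case True
    then obtain q where q: "q \<in> reg T'" "p = h' q" using p placedD(3)[OF pl'] by blast
    have "regular_condition qop T' F q" using F(1) q(1) by (simp add: point_coloring_def)
    then have "regular_condition qop T' (f' \<circ> h') q"
      using conditions_cong(2)[of T' "f' \<circ> h'" F] fF by blast
    then show ?thesis using placed_conditions(2)[OF pl' T' q(1)] q(2) by blast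
  next
    case False
    then have pD: "p \<in> reg D - \<Delta>" using p outside(3) by blast
    then have "regular_condition qop D f p" using f by (simp add: point_coloring_def)
    then show ?thesis
      using conditions_local(2)[of
        "- \<Delta>" p D D' f f' qop] outside(1,2) outside(6)[OF pD] False by (simp add: f'_def)
  qed
  moreover have "singular_condition R1 R2 D' f' p" if p: "p \<in> sng D'" for p
  proof (cases "p \<in> \<Delta>")
    case True
    then obtain q where q: "q \<in> sng T'" "p = h' q" using p placedD(4)[OF pl'] by blast
    have "singular_condition R1 R2 T' F q" using F(1) q(1) by (simp add: point_coloring_def)
    then have "singular_condition R1 R2 T' (f' \<circ> h') q"
      using conditions_cong(1)[of T' "f' \<circ> h'" F] fF by blast
    then show ?thesis using placed_conditions(1)[OF pl' T' q(1)] q(2) by blast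
  next
    case False
    then have pD: "p \<in> sng D - \<Delta>" using p outside(4) by blast
    then have "singular_condition R1 R2 D f p" using f by (simp add: point_coloring_def)
    then show ?thesis
      using conditions_local(1)[of "- \<Delta>" p D D' f f' R1 R2] outside(1,2) False by (simp add: f'_def)
  qed
  ultimately have "point_coloring X qop R1 R2 D' f'" by (simp add: point_coloring_def)
  then show ?thesis using that by (simp add: f'_def)
qed

text \<open>The curve leaves the disk arbitrarily close to each boundary point, so the color at this
  point is already taken outside the disk. The boundary colors then determine everything
  inside.\<close>

lemma point_coloring_determined:
  assumes f: "point_coloring X qop R1 R2 D' f" and g: "point_coloring X qop R1 R2 D' g"
    and eq: "\<And>z. z \<in> curve D' - crossings D' - \<Delta> \<Longrightarrow> f z = g z"
    and z: "z \<in> curve D' - crossings D'"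
  shows "f z = g z"
proof (cases "z \<in> \<Delta>")
  case True
  have "(f \<circ> h') q = (g \<circ> h') q" if q: "q \<in> curve T' \<inter> frontier box" for q
  proof -
    have hq: "h' q \<in> curve D' - crossings D'" using frontier_not_crossing[of q] q boundary by simp
    have "\<forall>\<^sub>F y in at (h' q) within curve D'. f y = f (h' q)"
      "\<forall>\<^sub>F y in at (h' q) within curve D'. g y = g (h' q)"
      using f g hq by (auto simp: point_coloring_def)
    moreover have "open (- crossings D')"
      using D' by (intro open_Compl finite_imp_closed) (auto simp: singular_link_diagram_def)
    then have "\<forall>\<^sub>F y in nhds (h' q). y \<in> - crossings D'" using hq
      by (intro eventually_nhds_in_open) auto
    then have "\<forall>\<^sub>F y in at (h' q) within curve D'. y \<in> curve D' - crossings D'"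
      unfolding eventually_at_filter by eventually_elim auto
    \<comment> \<open>The conclusion does not mention \<open>y\<close>: a single point of the curve
      outside the disk is enough, and \<open>frequently_outside\<close> supplies it.\<close>
    ultimately have "\<forall>\<^sub>F y in at (h' q) within curve D'. y \<notin> \<Delta> \<longrightarrow> f (h' q) = g (h' q)"
      by eventually_elim (use eq in force)
    with frequently_outside[OF D' pl' T' q] have
      "\<exists>\<^sub>F y in at (h' q) within curve D'. f (h' q) = g (h' q)"
      by (rule frequently_rev_mp)
    then show ?thesis by (auto dest: frequently_ex)
  qed
  moreover note point_coloring_restrict[OF pl' T' f] point_coloring_restrict[OF pl' T' g]
  ultimately have all: "(f \<circ> h') q = (g \<circ> h') q" if "q \<in> curve T' - crossings T'" for q
    using ext that unfolding boundary_extends_def by blast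
  obtain q where q: "q \<in> curve T'" "z = h' q" using True z placedD(2)[OF pl'] by blast
  then have "q \<in> box" using T' by (auto simp: box_tangle_def)
  then have "q \<notin> crossings T'" using z q placed_crossings(4)[OF pl' T'] by blast
  then show ?thesis using all[of q] q by simp
qed (use eq z in blast)

lemma coloring_transfer:
  assumes c: "c \<in> colorings X qop R1 R2 D"
  shows "\<exists>!c'. c' \<in> colorings X qop R1 R2 D' \<and> same_colors_outside \<Delta> D D' c c'"
proof -
  have mem: "z \<in> curve D - crossings D - \<Delta> \<longleftrightarrow> z \<in> curve D' - crossings D' - \<Delta>" for z
    using outside(2,5) by blast
  obtain f' where f': "point_coloring X qop R1 R2 D' f'" "\<And>z. z \<notin> \<Delta> \<Longrightarrow> f' z = c (arc_of D z)"
    using point_coloring_glue[OF coloring_point_coloring[OF D c]] by blast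
  obtain c' where c': "c' \<in> colorings X qop R1 R2 D'"
    "\<And>z. z \<in> curve D' - crossings D' \<Longrightarrow> c' (arc_of D' z) = f' z"
    using point_coloring_coloring[OF D' f'(1)] by blast
  show ?thesis
  proof (intro ex1I[of _ c'] conjI)
    show "same_colors_outside \<Delta> D D' c c'"
      unfolding same_colors_outside_def using c'(2) f'(2) mem by simp
    fix d assume d: "d \<in> colorings X qop R1 R2 D' \<and> same_colors_outside \<Delta> D D' c d"
    show "d = c'"
    proof (rule coloring_eqI[of _ X qop R1 R2 D'])
      fix z assume "z \<in> curve D' - crossings D'"
      then show "d (arc_of D' z) = c' (arc_of D' z)"
      proof (rule point_coloring_determined[OF coloring_point_coloring[OF D']
        coloring_point_coloring[OF D'], rotated 3])
        fix y assume y: "y \<in> curve D' - crossings D' - \<Delta>"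
        then have "c (arc_of D y) = d (arc_of D' y)" using d mem unfolding same_colors_outside_def by blast
        then show "d (arc_of D' y) = c' (arc_of D' y)" using y f'(2) c'(2) by simp
      qed (use d c' in auto)
    qed (use d c' in auto)
  qed (use c' in auto)
qed

end

lemma bij_betw_unique_partner:
  assumes 1: "\<And>a. a \<in> A \<Longrightarrow> \<exists>!b. b \<in> B \<and> R a b" and 2: "\<And>b. b \<in> B \<Longrightarrow> \<exists>!a. a \<in> A \<and> R a b"
  shows "bij_betw (\<lambda>a. THE b. b \<in> B \<and> R a b) A B"
proof -
  have the: "(THE b. b \<in> B \<and> R a b) \<in> B \<and> R a (THE b. b \<in> B \<and> R a b)" if "a \<in> A" for a
    by (rule theI'[OF 1[OF that]])
  show ?thesis
  proof (rule bij_betw_imageI)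
    show "inj_on (\<lambda>a. THE b. b \<in> B \<and> R a b) A" using the 2 by (intro inj_onI) metis
    show "(\<lambda>a. THE b. b \<in> B \<and> R a b) ` A = B"
    proof (intro equalityI subsetI)
      fix b assume b: "b \<in> B"
      then obtain a where "a \<in> A" "R a b" using 2 by blast
      then have "(THE b. b \<in> B \<and> R a b) = b" using b 1 the by metis
      then show "b \<in> (\<lambda>a. THE b. b \<in> B \<and> R a b) ` A" using \<open>a \<in> A\<close> by blast
    qed (use the in auto)
  qed
qed

text \<open>The situation is symmetric once \<open>T\<close> and \<open>T'\<close> are exchanged, so
  unique partners exist in both directions, and such a relation is a bijection.\<close>

lemma single_move_colorings:
  assumes D: "singular_link_diagram D" "singular_link_diagram D'" and move: "single_move \<Delta> D D'"
    and ext: "\<And>T T'. local_move T T' \<Longrightarrow> boundary_extends X qop R1 R2 T T'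
      \<and> boundary_extends X qop R1 R2 T' T"
  shows "(\<forall>c \<in> colorings X qop R1 R2 D.
            \<exists>!c'. c' \<in> colorings X qop R1 R2 D' \<and> same_colors_outside \<Delta> D D' c c') \<and>
         bij_betw
           (\<lambda>c. THE c'. c' \<in> colorings X qop R1 R2 D' \<and> same_colors_outside \<Delta> D D' c c')
           (colorings X qop R1 R2 D) (colorings X qop R1 R2 D')"
proof -
  obtain T T' h h' where TT: "local_move T T' \<or> local_move T' T"
    and pl: "placed h T D \<Delta>" "placed h' T' D' \<Delta>" "\<forall>z \<in> frontier box. h z = h' z"
    and out: "equal_outside \<Delta> D D'"
    using move unfolding single_move_def by blast
  have ext: "boundary_extends X qop R1 R2 T T'" "boundary_extends X qop R1 R2 T' T"
    using ext[of T T'] ext[of T' T] TT by auto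
  have out': "equal_outside \<Delta> D' D" using out by (auto simp: equal_outside_def)
  have same: "same_colors_outside \<Delta> D' D c' c
    \<longleftrightarrow> same_colors_outside \<Delta> D D' c c'" for c c' :: "complex set \<Rightarrow> 'a"
  proof -
    have "curve D' - crossings D' - \<Delta> = curve D - crossings D - \<Delta>"
      using out by (auto simp: equal_outside_def crossings_def)
    then show ?thesis by (auto simp: same_colors_outside_def)
  qed
  interpret forth: replaced_tangle X qop R1 R2 D D' T T' \<Delta> h h'
    using D pl out ext by unfold_locales auto
  interpret converse: replaced_tangle X qop R1 R2 D' D T' T \<Delta> h' h
    using D pl out' ext by unfold_locales auto
  show ?thesis
    using forth.coloring_transfer converse.coloring_transfer
    by (intro conjI ballI bij_betw_unique_partner) (simp_all add: same)
qed

section \<open>Coordinates of drawn tangles\<close>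

text \<open>Width \<open>c\<close> and slope \<open>e\<close> stay parameters because crossings use
  segments of width 1, caps and cups segments of width \<open>1/2\<close>, both with slopes 1 and
  -1.\<close>

lemma mem_diagonal:
  assumes "c > 0"
  shows "z \<in> closed_segment (Complex a b) (Complex (a + c) (b + e * c)) \<longleftrightarrow>
    a \<le> Re z \<and> Re z \<le> a + c \<and> Im z = b + e * (Re z - a)"
proof
  assume "z \<in> closed_segment (Complex a b) (Complex (a + c) (b + e * c))"
  then obtain u where u: "0 \<le> u" "u \<le> 1"
    "z = (1 - u) *\<^sub>R Complex a b + u *\<^sub>R Complex (a + c) (b + e * c)"
    by (auto simp: in_segment)
  then have "Re z = (1 - u) * a + u * (a + c)" "Im z = (1 - u) * b + u * (b + e * c)" by simp_all
  then have "Re z = a + u * c" "Im z = b + e * (u * c)" by (simp_all add: algebra_simps)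
  moreover have "u * c \<le> 1 * c" using u(2) assms by (intro mult_right_mono) auto
  ultimately show "a \<le> Re z \<and> Re z \<le> a + c \<and> Im z = b + e * (Re z - a)" using u(1) assms by simp
next
  assume z: "a \<le> Re z \<and> Re z \<le> a + c \<and> Im z = b + e * (Re z - a)"
  define u where "u = (Re z - a) / c"
  have "u * c = Re z - a" "0 \<le> u" "u \<le> 1" using assms z by (simp_all add: u_def)
  moreover have "z = (1 - u) *\<^sub>R Complex a b + u *\<^sub>R Complex (a + c) (b + e * c)"
  proof -
    have "Re z = a + u * c" "Im z = b + e * (u * c)" using z \<open>u * c = Re z - a\<close> by simp_all
    then show ?thesis by (simp add: complex_eq_iff algebra_simps)
  qed
  ultimately show "z \<in> closed_segment (Complex a b) (Complex (a + c) (b + e * c))"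
    by (auto simp: in_segment)
qed

lemma mem_vertical:
  "z \<in> closed_segment (node j k) (node j (k + 1)) \<longleftrightarrow> Re z = j
    \<and> - real k - 1 \<le> Im z \<and> Im z \<le> - real k"
  by (subst closed_segment_commute) (auto simp: node_def closed_segment_same_Re closed_segment_eq_real_ivl)

lemma mem_falling:
  assumes "c > 0"
  shows "z \<in> closed_segment (Complex a b) (Complex (a + c) (b - c)) \<longleftrightarrow>
    a \<le> Re z \<and> Re z \<le> a + c \<and> Im z = b - (Re z - a)"
  using mem_diagonal[OF assms, of z a b "-1"] by (simp add: algebra_simps)

lemma mem_rising:
  assumes "c > 0"
  shows "z \<in> closed_segment (Complex a b) (Complex (a + c) (b + c)) \<longleftrightarrow>
    a \<le> Re z \<and> Re z \<le> a + c \<and> Im z = b + (Re z - a)"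
  using mem_diagonal[OF assms, of z a b 1] by simp

text \<open>Relative to the center, the two diagonals together satisfy a single equation between
  absolute values, which spares later case distinctions.\<close>

lemma mem_cross_at:
  "z \<in> cross_at i k \<longleftrightarrow> \<bar>Re z - (real i + 1/2)\<bar>
    = \<bar>Im z + (real k + 1/2)\<bar> \<and> \<bar>Im z + (real k + 1/2)\<bar> \<le> 1/2"
proof -
  have n: "node i k = Complex (real i) (- real k)" "node i (k + 1) = Complex (real i) (- real k - 1)"
    "node (i + 1) k = Complex (real i + 1) (- real k - 1 + 1)"
      "node (i + 1) (k + 1) = Complex (real i + 1) (- real k - 1)"
    by (simp_all add: node_def)
  have "z \<in> cross_at i k \<longleftrightarrow>
    (real i \<le> Re z \<and> Re z \<le> real i + 1 \<and> Im z = - real k - (Re z - real i)) \<or>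
    (real i \<le> Re z \<and> Re z \<le> real i + 1 \<and> Im z = - real k - 1 + (Re z - real i))"
    unfolding cross_at_def Un_iff closed_segment_commute[of "node (i + 1) k"] unfolding n
    by (subst mem_falling mem_rising, simp)+ simp
  then show ?thesis by (simp only:) argo
qed

lemma mem_cap:
  "z
    \<in> closed_segment (node i (k + 1)) (center i k) \<union> closed_segment (center i k) (node (i
    + 1) (k + 1)) \<longleftrightarrow>
   \<bar>Re z - (real i + 1/2)\<bar> = - Im z - (real k + 1/2) \<and> - Im z - (real k + 1/2) \<le> 1/2"
proof -
  have n: "node i (k + 1) = Complex (real i) (- real k - 1)"
    "node (i + 1) (k + 1) = Complex (real i + 1/2 + 1/2) (- real k - 1/2 - 1/2)"
    by (simp_all add: node_def)
  have c: "center i k = Complex (real i + 1/2) (- real k - 1 + 1/2)"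
    "center i k = Complex (real i + 1/2) (- real k - 1/2)"
    by (simp_all add: center_def)
  have "z \<in> closed_segment (node i (k + 1)) (center i k) \<longleftrightarrow>
    (real i \<le> Re z \<and> Re z \<le> real i + 1/2 \<and> Im z = - real k - 1 + (Re z - real i))"
    unfolding n c(1) by (subst mem_rising) simp_all
  moreover have "z \<in> closed_segment (center i k) (node (i + 1) (k + 1)) \<longleftrightarrow>
    (real i + 1/2 \<le> Re z \<and> Re z \<le> real i + 1/2 + 1/2 \<and> Im z
      = - real k - 1/2 - (Re z - (real i + 1/2)))"
    unfolding n c(2) by (subst mem_falling) simp_all
  ultimately show ?thesis unfolding Un_iff by (simp only:) argo
qed

lemma mem_cup:
  "z \<in> closed_segment (node i k) (center i k) \<union> closed_segment (center i k) (node (i + 1) k) \<longleftrightarrow>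
   \<bar>Re z - (real i + 1/2)\<bar> = Im z + (real k + 1/2) \<and> Im z + (real k + 1/2) \<le> 1/2"
proof -
  have n: "node i k = Complex (real i) (- real k)"
    "node (i + 1) k = Complex (real i + 1/2 + 1/2) (- real k - 1/2 + 1/2)"
    by (simp_all add: node_def)
  have c: "center i k = Complex (real i + 1/2) (- real k - 1/2)" by (simp add: center_def)
  have "z \<in> closed_segment (node i k) (center i k) \<longleftrightarrow>
    (real i \<le> Re z \<and> Re z \<le> real i + 1/2 \<and> Im z = - real k - (Re z - real i))"
    unfolding n(1) c by (subst mem_falling) simp_all
  moreover have "z \<in> closed_segment (center i k) (node (i + 1) k) \<longleftrightarrow>
    (real i + 1/2 \<le> Re z \<and> Re z \<le> real i + 1/2 + 1/2 \<and> Im z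
      = - real k - 1/2 + (Re z - (real i + 1/2)))"
    unfolding n c by (subst mem_rising) simp_all
  ultimately show ?thesis unfolding Un_iff by (simp only:) argo
qed

section \<open>Layers described by their special position\<close>

fun index :: "layer \<Rightarrow> nat option" where
  "index Straight = None"
| "index (Sigma i) = Some i"
| "index (Sigma_bar i) = Some i"
| "index (Tau i) = Some i"
| "index (Cap i) = Some i"
| "index (Cup i) = Some i"

text \<open>Differs from \<open>index\<close> exactly at caps and cups: the strands are not vertical
  there, yet no crossing is present.\<close>

fun crossing_index :: "layer \<Rightarrow> nat option" where
  "crossing_index (Cap i) = None"
| "crossing_index (Cup i) = None"
| "crossing_index l = index l"

definition fits :: "nat \<Rightarrow> layer \<Rightarrow> bool" where
  "fits n l \<longleftrightarrow> (\<forall>i. index l = Some i \<longrightarrow> 1 \<le> i \<and> i < n)"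

text \<open>Excludes caps and cups. Every position then has a strand both at the top and at the
  bottom of the layer, so that colors can be propagated downwards.\<close>

definition plain :: "nat \<Rightarrow> layer \<Rightarrow> bool" where
  "plain n l \<longleftrightarrow> fits n l \<and> crossing_index l = index l"

lemma verticals_draw:
  "j \<in> {1..n} \<Longrightarrow> index l \<noteq> Some j \<Longrightarrow> index l \<noteq> Some (j - 1) \<Longrightarrow>
    closed_segment (node j k) (node j (k + 1)) \<subseteq> draw n k l"
  by (cases l) (auto simp: verticals_def)

lemma cross_draw: "crossing_index l = Some i \<Longrightarrow> cross_at i k \<subseteq> draw n k l"
  by (cases l) auto

lemma mem_verticals:
  "z \<in> verticals I k \<longleftrightarrow> (\<exists>j \<in> I. Re z = real j) \<and> - real k - 1 \<le> Im z \<and> Im z \<le> - real k"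
  unfolding verticals_def by (auto simp: mem_vertical simp del: One_nat_def)

text \<open>A cap and a cup are the lower and the upper half of a cross, so one equation between
  absolute values covers every part that is not vertical.\<close>

lemma draw_cases:
  assumes "z \<in> draw n k l"
  obtains (vertical) j where "j \<in> {1..n}" "index l \<noteq> Some j" "index l \<noteq> Some (j - 1)"
      "Re z = real j" "- real k - 1 \<le> Im z" "Im z \<le> - real k"
  | (diagonal) i where "index l = Some i" "\<bar>Re z - (real i + 1/2)\<bar> = \<bar>Im z + (real k + 1/2)\<bar>"
      "- real k - 1 \<le> Im z" "Im z \<le> - real k"
proof -
  have v: thesis if vi: "z \<in> verticals ({1..n} - {i, i + 1}) k" "index l = Some i" for i
  proof -
    obtain j where "j \<in> {1..n} - {i, i + 1}" "Re z = real j" "- real k - 1 \<le> Im z" "Im z \<le> - real k"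
      using vi(1) unfolding mem_verticals by blast
    then show thesis by (intro vertical[of j]) (use vi(2) in auto)
  qed
  have d: thesis if "index l = Some i" "\<bar>Re z - (real i + 1/2)\<bar> = \<bar>Im z + (real k + 1/2)\<bar>"
    "\<bar>Im z + (real k + 1/2)\<bar> \<le> 1/2" for i
    using that diagonal[of i] by (auto simp: abs_if split: if_splits)
  show thesis
  proof (cases l)
    case Straight
    then show ?thesis using assms vertical by (auto simp: mem_verticals)
  next
    case (Cap i)
    then have "z \<in> verticals ({1..n} - {i, i + 1}) k \<or> \<bar>Re z - (real i + 1/2)\<bar>
      = - Im z - (real k + 1/2)
        \<and> - Im z - (real k + 1/2) \<le> 1/2"
      using assms mem_cap[of z i k] by auto
    then show ?thesis using v[of i] d[of i] Cap by auto
  next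
    case (Cup i)
    then have "z \<in> verticals ({1..n} - {i, i + 1}) k \<or> \<bar>Re z - (real i + 1/2)\<bar>
      = Im z + (real k + 1/2)
        \<and> Im z + (real k + 1/2) \<le> 1/2"
      using assms mem_cup[of z i k] by auto
    then show ?thesis using v[of i] d[of i] Cup by auto
  qed (use assms v d in \<open>auto simp: mem_cross_at\<close>)
qed

lemma draw_height: "z \<in> draw n k l \<Longrightarrow> - real k - 1 \<le> Im z \<and> Im z \<le> - real k"
  by (erule draw_cases) auto

lemma curve_tangle: "z \<in> curve (tangle n ls) \<longleftrightarrow> (\<exists>k < length ls. z \<in> draw n k (ls ! k))"
  by (auto simp: tangle_def)

lemma crossings_tangle:
  "z \<in> crossings (tangle n ls) \<longleftrightarrow> (\<exists>i k. k < length ls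
    \<and> crossing_index (ls ! k) = Some i \<and> z = center i k)"
proof -
  have *: "crossing_index l = Some i \<longleftrightarrow> l \<in> {Sigma i, Sigma_bar i} \<or> l = Tau i" for l i
    by (cases l) auto
  show ?thesis unfolding * by (auto simp: tangle_def crossings_def)
qed

lemma center_coords [simp]: "Re (center i k) = real i + 1/2" "Im (center i k) = - real k - 1/2"
  by (simp_all add: center_def)

lemma node_coords [simp]: "Re (node i k) = real i" "Im (node i k) = - real k"
  by (simp_all add: node_def)

lemma center_eq_iff [simp]: "center i k = center i' k' \<longleftrightarrow> i = i' \<and> k = k'"
  by (auto simp: complex_eq_iff)

lemma node_eq_iff [simp]: "node i k = node i' k' \<longleftrightarrow> i = i' \<and> k = k'"
  by (auto simp: complex_eq_iff)

text \<open>A center lies strictly inside its strip, halfway down, so the bounds on the height leave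
  only layer \<open>k\<close>.\<close>

lemma crossing_heights:
  assumes "z \<in> crossings (tangle n ls)" "- real k - 1 \<le> Im z" "Im z \<le> - real k"
  shows "k < length ls \<and> (\<exists>i. crossing_index (ls ! k) = Some i \<and> z = center i k)"
proof -
  obtain i k' where k': "k' < length ls" "crossing_index (ls ! k') = Some i" "z = center i k'"
    using assms(1) by (auto simp: crossings_tangle)
  then have "real k' < real k + 1" "real k < real k' + 1" using assms by auto
  then have "k' = k" by linarith
  with k' show ?thesis by auto
qed

section \<open>Tangles inside the box\<close>

lemma mem_box: "z \<in> box \<longleftrightarrow> 0 \<le> Re z \<and> Re z \<le> 4 \<and> -3 \<le> Im z \<and> Im z \<le> 0"
  by (auto simp: Defs.box_def in_cbox_complex_iff)

lemma mem_interior_box: "z \<in> interior box \<longleftrightarrow> 0 < Re z \<and> Re z < 4 \<and> -3 < Im z \<and> Im z < 0"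
  by (auto simp: Defs.box_def in_box_complex_iff interior_cbox)

lemma mem_frontier_box: "z \<in> frontier box \<longleftrightarrow> z \<in> box \<and> (Re z = 0 \<or> Re z = 4 \<or> Im z = -3 \<or> Im z = 0)"
proof -
  have "closed box" unfolding Defs.box_def by (rule closed_cbox)
  then have "z \<in> frontier box \<longleftrightarrow> z \<in> box \<and> z \<notin> interior box" by (simp add: frontier_def)
  then show ?thesis by (auto simp: mem_box mem_interior_box)
qed

lemma draw_fits:
  assumes "z \<in> draw n k l" "fits n l"
  shows "1 \<le> Re z \<and> Re z \<le> real n"
  using assms(1)
proof (cases rule: draw_cases)
  case (diagonal i)
  then have "1 \<le> i" "i < n" using assms(2) by (auto simp: fits_def)
  then have "1 \<le> real i" "real i + 1 \<le> real n" by linarith+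
  moreover have "\<bar>Re z - (real i + 1/2)\<bar> \<le> 1/2" using diagonal by (auto simp: abs_if)
  ultimately show ?thesis by (intro conjI; linarith)
qed auto

lemma draw_boundary:
  assumes "z \<in> draw n k l" "Im z = - real k \<or> Im z = - real k - 1"
  obtains j where "Re z = real j"
  using assms(1)
proof (cases rule: draw_cases)
  case (diagonal i)
  then have "Re z = real i \<or> Re z = real (i + 1)" using assms(2) by (auto simp: abs_if split: if_splits)
  then show ?thesis using that by blast
qed (use that in blast)

text \<open>At distance less than \<open>1/2\<close> from position \<open>j\<close> a layer has a
  single strand: a vertical one, or the left or right side of a cross, where the real part is a
  function of the height.\<close>

lemma draw_injective:
  assumes y: "y \<in> draw n k l" "\<bar>Re y - real j\<bar> < 1/2" and z: "z \<in> draw n k l"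
    "\<bar>Re z - real j\<bar> < 1/2"
    and h: "Im y = Im z" "Im z \<noteq> - real k - 1/2"
  shows "y = z"
proof -
  have vert: "j' = j" if "\<bar>real j' - real j\<bar> < 1/2" for j' using that by linarith
  have diag: "(j = i \<and> Re w = real i + 1/2 - \<bar>Im w + (real k + 1/2)\<bar>) \<or>
      (j = i + 1 \<and> Re w = real i + 1/2 + \<bar>Im w + (real k + 1/2)\<bar>)"
    if "\<bar>Re w - (real i + 1/2)\<bar> = \<bar>Im w + (real k + 1/2)\<bar>" "- real k - 1 \<le> Im w" "Im w \<le> - real k"
      "\<bar>Re w - real j\<bar> < 1/2" for w i
  proof -
    have "\<bar>Im w + (real k + 1/2)\<bar> \<le> 1/2" using that by (auto simp: abs_if)
    then have "real i - 1 < real j" "real j < real i + 2" using that by linarith+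
    then have "j = i \<or> j = i + 1" by linarith
    then show ?thesis using that by (auto simp: abs_if split: if_splits)
  qed
  have "Re y = Re z"
    using y(1)
  proof (cases rule: draw_cases)
    case v: (vertical jy)
    have jy: "jy = j" using v y(2) vert by simp
    show ?thesis using z(1)
    proof (cases rule: draw_cases)
      case (vertical jz)
      then show ?thesis using v jy z(2) vert[of jz] by simp
    next
      case (diagonal i)
      then show ?thesis using diag[of z i] z(2) v jy by auto
    qed
  next
    case d: (diagonal i)
    note dy = diag[OF d(2-4) y(2)]
    show ?thesis using z(1)
    proof (cases rule: draw_cases)
      case (vertical jz)
      then show ?thesis using dy d z(2) vert[of jz] by auto
    next
      case (diagonal i')
      then show ?thesis using diag[of z i'] z(2) d dy h by auto
    qed
  qed
  with h show ?thesis by (simp add: complex_eq_iff)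
qed

lemma over_tangle: "over (tangle n ls) p \<subseteq> sphere 0 1"
proof -
  have "norm (sgn (1 - \<i>)) = 1" "norm (sgn (1 + \<i>)) = 1" by (simp_all add: norm_sgn complex_eq_iff)
  then show ?thesis by (auto simp: tangle_def)
qed

text \<open>All strands run between the real parts 1 and 3, strictly between the sides of the box,
  so the frontier is met at the top and the bottom only.\<close>

lemma box_tangle_tangle:
  assumes "length ls = 3" "n \<le> 3" "list_all (fits n) ls"
  shows "box_tangle (tangle n ls)"
proof -
  let ?T = "tangle n ls"
  have fit: "fits n (ls ! k)" if "k < 3" for k using assms that by (simp add: list_all_length)
  have box: "1 \<le> Re z" "Re z \<le> 3" "-3 \<le> Im z" "Im z \<le> 0" if zT: "z \<in> curve ?T" for z
  proof -
    obtain k where k: "k < 3" "z \<in> draw n k (ls ! k)" using zT unfolding curve_tangle assms(1) by blast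
    then show "1 \<le> Re z" "Re z \<le> 3" "-3 \<le> Im z" "Im z \<le> 0"
      using draw_fits[OF k(2) fit[OF k(1)]] draw_height[OF k(2)] assms(2) by auto
  qed
  have "z \<in> curve ?T \<inter> interior box" if z: "z \<in> crossings ?T" for z
  proof -
    obtain i k where k: "k < 3" "crossing_index (ls ! k) = Some i" "z = center i k"
      using z assms(1) by (auto simp: crossings_tangle)
    have "z \<in> cross_at i k" using k(3) by (simp add: mem_cross_at)
    then have c: "z \<in> curve ?T" using cross_draw[OF k(2)] k(1) assms(1) by (auto simp: curve_tangle)
    have "real k \<le> 2" using k(1) by simp
    then show ?thesis using c box[OF c] k by (auto simp: mem_interior_box)
  qed
  moreover have "\<exists>r > 0. inj_on Im (curve ?T \<inter> ball z r) \<and>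
        ((\<forall>y \<in> curve ?T \<inter> ball z r. Im y \<le> Im z) \<or> (\<forall>y \<in> curve ?T \<inter> ball z r. Im z \<le> Im y))"
    if z: "z \<in> curve ?T \<inter> frontier box" for z
  proof (intro exI conjI)
    have zT: "z \<in> curve ?T" using z by blast
    have Im: "Im z = -3 \<or> Im z = 0" using z box[OF zT] by (auto simp: mem_frontier_box)
    then show "(\<forall>y \<in> curve ?T \<inter> ball z (1/2). Im y \<le> Im z) \<or> (\<forall>y
      \<in> curve ?T \<inter> ball z (1/2). Im z \<le> Im y)"
      using box by auto
    obtain k0 where k0: "k0 < 3" "z \<in> draw n k0 (ls ! k0)" using zT unfolding curve_tangle assms(1) by blast
    have "real k0 \<le> 2" using k0(1) by simp
    then have "Im z = - real k0 \<or> Im z = - real k0 - 1"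
      using Im draw_height[OF k0(2)] by auto
    then obtain j where j: "Re z = real j" using draw_boundary[OF k0(2)] by blast
    \<comment> \<open>Within radius \<open>1/2\<close> of a boundary point only the first or only
      the last layer is met, and only near one position, so \<open>draw_injective\<close>
      applies.\<close>
    have layer: "y \<in> draw n (if Im z = 0 then 0 else 2) (ls ! (if Im z = 0 then 0 else 2))"
      "\<bar>Re y - real j\<bar> < 1/2" "\<bar>Im y - Im z\<bar> < 1/2" if y: "y \<in> curve ?T \<inter> ball z (1/2)" for y
    proof -
      have "norm (y - z) < 1/2" using y by (auto simp: dist_norm norm_minus_commute)
      then show n: "\<bar>Re y - real j\<bar> < 1/2" "\<bar>Im y - Im z\<bar> < 1/2"
        using abs_Re_le_cmod[of "y - z"] abs_Im_le_cmod[of "y - z"] j by auto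
      obtain k where k: "k < 3" "y \<in> draw n k (ls ! k)" using y
        unfolding curve_tangle assms(1) Int_iff by blast
      have "k = 0 \<or> k = 1 \<or> k = 2" using k(1) by linarith
      then have "k = (if Im z = 0 then 0 else 2)" using draw_height[OF k(2)] n(2) Im by auto
      then show "y \<in> draw n (if Im z = 0 then 0 else 2) (ls ! (if Im z = 0 then 0 else 2))" using k(2) by simp
    qed
    show "inj_on Im (curve ?T \<inter> ball z (1/2))"
    proof (rule inj_onI)
      fix x y assume x: "x \<in> curve ?T \<inter> ball z (1/2)" and y:
        "y \<in> curve ?T \<inter> ball z (1/2)" and eq: "Im x = Im y"
      show "x = y"
        by (rule draw_injective[OF layer(1,2)[OF x] layer(1,2)[OF y] eq]) (use layer(3)[OF y] Im in auto)
    qed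
  qed simp
  moreover have "curve ?T \<subseteq> box"
  proof
    fix z assume "z \<in> curve ?T"
    from box[OF this] show "z \<in> box" by (simp add: mem_box)
  qed
  ultimately show ?thesis unfolding box_tangle_def using over_tangle by blast
qed

lemma tangle_boundary:
  assumes "length ls = 3" "n \<le> 3" "list_all (fits n) ls"
  shows "curve (tangle n ls) \<inter> frontier box =
    {z \<in> draw n 0 (ls ! 0). Im z = 0} \<union> {z \<in> draw n 2 (ls ! 2). Im z = -3}"
proof (intro equalityI subsetI)
  fix z assume z: "z \<in> curve (tangle n ls) \<inter> frontier box"
  obtain k where k: "k < 3" "z \<in> draw n k (ls ! k)" using z unfolding curve_tangle assms(1) Int_iff by blast
  have "fits n (ls ! k)" using assms k by (simp add: list_all_length)
  then have "1 \<le> Re z" "Re z \<le> 3" using draw_fits[OF k(2)] assms(2) by auto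
  then have "Im z = 0 \<or> Im z = -3" using z by (auto simp: mem_frontier_box)
  moreover have "k = 0 \<or> k = 1 \<or> k = 2" using k(1) by linarith
  ultimately show "z \<in> {z \<in> draw n 0 (ls ! 0). Im z = 0} \<union> {z \<in> draw n 2 (ls ! 2). Im z = -3}"
    using k(2) draw_height[OF k(2)] by auto
next
  fix z assume "z \<in> {z \<in> draw n 0 (ls ! 0). Im z = 0} \<union> {z \<in> draw n 2 (ls ! 2). Im z = -3}"
  then obtain k where k: "k < 3" "z \<in> draw n k (ls ! k)" "Im z = 0 \<or> Im z = -3"
    using that[of 0] that[of 2] by auto
  then have "fits n (ls ! k)" using assms by (simp add: list_all_length)
  then have "1 \<le> Re z" "Re z \<le> 3" using draw_fits[OF k(2)] assms(2) by auto
  moreover have "z \<in> curve (tangle n ls)" using k assms(1) by (auto simp: curve_tangle)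
  ultimately show "z \<in> curve (tangle n ls) \<inter> frontier box" using k(3)
    by (auto simp: mem_frontier_box mem_box)
qed

section \<open>Germs at the crossings of a tangle\<close>

text \<open>The crossing itself, at \<open>r = 0\<close>, is left out. For a corner direction the
  other end, at \<open>r = 1/2\<close>, is a node where the color can be read off.\<close>

definition half_edge :: "complex \<Rightarrow> complex \<Rightarrow> complex set" where
  "half_edge c d = (\<lambda>r. c + r *\<^sub>R d) ` {0<..1/2}"

definition corners :: "complex set" where
  "corners = {1 + \<i>, 1 - \<i>, - 1 + \<i>, - 1 - \<i>}"

lemma center_corners:
  "center i k + (1/2) *\<^sub>R (1 + \<i>) = node (i + 1) k"
    "center i k + (1/2) *\<^sub>R (1 - \<i>) = node (i + 1) (k + 1)"
  "center i k + (1/2) *\<^sub>R (- 1 + \<i>) = node i k" "center i k + (1/2) *\<^sub>R (- 1 - \<i>) = node i (k + 1)"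
  by (simp_all add: complex_eq_iff)

lemma corners_nonzero: "d \<in> corners \<Longrightarrow> d \<noteq> 0"
  by (auto simp: corners_def complex_eq_iff)

lemma sgn_corner: "d \<in> corners \<Longrightarrow> sgn d = d /\<^sub>R sqrt 2"
  by (auto simp: corners_def sgn_div_norm cmod_def)

lemma inj_sgn_corners: "inj_on sgn corners"
  by (rule inj_onI) (simp add: sgn_corner)

lemma half_edge_coords:
  assumes "z \<in> half_edge (center i k) d" "d \<in> corners"
  shows "\<bar>Re z - (real i + 1/2)\<bar> = \<bar>Im z + (real k + 1/2)\<bar>" "0 < \<bar>Im z + (real k + 1/2)\<bar>"
    "\<bar>Im z + (real k + 1/2)\<bar> \<le> 1/2"
  using assms by (auto simp: half_edge_def corners_def)

lemma cross_half_edges: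
  assumes "z \<in> cross_at i k" "z \<noteq> center i k"
  shows "\<exists>d \<in> corners. z \<in> half_edge (center i k) d"
proof -
  define x y where "x = Re z - (real i + 1/2)" and "y = Im z + (real k + 1/2)"
  have xy: "\<bar>x\<bar> = \<bar>y\<bar>" "\<bar>y\<bar> \<le> 1/2" using assms(1) by (auto simp: mem_cross_at x_def y_def)
  have z: "z = center i k + Complex x y" by (simp add: complex_eq_iff x_def y_def)
  have "x \<noteq> 0" using assms(2) xy z by (auto simp: complex_eq_iff)
  \<comment> \<open>The signs of the coordinates choose the quadrant; their common absolute value is
    the parameter on the half edge.\<close>
  define d where "d = Complex (sgn x) (sgn y)"
  have "z = center i k + \<bar>x\<bar> *\<^sub>R d"
    unfolding z d_def using xy(1) by (simp add: complex_eq_iff abs_mult_sgn) (metis abs_mult_sgn mult.commute)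
  moreover have "d \<in> corners"
    using \<open>x \<noteq> 0\<close> xy by (auto simp: d_def corners_def complex_eq_iff sgn_if)
  ultimately show ?thesis using \<open>x \<noteq> 0\<close> xy unfolding half_edge_def by (intro bexI[of _ d]) auto
qed

lemma half_edge_subset:
  assumes k: "k < length ls" "crossing_index (ls ! k) = Some i" and d: "d \<in> corners"
  shows "half_edge (center i k) d \<subseteq> curve (tangle n ls) - crossings (tangle n ls)"
proof
  fix z assume "z \<in> half_edge (center i k) d"
  note z = half_edge_coords[OF this d]
  have "z \<in> draw n k (ls ! k)" using cross_draw[OF k(2)] z mem_cross_at[of z i k] by blast
  then have "z \<in> curve (tangle n ls)" using k(1) by (auto simp: curve_tangle)
  moreover have "z \<notin> crossings (tangle n ls)"
  proof
    assume "z \<in> crossings (tangle n ls)"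
    moreover have "- real k - 1 \<le> Im z" "Im z \<le> - real k" using z(3) by linarith+
    ultimately have "\<exists>i. z = center i k" using crossing_heights by blast
    then show False using z(2) by auto
  qed
  ultimately show "z \<in> curve (tangle n ls) - crossings (tangle n ls)" by blast
qed

lemma tendsto_half_edge: "d \<noteq> 0
  \<Longrightarrow> filterlim (\<lambda>r. c + r *\<^sub>R d) (at c within half_edge c d) (at_right 0)"
proof -
  assume d: "d \<noteq> 0"
  have "((\<lambda>r::real. c + r *\<^sub>R d) \<longlongrightarrow> c + 0 *\<^sub>R d) (at_right 0)" by (intro tendsto_intros)
  moreover have "\<forall>\<^sub>F r::real in at_right 0. r \<in> {0<..<1/2}" by (intro eventually_at_right_real) auto
  then have "\<forall>\<^sub>F r in at_right 0. c + r *\<^sub>R d \<in> half_edge c d \<and> c + r *\<^sub>R d \<noteq> c"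
    by eventually_elim (use d in \<open>auto simp: half_edge_def\<close>)
  ultimately show ?thesis by (simp add: filterlim_at)
qed

text \<open>This is \<open>star_directions\<close> with the corners themselves as indices. A disk of
  radius \<open>1/2\<close> about the center meets no other layer and no vertical strand, so only
  the cross remains.\<close>

lemma tangle_directions:
  assumes k: "k < length ls" "crossing_index (ls ! k) = Some i"
  shows "directions (tangle n ls) (center i k) = sgn ` corners"
    and "d \<in> corners
      \<Longrightarrow> \<forall>\<^sub>F z in end_at (tangle n ls) (center i k) (sgn d). z
      \<in> half_edge (center i k) d"
proof -
  let ?T = "tangle n ls" and ?c = "center i k"
  have sub: "half_edge ?c d \<subseteq> curve ?T" if "d \<in> corners" for d
    using half_edge_subset[OF k that] by blast
  have nb: "at ?c within half_edge ?c d \<noteq> bot" if "d \<in> corners" for d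
    using tendsto_half_edge[OF corners_nonzero[OF that], of ?c]
      by (auto simp: filterlim_def bot_unique filtermap_bot_iff)
  have lim: "((\<lambda>z. sgn (z - ?c)) \<longlongrightarrow> sgn d) (at ?c within half_edge ?c d)" if "d \<in> corners" for d
  proof (rule tendsto_eventually)
    show "\<forall>\<^sub>F z in at ?c within half_edge ?c d. sgn (z - ?c) = sgn d"
      unfolding eventually_at_filter by (intro always_eventually) (auto simp: half_edge_def sgn_scaleR)
  qed
  have "\<forall>\<^sub>F z in nhds ?c. z \<in> ball ?c (1/2)" by (intro eventually_nhds_in_open) auto
  then have "\<forall>\<^sub>F z in at ?c within curve ?T. z \<in> (\<Union>d\<in>corners. half_edge ?c d)"
    unfolding eventually_at_filter
  proof eventually_elim
    case (elim z)
    show ?case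
    proof (intro impI)
      assume z: "z \<noteq> ?c" "z \<in> curve ?T"
      have "norm (z - ?c) < 1/2" using elim by (simp add: dist_norm norm_minus_commute)
      then have near: "\<bar>Re z - (real i + 1/2)\<bar> < 1/2" "\<bar>Im z + (real k + 1/2)\<bar> < 1/2"
        using abs_Re_le_cmod[of "z - ?c"] abs_Im_le_cmod[of "z - ?c"] unfolding minus_complex.sel center_coords
        by linarith+
      obtain k' where k': "k' < length ls" "z \<in> draw n k' (ls ! k')" using z(2) unfolding curve_tangle by blast
      have "real k' < real k + 1" "real k < real k' + 1" using draw_height[OF k'(2)] near(2) by linarith+
      then have "k' = k" by linarith
      have idx: "index (ls ! k) = Some i" using k(2) by (cases "ls ! k") auto
      have "z \<in> cross_at i k" using k'(2)
      proof (cases rule: draw_cases)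
        case (vertical j)
        then have "real i < real j" "real j < real i + 1" using near(1) by linarith+
        then have "real i < real j" "real j < real (i + 1)" by simp_all
        then show ?thesis unfolding of_nat_less_iff by linarith
      next
        case (diagonal i')
        then show ?thesis using \<open>k' = k\<close> idx near(2) by (auto simp: mem_cross_at)
      qed
      then show "z \<in> (\<Union>d\<in>corners. half_edge ?c d)" using cross_half_edges z(1) by blast
    qed
  qed
  moreover have "finite corners" by (simp add: corners_def)
  ultimately show "directions ?T ?c = sgn ` corners"
    "d \<in> corners \<Longrightarrow> \<forall>\<^sub>F z in end_at ?T ?c (sgn d). z \<in> half_edge ?c d"
    using star_directions[of corners sgn "half_edge ?c" ?T ?c] inj_sgn_corners sub nb lim by blast+
qed

lemma tangle_germ:
  assumes k: "k < length ls" "crossing_index (ls ! k) = Some i" and d: "d \<in> corners"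
    and v: "\<And>z. z \<in> half_edge (center i k) d \<Longrightarrow> f z = v"
  shows "germ_value (tangle n ls) f (center i k) (sgn d) x \<longleftrightarrow> v = x"
proof -
  have g: "germ_value (tangle n ls) f (center i k) (sgn d) v"
    unfolding germ_value_def by (rule eventually_mono[OF tangle_directions(2)[OF k d]]) (rule v)
  moreover have "sgn d \<in> directions (tangle n ls) (center i k)" using tangle_directions(1)[OF k] d by simp
  ultimately show ?thesis using germ_value_unique by metis
qed

lemma corner_minus: "- sgn (1 - \<i>) = sgn (- 1 + \<i>)" "- sgn (1 + \<i>) = sgn (- 1 - \<i>)"
  "- sgn (- 1 + \<i>) = sgn (1 - \<i>)" "- sgn (- 1 - \<i>) = sgn (1 + \<i>)"
  by (subst sgn_minus[symmetric], rule arg_cong[where f = sgn], simp)+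

lemma over_center:
  assumes k: "k < length ls"
  shows "ls ! k = Sigma i \<Longrightarrow> over (tangle n ls) (center i k) = {sgn (1 - \<i>), sgn (- 1 + \<i>)}"
    and "ls ! k = Sigma_bar i \<Longrightarrow> over (tangle n ls) (center i k) = {sgn (1 + \<i>), sgn (- 1 - \<i>)}"
proof -
  show "ls ! k = Sigma i \<Longrightarrow> over (tangle n ls) (center i k) = {sgn (1 - \<i>), sgn (- 1 + \<i>)}"
    "ls ! k = Sigma_bar i \<Longrightarrow> over (tangle n ls) (center i k) = {sgn (1 + \<i>), sgn (- 1 - \<i>)}"
    using k by (auto simp: tangle_def corner_minus)
qed

lemma ccw_sgn: "ccw (sgn u) (sgn v) \<longleftrightarrow> ccw u v"
  using linear_image_ccw(1)[of "\<lambda>x. x" u v] by (simp add: ccw_def linear_iff)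

text \<open>Collects the equations for every choice of ends in the definition of a coloring: both
  under-ends at a regular crossing, all four rotations at a singular one.\<close>

definition colors_crossing ::
  "('a \<Rightarrow> 'a \<Rightarrow> 'a) \<Rightarrow> ('a \<Rightarrow> 'a \<Rightarrow> 'a) \<Rightarrow> ('a \<Rightarrow> 'a \<Rightarrow> 'a) \<Rightarrow> layer \<Rightarrow> 'a \<Rightarrow> 'a \<Rightarrow> 'a \<Rightarrow> 'a \<Rightarrow> bool" where
  "colors_crossing qop R1 R2 l nw ne sw se \<longleftrightarrow> (case l of
     Sigma i \<Rightarrow> se = nw \<and> sw = qop ne nw \<and> ne = qop sw nw
   | Sigma_bar i \<Rightarrow> sw = ne \<and> se = qop nw ne \<and> nw = qop se ne
   | Tau i \<Rightarrow> sw = R1 nw ne \<and> se = R2 nw ne \<and> se = R1 sw nw \<and> ne = R2 sw nw \<and>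
       ne = R1 se sw \<and> nw = R2 se sw \<and> nw = R1 ne se \<and> sw = R2 ne se
   | _ \<Rightarrow> True)"

lemma regular_condition_iff:
  assumes "over D p = {a, b}" "directions D p - over D p = {c, d}" "- a = b" "- b = a" "- c = d" "- d = c"
    and "\<And>x. germ_value D f p a x \<longleftrightarrow> va = x" "\<And>x. germ_value D f p b x \<longleftrightarrow> vb = x"
    "\<And>x. germ_value D f p c x \<longleftrightarrow> vc = x" "\<And>x. germ_value D f p d x \<longleftrightarrow> vd = x"
  shows "regular_condition qop D f p \<longleftrightarrow> va = vb \<and> vd = qop vc va \<and> vc = qop vd va"
  unfolding regular_condition_def assms(2) unfolding assms(1) by (simp add: assms(3-)) auto

text \<open>With \<open>a\<close>, \<open>b\<close>, \<open>c\<close>, \<open>d\<close> in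
  counterclockwise order, just the consecutive pairs satisfy \<open>ccw\<close>; each of the four
  contributes two equations.\<close>

lemma singular_condition_iff:
  assumes "directions D p = {a, b, c, d}" "- a = c" "- b = d" "- c = a" "- d = b"
    and "ccw a b" "ccw b c" "ccw c d" "ccw d a" "\<not> ccw b a" "\<not> ccw c b" "\<not> ccw d c" "\<not> ccw a d"
      "\<not> ccw a a" "\<not> ccw b b" "\<not> ccw c c" "\<not> ccw d d" "\<not> ccw a c"
        "\<not> ccw c a" "\<not> ccw b d" "\<not> ccw d b"
    and "\<And>x. germ_value D f p a x \<longleftrightarrow> va = x" "\<And>x. germ_value D f p b x \<longleftrightarrow> vb = x"
    "\<And>x. germ_value D f p c x \<longleftrightarrow> vc = x" "\<And>x. germ_value D f p d x \<longleftrightarrow> vd = x"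
  shows "singular_condition R1 R2 D f p \<longleftrightarrow> vc = R1 vb va \<and> vd = R2 vb va
    \<and> vd = R1 vc vb \<and> va = R2 vc vb \<and>
    va = R1 vd vc \<and> vb = R2 vd vc \<and> vb = R1 va vd \<and> vc = R2 va vd"
  unfolding singular_condition_def assms(1) by (simp add: assms(2-))

text \<open>The germs at a center are the colors of the half edges, so the geometric conditions turn
  into equations between the four colors \<open>v d\<close>.\<close>

lemma tangle_condition:
  assumes k: "k < length ls" "crossing_index (ls ! k) = Some i"
    and v: "\<And>d z. d \<in> corners \<Longrightarrow> z \<in> half_edge (center i k) d \<Longrightarrow> f z = v d"
  shows "(center i k \<in> reg (tangle n ls) \<longrightarrow> regular_condition qop (tangle n ls) f (center i k)) \<and>
    (center i k \<in> sng (tangle n ls) \<longrightarrow> singular_condition R1 R2 (tangle n ls) f (center i k)) \<longleftrightarrow>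
    colors_crossing qop R1 R2 (ls ! k) (v (- 1 + \<i>)) (v (1 + \<i>)) (v (- 1 - \<i>)) (v (1 - \<i>))"
proof -
  let ?T = "tangle n ls" and ?c = "center i k"
  have g: "germ_value ?T f ?c (sgn d) x \<longleftrightarrow> v d = x" if "d \<in> corners" for d x
    using that v by (intro tangle_germ[OF k that]) auto
  have germ: "germ_value ?T f ?c (sgn (1 - \<i>)) x \<longleftrightarrow> v (1 - \<i>) = x"
    "germ_value ?T f ?c (sgn (- 1 + \<i>)) x \<longleftrightarrow> v (- 1 + \<i>) = x"
    "germ_value ?T f ?c (sgn (1 + \<i>)) x \<longleftrightarrow> v (1 + \<i>) = x"
      "germ_value ?T f ?c (sgn (- 1 - \<i>)) x \<longleftrightarrow> v (- 1 - \<i>) = x" for x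
    by (rule g; simp add: corners_def)+
  have dirs: "directions ?T ?c = {sgn (1 + \<i>), sgn (1 - \<i>), sgn (- 1 + \<i>), sgn (- 1 - \<i>)}"
    using tangle_directions(1)[OF k, of n] by (simp add: corners_def)
  have "distinct [1 + \<i>, 1 - \<i>, - 1 + \<i>, - 1 - \<i>]" by (auto simp: complex_eq_iff)
  then have "distinct (map sgn [1 + \<i>, 1 - \<i>, - 1 + \<i>, - 1 - \<i>])"
    using inj_sgn_corners by (subst distinct_map) (simp add: corners_def)
  then have diff: "directions ?T ?c - {sgn (1 - \<i>), sgn (- 1 + \<i>)} = {sgn (1 + \<i>), sgn (- 1 - \<i>)}"
    "directions ?T ?c - {sgn (1 + \<i>), sgn (- 1 - \<i>)} = {sgn (1 - \<i>), sgn (- 1 + \<i>)}"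
    unfolding dirs by auto
  have reg: "?c \<in> reg ?T \<longleftrightarrow> ls ! k \<in> {Sigma i, Sigma_bar i}" and sng: "?c \<in> sng ?T \<longleftrightarrow> ls ! k = Tau i"
    using k(1) by (auto simp: tangle_def)
  consider "ls ! k = Sigma i" | "ls ! k = Sigma_bar i" | "ls ! k = Tau i" using k(2) by (cases "ls ! k") auto
  then show ?thesis
  proof cases
    case 1
    have eq: "regular_condition qop ?T f ?c \<longleftrightarrow>
        v (1 - \<i>) = v (- 1 + \<i>) \<and> v (- 1 - \<i>) = qop (v (1 + \<i>)) (v (1 - \<i>))
          \<and> v (1 + \<i>) = qop (v (- 1 - \<i>)) (v (1 - \<i>))"
      using diff(1) unfolding over_center(1)[OF k(1) 1, of n, symmetric]
      by (rule regular_condition_iff[OF over_center(1)[OF k(1) 1] _ corner_minus(1,3,2,4) germ(1-4)])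
    have gen: "se = nw \<and> sw = qop ne se \<and> ne = qop sw se \<longleftrightarrow>
        colors_crossing qop R1 R2 (ls ! k) nw ne sw se" for nw ne sw se
      using 1 by (auto simp: colors_crossing_def)
    have r: "?c \<in> reg ?T" "?c \<notin> sng ?T" using 1 by (simp_all add: reg sng)
    show ?thesis by (simp only: eq gen r simp_thms)
  next
    case 2
    have eq: "regular_condition qop ?T f ?c \<longleftrightarrow>
        v (1 + \<i>) = v (- 1 - \<i>) \<and> v (1 - \<i>) = qop (v (- 1 + \<i>)) (v (1 + \<i>))
          \<and> v (- 1 + \<i>) = qop (v (1 - \<i>)) (v (1 + \<i>))"
      using diff(2) unfolding over_center(2)[OF k(1) 2, of n, symmetric] insert_commute[of "sgn (1 - \<i>)"]
      by (rule regular_condition_iff[OF over_center(2)[OF k(1) 2] _ corner_minus(2,4,3,1) germ(3,4,2,1)])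
    have gen: "ne = sw \<and> se = qop nw ne \<and> nw = qop se ne \<longleftrightarrow>
        colors_crossing qop R1 R2 (ls ! k) nw ne sw se" for nw ne sw se
      using 2 by (auto simp: colors_crossing_def)
    have r: "?c \<in> reg ?T" "?c \<notin> sng ?T" using 2 by (simp_all add: reg sng)
    show ?thesis by (simp only: eq gen r simp_thms)
  next
    case 3
    have dirs': "directions ?T ?c = {sgn (1 + \<i>), sgn (- 1 + \<i>), sgn (- 1 - \<i>), sgn (1 - \<i>)}"
      unfolding dirs by blast
    have eq: "singular_condition R1 R2 ?T f ?c \<longleftrightarrow>
      v (- 1 - \<i>) = R1 (v (- 1 + \<i>)) (v (1 + \<i>)) \<and> v (1 - \<i>) = R2 (v (- 1 + \<i>)) (v (1 + \<i>)) \<and>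
      v (1 - \<i>) = R1 (v (- 1 - \<i>)) (v (- 1 + \<i>)) \<and> v (1 + \<i>) = R2 (v (- 1 - \<i>)) (v (- 1 + \<i>)) \<and>
      v (1 + \<i>) = R1 (v (1 - \<i>)) (v (- 1 - \<i>)) \<and> v (- 1 + \<i>) = R2 (v (1 - \<i>)) (v (- 1 - \<i>)) \<and>
      v (- 1 + \<i>) = R1 (v (1 + \<i>)) (v (1 - \<i>)) \<and> v (- 1 - \<i>) = R2 (v (1 + \<i>)) (v (1 - \<i>))"
      by (rule singular_condition_iff[OF dirs' corner_minus(2,3,4,1) _ _ _ _ _ _ _ _ _ _ _ _ _ _ _ _
        germ(3,2,4,1)];
        unfold ccw_sgn; simp add: ccw_def)
    have gen: "sw = R1 nw ne \<and> se = R2 nw ne \<and> se = R1 sw nw \<and> ne = R2 sw nw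
      \<and> ne = R1 se sw \<and> nw = R2 se sw \<and> nw = R1 ne se \<and> sw = R2 ne se \<longleftrightarrow>
        colors_crossing qop R1 R2 (ls ! k) nw ne sw se" for nw ne sw se
      using 3 by (auto simp: colors_crossing_def)
    have r: "?c \<notin> reg ?T" "?c \<in> sng ?T" using 3 by (simp_all add: reg sng)
    show ?thesis by (simp only: eq gen r simp_thms)
  qed
qed

section \<open>Colorings of tangle words\<close>

text \<open>Crossings have half-integral real part; after doubling, parity excludes them.\<close>

lemma node_not_crossing: "Re z = real j \<Longrightarrow> z \<notin> crossings (tangle n ls)"
proof
  assume "Re z = real j" "z \<in> crossings (tangle n ls)"
  then obtain i where "real i + 1/2 = real j" by (auto simp: crossings_tangle)
  then have "real (2 * j) = real (2 * i + 1)" by simp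
  then have "2 * j = 2 * i + 1" by (simp only: of_nat_eq_iff)
  then show False by presburger
qed

section \<open>Pieces of constant color\<close>

lemma constant_vertical:
  assumes f: "point_coloring X qop R1 R2 (tangle n ls) f" and k: "k < length ls"
    and j: "j \<in> {1..n}" "index (ls ! k) \<noteq> Some j" "index (ls ! k) \<noteq> Some (j - 1)"
    and z: "z \<in> closed_segment (node j k) (node j (k + 1))"
  shows "f z = f (node j k)"
proof (rule point_coloring_connected[OF f])
  show "closed_segment (node j k) (node j (k + 1)) \<subseteq> curve (tangle n ls) - crossings (tangle n ls)"
  proof
    fix y assume y: "y \<in> closed_segment (node j k) (node j (k + 1))"
    then have "y \<in> curve (tangle n ls)" using verticals_draw[OF j] k unfolding curve_tangle by blast
    moreover have "Re y = real j" using y by (simp only: mem_vertical)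
    ultimately show "y \<in> curve (tangle n ls) - crossings (tangle n ls)" using node_not_crossing by blast
  qed
qed (use z in auto)

lemma constant_half_edge:
  assumes f: "point_coloring X qop R1 R2 (tangle n ls) f" and k: "k < length ls" "crossing_index (ls ! k) = Some i"
    and d: "d \<in> corners" and z: "z \<in> half_edge (center i k) d"
  shows "f z = f (center i k + (1/2) *\<^sub>R d)"
proof (rule point_coloring_connected[OF f _ half_edge_subset[OF k d] z])
  show "connected (half_edge (center i k) d)"
    unfolding half_edge_def by (intro connected_continuous_image continuous_intros) auto
  show "center i k + (1/2) *\<^sub>R d \<in> half_edge (center i k) d"
    unfolding half_edge_def by (intro imageI) auto
qed

lemma constant_cap:
  assumes f: "point_coloring X qop R1 R2 (tangle n ls) f" and k: "k < length ls" "ls ! k = Cap i"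
    and z: "z
      \<in> closed_segment (node i (k + 1)) (center i k) \<union> closed_segment (center i k) (node
      (i + 1) (k + 1))"
  shows "f z = f (node i (k + 1))"
proof (rule point_coloring_connected[OF f])
  let ?S
    = "closed_segment (node i (k + 1)) (center i k) \<union> closed_segment (center i k) (node (i + 1) (k + 1))"
  have "center i k
    \<in> closed_segment (node i (k + 1)) (center i k) \<inter> closed_segment (center i k) (node (i + 1) (k + 1))"
    by simp
  then show "connected ?S" by (intro connected_Un connected_segment) blast
  show "?S \<subseteq> curve (tangle n ls) - crossings (tangle n ls)"
  proof
    fix y assume y: "y \<in> ?S"
    then have "y \<in> draw n k (ls ! k)" unfolding k(2) draw.simps by blast
    then have "y \<in> curve (tangle n ls)" "- real k - 1 \<le> Im y" "Im y \<le> - real k"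
      using k(1) draw_height curve_tangle by blast+
    then show "y \<in> curve (tangle n ls) - crossings (tangle n ls)"
      using crossing_heights[of y n ls k] k(2) by auto
  qed
qed (use z in auto)

lemma constant_cup:
  assumes f: "point_coloring X qop R1 R2 (tangle n ls) f" and k: "k < length ls" "ls ! k = Cup i"
    and z: "z \<in> closed_segment (node i k) (center i k) \<union> closed_segment (center i k) (node (i + 1) k)"
  shows "f z = f (node i k)"
proof (rule point_coloring_connected[OF f])
  let ?S = "closed_segment (node i k) (center i k) \<union> closed_segment (center i k) (node (i + 1) k)"
  have "center i k
    \<in> closed_segment (node i k) (center i k) \<inter> closed_segment (center i k) (node (i + 1) k)"
    by simp
  then show "connected ?S" by (intro connected_Un connected_segment) blast
  show "?S \<subseteq> curve (tangle n ls) - crossings (tangle n ls)"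
  proof
    fix y assume y: "y \<in> ?S"
    then have "y \<in> draw n k (ls ! k)" unfolding k(2) draw.simps by blast
    then have "y \<in> curve (tangle n ls)" "- real k - 1 \<le> Im y" "Im y \<le> - real k"
      using k(1) draw_height curve_tangle by blast+
    then show "y \<in> curve (tangle n ls) - crossings (tangle n ls)"
      using crossing_heights[of y n ls k] k(2) by auto
  qed
qed (use z in auto)

lemma crossing_colors:
  assumes f: "point_coloring X qop R1 R2 (tangle n ls) f" and k: "k < length ls" "crossing_index (ls ! k) = Some i"
  shows "colors_crossing qop R1 R2 (ls ! k) (f (node i k)) (f (node (i + 1) k)) (f (node i (k + 1)))
    (f (node (i + 1) (k + 1)))"
  using tangle_condition[OF k, of f "\<lambda>d. f (center i k + (1/2) *\<^sub>R d)" n qop R1 R2]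
    constant_half_edge[OF f k] f
  unfolding center_corners by (simp add: point_coloring_def)

text \<open>Colors are indexed by all natural numbers, and both new entries are computed from the
  old \<open>s\<close>. The over-color crosses to the neighbouring position unchanged; caps and cups
  get the identity as a default value.\<close>

fun act :: "('a \<Rightarrow> 'a \<Rightarrow> 'a) \<Rightarrow> ('a \<Rightarrow> 'a \<Rightarrow> 'a) \<Rightarrow> ('a \<Rightarrow> 'a \<Rightarrow> 'a) \<Rightarrow> layer \<Rightarrow> (nat \<Rightarrow> 'a) \<Rightarrow> nat \<Rightarrow> 'a" where
  "act qop R1 R2 (Sigma i) s = s(i := qop (s (i + 1)) (s i), i + 1 := s i)"
| "act qop R1 R2 (Sigma_bar i) s = s(i := s (i + 1), i + 1 := qop (s i) (s (i + 1)))"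
| "act qop R1 R2 (Tau i) s = s(i := R1 (s i) (s (i + 1)), i + 1 := R2 (s i) (s (i + 1)))"
| "act qop R1 R2 _ s = s"

lemma act_cong:
  assumes "plain n l" "\<And>j. j \<in> {1..n} \<Longrightarrow> s j = t j" "j \<in> {1..n}"
  shows "act qop R1 R2 l s j = act qop R1 R2 l t j"
  using assms by (cases l) (auto simp: plain_def fits_def)

lemma act_vertical: "index l \<noteq> Some j \<Longrightarrow> index l \<noteq> Some (j - 1) \<Longrightarrow> 1 \<le> j \<Longrightarrow> act qop R1 R2 l s j = s j"
  by (cases l) auto

lemma act_crossing:
  assumes "crossing_index l = Some i" "colors_crossing qop R1 R2 l (s i) (s (i + 1)) sw se"
  shows "sw = act qop R1 R2 l s i" "se = act qop R1 R2 l s (i + 1)"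
proof -
  consider "l = Sigma i" | "l = Sigma_bar i" | "l = Tau i" using assms(1) by (cases l) auto
  then have "sw = act qop R1 R2 l s i \<and> se = act qop R1 R2 l s (i + 1)"
  proof cases
    case 1
    have "se = s i" "sw = qop (s (i + 1)) (s i)"
      using assms(2) unfolding 1 colors_crossing_def layer.case by blast+
    then show ?thesis unfolding 1 act.simps by simp
  next
    case 2
    have "sw = s (i + 1)" "se = qop (s i) (s (i + 1))"
      using assms(2) unfolding 2 colors_crossing_def layer.case by blast+
    then show ?thesis unfolding 2 act.simps by simp
  next
    case 3
    have "sw = R1 (s i) (s (i + 1))" "se = R2 (s i) (s (i + 1))"
      using assms(2) unfolding 3 colors_crossing_def layer.case by blast+
    then show ?thesis unfolding 3 act.simps by simp
  qed
  then show "sw = act qop R1 R2 l s i" "se = act qop R1 R2 l s (i + 1)" by auto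
qed

lemma index_cases:
  assumes "j \<in> {1..n}"
  obtains "index l \<noteq> Some j" "index l \<noteq> Some (j - 1)" | "index l = Some j" | i
    where "index l = Some i" "j = i + 1"
  using assms that(1) that(2) that(3)[of "j - 1"]
  by (cases "index l = Some j"; cases "index l = Some (j - 1)") simp_all

lemma node_step:
  assumes f: "point_coloring X qop R1 R2 (tangle n ls) f" and k: "k < length ls"
    "plain n (ls ! k)" and j: "j \<in> {1..n}"
  shows "f (node j (k + 1)) = act qop R1 R2 (ls ! k) (\<lambda>j. f (node j k)) j"
proof (cases rule: index_cases[OF j, of "ls ! k"])
  case 1
  then have "f (node j (k + 1)) = f (node j k)" by (intro constant_vertical[OF f k(1) j]) auto
  then show ?thesis using act_vertical[OF 1, of qop R1 R2 "\<lambda>j. f (node j k)"] j by simp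
next
  case 2
  then have c: "crossing_index (ls ! k) = Some j" using k(2) by (simp add: plain_def)
  show ?thesis using act_crossing(1)[OF c, of qop R1 R2
    "\<lambda>j. f (node j k)"] crossing_colors[OF f k(1) c] by simp
next
  case (3 i)
  then have c: "crossing_index (ls ! k) = Some i" using k(2) by (simp add: plain_def)
  show ?thesis using act_crossing(2)[OF c, of qop R1 R2
    "\<lambda>j. f (node j k)"] crossing_colors[OF f k(1) c] 3 by simp
qed

text \<open>\<open>s\<close> is any sequence with the right colors at the positions \<open>1\<close>
  to \<open>n\<close>; by \<open>act_cong\<close> its other entries never influence these
  positions.\<close>

lemma node_colors:
  assumes f: "point_coloring X qop R1 R2 (tangle n ls) f" and pl: "list_all (plain n) ls"
    and s: "\<And>j. j \<in> {1..n} \<Longrightarrow> s j = f (node j 0)"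
  shows "k \<le> length ls \<Longrightarrow> j \<in> {1..n} \<Longrightarrow> f (node j k) = fold (act qop R1 R2) (take k ls) s j"
proof (induction k arbitrary: j)
  case (Suc k)
  then have k: "k < length ls" "plain n (ls ! k)" using pl by (auto simp: list_all_length)
  have "f (node j (k + 1)) = act qop R1 R2 (ls ! k) (\<lambda>j. f (node j k)) j"
    by (rule node_step[OF f k Suc.prems(2)])
  also have "\<dots> = act qop R1 R2 (ls ! k) (fold (act qop R1 R2) (take k ls) s) j"
    using Suc k by (intro act_cong[OF k(2) _ Suc.prems(2)]) auto
  finally show ?case using k(1) by (simp add: take_Suc_conv_app_nth)
qed (simp add: s)

lemma corner_node:
  assumes "d \<in> corners"
  obtains j k' where "j \<in> {i, i + 1}" "k' \<in> {k, k + 1}" "center i k + (1/2) *\<^sub>R d = node j k'"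
  using assms center_corners[of i k] unfolding corners_def by blast

text \<open>The node is found before a coloring is chosen, so that two colorings can be compared at
  the same node.\<close>

lemma nearest_node:
  assumes pl: "list_all (plain n) ls" and z: "z \<in> curve (tangle n ls) - crossings (tangle n ls)"
  obtains j k where "j \<in> {1..n}" "k \<le> length ls"
    "\<And>f. point_coloring X qop R1 R2 (tangle n ls) f \<Longrightarrow> f z = f (node j k)"
proof -
  have "z \<in> curve (tangle n ls)" using z by blast
  then obtain k where k: "k < length ls" "z \<in> draw n k (ls ! k)" unfolding curve_tangle by blast
  have p: "plain n (ls ! k)" using pl k by (simp add: list_all_length)
  show ?thesis using k(2)
  proof (cases rule: draw_cases)
    case (vertical j)
    then have "z \<in> closed_segment (node j k) (node j (k + 1))" unfolding mem_vertical by simp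
    then have "f z = f (node j k)" if "point_coloring X qop R1 R2 (tangle n ls) f" for f
      by (rule constant_vertical[OF that k(1) vertical(1-3)])
    then show ?thesis using vertical(1) k(1) by (intro that[of j k]) auto
  next
    case (diagonal i)
    have i: "crossing_index (ls ! k) = Some i" "1 \<le> i" "i < n" using p diagonal(1)
      by (auto simp: plain_def fits_def)
    then have "z \<noteq> center i k" using z k by (auto simp: crossings_tangle)
    moreover have "\<bar>Im z + (real k + 1/2)\<bar> \<le> 1/2" using diagonal(3,4) by linarith
    then have "z \<in> cross_at i k" using diagonal(2) by (simp only: mem_cross_at)
    ultimately obtain d where d: "d \<in> corners" "z \<in> half_edge (center i k) d"
      using cross_half_edges by blast
    obtain j k' where jk: "j \<in> {i, i + 1}" "k' \<in> {k, k + 1}" "center i k + (1/2) *\<^sub>R d = node j k'"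
      using corner_node[OF d(1)] .
    show ?thesis
    proof (rule that)
      show "j \<in> {1..n}" "k' \<le> length ls" using jk i k by auto
      show "f z = f (node j k')" if "point_coloring X qop R1 R2 (tangle n ls) f" for f
        using constant_half_edge[OF that k(1) i(1) d] jk(3) by simp
    qed
  qed
qed

text \<open>The finitely many closed pieces that miss \<open>z\<close> stay away from a
  neighbourhood of \<open>z\<close>. Every nearby point of \<open>K\<close> therefore shares a piece
  with \<open>z\<close>.\<close>

lemma locally_constant_pieces:
  fixes K C :: "complex set"
  assumes fin: "finite \<S>" "\<And>S. S \<in> \<S> \<Longrightarrow> closed S" and cover: "K \<subseteq> \<Union>\<S>" and C: "closed C"
    and const: "\<And>S y z. S \<in> \<S> \<Longrightarrow> y \<in> S - C \<Longrightarrow> z \<in> S - C \<Longrightarrow> f y = f z"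
    and z: "z \<in> K - C"
  shows "\<forall>\<^sub>F y in at z within K. f y = f z"
proof -
  have "closed (\<Union>{S \<in> \<S>. z \<notin> S})" using fin by (intro closed_Union) auto
  then have "open (- (\<Union>{S \<in> \<S>. z \<notin> S} \<union> C))" using C by (intro open_Compl closed_Un)
  then have "\<forall>\<^sub>F y in nhds z. y \<in> - (\<Union>{S \<in> \<S>. z \<notin> S} \<union> C)"
    by (rule eventually_nhds_in_open) (use z in auto)
  then show ?thesis unfolding eventually_at_filter
  proof eventually_elim
    case (elim y)
    show ?case
    proof (intro impI)
      assume "y \<in> K"
      then obtain S where S: "S \<in> \<S>" "y \<in> S" using cover by blast
      then have "z \<in> S" using elim by blast
      then show "f y = f z" using const[OF S(1)] S(2) z elim by blast
    qed
  qed
qed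

lemma finite_crossings_tangle: "finite (crossings (tangle n ls))"
proof -
  have "crossings (tangle n ls)
    \<subseteq> (\<Union>k<length ls. (\<lambda>i. center i k) ` set_option (crossing_index (ls ! k)))"
    by (auto simp: crossings_tangle intro!: bexI)
  then show ?thesis by (rule finite_subset) simp
qed

lemma closed_half_edge: "closed (insert c (half_edge c d))"
proof -
  have "insert c (half_edge c d) = (\<lambda>r. c + r *\<^sub>R d) ` {0..1/2}"
  proof -
    have "{0..1/2::real} = insert 0 {0<..1/2}" by auto
    then show ?thesis by (simp add: half_edge_def)
  qed
  moreover have "compact ((\<lambda>r. c + r *\<^sub>R d) ` {0..1/2::real})"
    by (intro compact_continuous_image continuous_intros) auto
  ultimately show ?thesis by (simp add: compact_imp_closed)
qed

text \<open>\<open>a k j\<close> is the prescribed color of position \<open>j\<close> at level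
  \<open>k\<close>, and rounding to the nearest node extends it to the plane. \<open>vert\<close>
  makes consecutive levels fit along vertical strands, \<open>cross\<close> is the relation at the
  crossings.\<close>

lemma tangle_coloring_exists:
  fixes a :: "nat \<Rightarrow> nat \<Rightarrow> 'a"
  assumes pl: "list_all (plain n) ls" and X: "\<And>k j. a k j \<in> X"
    and vert: "\<And>k j. k < length ls \<Longrightarrow> j \<in> {1..n}
      \<Longrightarrow> index (ls ! k) \<noteq> Some j \<Longrightarrow> index (ls ! k) \<noteq>
      Some (j - 1) \<Longrightarrow>
      a (k + 1) j = a k j"
    and cross: "\<And>k i. k < length ls \<Longrightarrow> crossing_index (ls ! k) = Some i \<Longrightarrow>
      colors_crossing qop R1 R2 (ls ! k) (a k i) (a k (i + 1)) (a (k + 1) i) (a (k + 1) (i + 1))"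
  obtains f where "point_coloring X qop R1 R2 (tangle n ls) f" "\<And>j k. f (node j k) = a k j"
proof -
  let ?T = "tangle n ls"
  \<comment> \<open>The floor of a coordinate plus \<open>1/2\<close> is the nearest integer. The
    height enters as \<open>- Im z\<close>, since layers are counted downwards.\<close>
  define f where "f = (\<lambda>z. a (nat \<lfloor>1/2 - Im z\<rfloor>) (nat \<lfloor>Re z + 1/2\<rfloor>))"
  have round: "nat \<lfloor>x\<rfloor> = m" if "real m \<le> x" "x < real m + 1" for x m
    using that floor_unique[of "int m" x] by simp
  have near: "f z = a k j"
    if "real k - 1/2 \<le> - Im z" "- Im z < real k + 1/2" "real j - 1/2 \<le> Re z"
    "Re z < real j + 1/2" for z j k
  proof -
    have "nat \<lfloor>1/2 - Im z\<rfloor> = k" "nat \<lfloor>Re z + 1/2\<rfloor> = j" using that by (intro round; linarith)+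
    then show ?thesis by (simp add: f_def)
  qed
  have node: "f (node j k) = a k j" for j k by (rule near) simp_all
  \<comment> \<open>The upper half of a vertical segment rounds to level \<open>k\<close>, the rest
    to level \<open>k + 1\<close>; \<open>vert\<close> equates the two colors.\<close>
  have vconst: "f z = a k j"
    if "k < length ls" "j \<in> {1..n}" "index (ls ! k) \<noteq> Some j" "index (ls ! k) \<noteq> Some (j - 1)"
    "z \<in> closed_segment (node j k) (node j (k + 1))" for k j z
  proof -
    have z: "Re z = real j" "- real k - 1 \<le> Im z" "Im z \<le> - real k" using that(5)
      by (simp_all only: mem_vertical)
    show ?thesis
    proof (cases "- Im z < real k + 1/2")
      case True
      then show ?thesis using z by (intro near) auto
    next
      case False
      have "real (k + 1) = real k + 1" by simp
      then have "f z = a (k + 1) j" using z False by (intro near) linarith+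
      then show ?thesis using vert[OF that(1-4)] by simp
    qed
  qed
  \<comment> \<open>A half edge omits its center, so each of its points is strictly nearer to its
    own corner node than to the other three.\<close>
  have hconst: "f z = f (center i k + (1/2) *\<^sub>R d)"
    if d: "d \<in> corners" "z \<in> half_edge (center i k) d" for i k d z
  proof -
    obtain r where r: "0 < r" "r \<le> 1/2" "z = center i k + r *\<^sub>R d" using d(2)
      by (auto simp: half_edge_def)
    have "real (k + 1) = real k + 1" "real (i + 1) = real i + 1" by simp_all
    note s = this
    consider "d = 1 + \<i>" | "d = 1 - \<i>" | "d = - 1 + \<i>" | "d = - 1 - \<i>" using d(1)
      by (auto simp: corners_def)
    then show ?thesis
    proof cases
      case 1
      then have "f z = a k (i + 1)" using r s by (intro near) simp_all
      then show ?thesis unfolding 1 center_corners node .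
    next
      case 2
      then have "f z = a (k + 1) (i + 1)" using r s by (intro near) simp_all
      then show ?thesis unfolding 2 center_corners node .
    next
      case 3
      then have "f z = a k i" using r s by (intro near) simp_all
      then show ?thesis unfolding 3 center_corners node .
    next
      case 4
      then have "f z = a (k + 1) i" using r s by (intro near) simp_all
      then show ?thesis unfolding 4 center_corners node .
    qed
  qed
  \<comment> \<open>Half edges are closed up by adding their centers, as
    \<open>locally_constant_pieces\<close> wants closed pieces; the centers are taken out again as
    crossings.\<close>
  define \<S> where "\<S> = (\<Union>k<length ls. (\<lambda>j. closed_segment (node j k) (node j (k + 1))) `
        {j \<in> {1..n}. index (ls ! k) \<noteq> Some j \<and> index (ls ! k) \<noteq> Some (j - 1)}) \<union>
      (\<Union>k<length ls. \<Union>i\<in>set_option (crossing_index (ls ! k)).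
        (\<lambda>d. insert (center i k) (half_edge (center i k) d)) ` corners)"
  have "\<forall>\<^sub>F y in at z within curve ?T. f y = f z" if z: "z \<in> curve ?T - crossings ?T" for z
  proof (rule locally_constant_pieces[OF _ _ _ _ _ z, of \<S>])
    show "finite \<S>" by (simp add: \<S>_def corners_def)
    show "closed S" if "S \<in> \<S>" for S using that closed_half_edge by (auto simp: \<S>_def)
    show "closed (crossings ?T)" using finite_crossings_tangle by (rule finite_imp_closed)
    show "curve ?T \<subseteq> \<Union>\<S>"
    proof
      fix z assume "z \<in> curve ?T"
      then obtain k where k: "k < length ls" "z \<in> draw n k (ls ! k)" unfolding curve_tangle by blast
      have p: "plain n (ls ! k)" using pl k by (simp add: list_all_length)
      show "z \<in> \<Union>\<S>" using k(2)
      proof (cases rule: draw_cases)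
        case (vertical j)
        then have "z \<in> closed_segment (node j k) (node j (k + 1))" unfolding mem_vertical by simp
        then show ?thesis using vertical(1-3) k(1) unfolding \<S>_def by blast
      next
        case (diagonal i)
        have i: "i \<in> set_option (crossing_index (ls ! k))" using p diagonal(1) by (auto simp: plain_def)
        have "\<bar>Im z + (real k + 1/2)\<bar> \<le> 1/2" using diagonal(3,4) by linarith
        then have "z \<in> cross_at i k" using diagonal(2) by (simp only: mem_cross_at)
        then have "\<exists>d\<in>corners. z \<in> insert (center i k) (half_edge (center i k) d)"
          using cross_half_edges[of z i k] by (cases "z = center i k") (auto simp: corners_def)
        then show ?thesis using i k(1) unfolding \<S>_def by blast
      qed
    qed
    fix S x y assume S: "S \<in> \<S>" and x: "x \<in> S - crossings ?T" and y: "y \<in> S - crossings ?T"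
    then consider k j
      where "k < length ls" "j \<in> {1..n}" "index (ls ! k) \<noteq> Some j"
      "index (ls ! k) \<noteq> Some (j - 1)"
        "S = closed_segment (node j k) (node j (k + 1))"
      | k i d where "k < length ls" "crossing_index (ls ! k) = Some i" "d \<in> corners"
        "S = insert (center i k) (half_edge (center i k) d)"
      unfolding \<S>_def by auto
    then show "f x = f y"
    proof cases
      case 1
      then show ?thesis using vconst[OF 1(1-4)] x y by simp
    next
      case 2
      then have "center i k \<in> crossings ?T" by (auto simp: crossings_tangle)
      then have "x \<in> half_edge (center i k) d" "y \<in> half_edge (center i k) d" using 2(4) x y by auto
      then show ?thesis using hconst[OF 2(3)] by metis
    qed
  qed
  moreover have "f z \<in> X" for z by (simp add: f_def X)
  moreover have "(p \<in> reg ?T \<longrightarrow> regular_condition qop ?T f p) \<and> (p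
    \<in> sng ?T \<longrightarrow> singular_condition R1 R2 ?T f p)"
    if pc: "p \<in> crossings ?T" for p
  proof -
    obtain i k where k: "k < length ls" "crossing_index (ls ! k) = Some i" and p: "p = center i k"
      using pc unfolding crossings_tangle by blast
    show ?thesis unfolding p
      using tangle_condition[OF k, of f
        "\<lambda>d. f (center i k + (1/2) *\<^sub>R d)" n qop R1 R2] hconst cross[OF k]
      unfolding center_corners node by blast
  qed
  ultimately have "point_coloring X qop R1 R2 ?T f"
    unfolding point_coloring_def by (auto simp: crossings_def)
  with node show ?thesis using that by blast
qed

section \<open>The moves\<close>

lemma plain_fits: "list_all (plain n) ls \<Longrightarrow> list_all (fits n) ls"
  by (auto simp: list_all_iff plain_def)

lemma plain_draw_ends:
  assumes "plain n l"
  shows "{z \<in> draw n k l. Im z = - real k} = (\<lambda>j. node j k) ` {1..n}"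
    and "{z \<in> draw n k l. Im z = - real k - 1} = (\<lambda>j. node j (k + 1)) ` {1..n}"
proof -
  have idx: "j \<in> {1..n}" if "index l = Some i" "j = i \<or> j = i + 1" for i j
    using assms that by (auto simp: plain_def fits_def)
  have nodes: "node j k \<in> draw n k l \<and> node j (k + 1) \<in> draw n k l" if j: "j \<in> {1..n}" for j
  proof (cases rule: index_cases[OF j, of l])
    case 1
    have "node j k \<in> closed_segment (node j k) (node j (k + 1))"
      "node j (k + 1) \<in> closed_segment (node j k) (node j (k + 1))"
      by simp_all
    then show ?thesis using verticals_draw[OF j 1] by blast
  next
    case 2
    then have "crossing_index l = Some j" using assms by (simp add: plain_def)
    moreover have "node j k \<in> cross_at j k" "node j (k + 1) \<in> cross_at j k" by (simp_all add: mem_cross_at)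
    ultimately show ?thesis using cross_draw by blast
  next
    case (3 i)
    then have "crossing_index l = Some i" using assms by (simp add: plain_def)
    moreover have "node j k \<in> cross_at i k" "node j (k + 1) \<in> cross_at i k"
      by (simp_all add: mem_cross_at 3)
    ultimately show ?thesis using cross_draw by blast
  qed
  have ends: "\<exists>j \<in> {1..n}. Re z = real j"
    if z: "z \<in> draw n k l" "Im z = - real k \<or> Im z = - real k - 1" for z
    using z(1)
  proof (cases rule: draw_cases)
    case (diagonal i)
    then have "\<bar>Re z - (real i + 1/2)\<bar> = 1/2" using z(2) by auto
    then have "Re z = real i \<or> Re z = real i + 1" by argo
    then have "Re z = real i \<or> Re z = real (i + 1)" unfolding of_nat_add of_nat_1 .
    then show ?thesis using idx[OF diagonal(1)] by blast
  qed blast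
  show "{z \<in> draw n k l. Im z = - real k} = (\<lambda>j. node j k) ` {1..n}"
  proof (intro equalityI subsetI)
    fix z assume z: "z \<in> {z \<in> draw n k l. Im z = - real k}"
    then obtain j where j: "j \<in> {1..n}" "Re z = real j" using ends by blast
    then have "z = node j k" using z by (simp add: complex_eq_iff)
    then show "z \<in> (\<lambda>j. node j k) ` {1..n}" using j(1) by blast
  qed (use nodes in auto)
  show "{z \<in> draw n k l. Im z = - real k - 1} = (\<lambda>j. node j (k + 1)) ` {1..n}"
  proof (intro equalityI subsetI)
    fix z assume z: "z \<in> {z \<in> draw n k l. Im z = - real k - 1}"
    then obtain j where j: "j \<in> {1..n}" "Re z = real j" using ends by blast
    then have "z = node j (k + 1)" using z by (simp add: complex_eq_iff)
    then show "z \<in> (\<lambda>j. node j (k + 1)) ` {1..n}" using j(1) by blast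
  qed (use nodes in auto)
qed

lemma plain_boundary:
  assumes "length ls = 3" "n \<le> 3" "list_all (plain n) ls"
  shows "curve (tangle n ls) \<inter> frontier box = (\<lambda>j. node j 0) ` {1..n} \<union> (\<lambda>j. node j 3) ` {1..n}"
proof -
  have p: "plain n (ls ! 0)" "plain n (ls ! 2)" using assms by (simp_all add: list_all_length)
  have "{z \<in> draw n 0 (ls ! 0). Im z = 0} = (\<lambda>j. node j 0) ` {1..n}"
    using plain_draw_ends(1)[OF p(1), of 0] by simp
  moreover have "{z \<in> draw n 2 (ls ! 2). Im z = - 3} = (\<lambda>j. node j 3) ` {1..n}"
    using plain_draw_ends(2)[OF p(2), of 2] by simp
  ultimately show ?thesis unfolding tangle_boundary[OF assms(1,2) plain_fits[OF assms(3)]] by simp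
qed

lemma sng_tangle_empty:
  assumes "\<And>i. Tau i \<notin> set ls"
  shows "sng (tangle n ls) = {}"
proof -
  have "ls ! k \<noteq> Tau i" if "k < length ls" for i k
    using nth_mem[OF that] assms by metis
  then show ?thesis by (simp add: tangle_def)
qed

text \<open>With a single color the relation at a regular crossing reduces to
  \<open>qop x x = x\<close>. This is how the color of a straight strand extends over a
  kink.\<close>

lemma regular_condition_constant:
  "qop x x = x \<Longrightarrow> regular_condition qop D (\<lambda>_. x) p"
  unfolding regular_condition_def germ_value_def
  by (rule ballI, rule exI[of _ x]) (auto intro!: exI[of _ x])

context singquandle
begin

lemma star_closed: "x \<in> X \<Longrightarrow> y \<in> X \<Longrightarrow> x \<star> y \<in> X"
  using right_bij by (auto simp: bij_betw_def)

lemma act_closed: "(\<And>j. s j \<in> X) \<Longrightarrow> act (\<star>) R1 R2 l s j \<in> X"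
  by (cases l) (auto simp: star_closed R1_closed R2_closed)

lemma fold_act_closed: "(\<And>j. s j \<in> X) \<Longrightarrow> fold (act (\<star>) R1 R2) ls s j \<in> X"
  by (induction ls arbitrary: s) (auto simp: act_closed)

text \<open>Propagation from the top realises one rotation of the rule. Axioms 1 to 3 yield the
  other rotations at a singular crossing, and involutivity yields the relation for the second
  under-end at a regular one.\<close>

lemma colors_crossing_act:
  assumes l: "crossing_index l = Some i" and s: "s i \<in> X" "s (i + 1) \<in> X"
  shows "colors_crossing (\<star>) R1 R2 l (s i) (s (i + 1)) (act (\<star>) R1 R2 l s i) (act
    (\<star>) R1 R2 l s (i + 1))"
proof -
  consider "l = Sigma i" | "l = Sigma_bar i" | "l = Tau i" using l by (cases l) auto
  then show ?thesis
  proof cases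
    case 3
    have a: "act (\<star>) R1 R2 l s i = R1 (s i) (s (i + 1))"
      "act (\<star>) R1 R2 l s (i + 1) = R2 (s i) (s (i + 1))"
      by (simp_all add: 3)
    show ?thesis unfolding a unfolding 3 colors_crossing_def layer.case
      using ax1a[OF s] ax1b[OF s] ax2a[OF s] ax2b[OF s] ax3a[OF s] ax3b[OF s] by blast
  qed (use s in \<open>simp_all add: colors_crossing_def involutive\<close>)
qed

text \<open>Only the top colors are handed to the new tangle; that the bottom boundary colors come
  out right is \<open>eq\<close>. The same propagation gives uniqueness, since every non-crossing
  point has the color of a node.\<close>

lemma plain_extends:
  assumes n: "1 \<le> n" "n \<le> 3" and ls: "length ls = 3" "list_all (plain n) ls"
    and ls': "length ls' = 3" "list_all (plain n) ls'"
    and eq: "\<And>s j. (\<And>j. s j \<in> X) \<Longrightarrow> j \<in> {1..n} \<Longrightarrow>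
      fold (act (\<star>) R1 R2) ls s j = fold (act (\<star>) R1 R2) ls' s j"
  shows "boundary_extends X (\<star>) R1 R2 (tangle n ls) (tangle n ls')"
proof -
  let ?T = "tangle n ls" and ?T' = "tangle n ls'"
  have bd: "curve ?T \<inter> frontier box = (\<lambda>j. node j 0) ` {1..n} \<union> (\<lambda>j. node j 3) ` {1..n}"
    and bd': "curve ?T' \<inter> frontier box = (\<lambda>j. node j 0) ` {1..n} \<union> (\<lambda>j. node j 3) ` {1..n}"
    using plain_boundary n ls ls' by auto
  have "\<exists>f'. point_coloring X (\<star>) R1 R2 ?T' f' \<and> (\<forall>z \<in> curve ?T \<inter> frontier box. f' z = f z)"
    if f: "point_coloring X (\<star>) R1 R2 ?T f" for f
  proof -
    have top: "f (node j 0) \<in> X" if "j \<in> {1..n}" for j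
    proof -
      have "node j 0 \<in> curve ?T" using bd that by blast
      moreover have "node j 0 \<notin> crossings ?T" by (rule node_not_crossing) simp
      ultimately show ?thesis using f by (simp add: point_coloring_def)
    qed
    \<comment> \<open>Positions outside \<open>{1..n}\<close> get the color of position 1 as a
      default, which keeps all of \<open>s\<close> in \<open>X\<close>; \<open>1 \<le> n\<close>
      guarantees that this position exists.\<close>
    define s where "s = (\<lambda>j. if j \<in> {1..n} then f (node j 0) else f (node 1 0))"
    have sX: "s j \<in> X" for j using top n by (auto simp: s_def)
    define a where "a = (\<lambda>k. fold (act (\<star>) R1 R2) (take k ls') s)"
    have aX: "a k j \<in> X" for k j using sX by (simp add: a_def fold_act_closed)
    have step: "a (k + 1) = act (\<star>) R1 R2 (ls' ! k) (a k)" if "k < length ls'" for k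
      using that by (simp add: a_def take_Suc_conv_app_nth)
    have vert: "a (k + 1) j = a k j"
      if "k < length ls'" "j \<in> {1..n}" "index (ls' ! k) \<noteq> Some j"
        "index (ls' ! k) \<noteq> Some (j - 1)" for k j
      using step[OF that(1)] act_vertical[OF that(3,4)] that(2) by simp
    have cross: "colors_crossing (\<star>) R1 R2 (ls' ! k) (a k i) (a k (i + 1)) (a (k + 1) i) (a (k + 1) (i + 1))"
      if "k < length ls'" "crossing_index (ls' ! k) = Some i" for k i
      unfolding step[OF that(1)] by (intro colors_crossing_act that(2) aX)
    obtain f' where f': "point_coloring X (\<star>) R1 R2 ?T' f'" "\<And>j k. f' (node j k) = a k j"
      using tangle_coloring_exists[where a = a, OF ls'(2) aX vert cross] by blast
    have "f' (node j 0) = f (node j 0)" if "j \<in> {1..n}" for j using that by (simp add: f'(2) a_def s_def)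
    moreover have "f' (node j 3) = f (node j 3)" if "j \<in> {1..n}" for j
    proof -
      have "f (node j 3) = fold (act (\<star>) R1 R2) (take 3 ls) s j"
        by (rule node_colors[OF f ls(2)]) (use that ls in \<open>auto simp: s_def\<close>)
      then show ?thesis using eq[of s j] sX that ls(1) ls'(1) by (simp add: f'(2) a_def)
    qed
    ultimately show ?thesis using f'(1) unfolding bd by blast
  qed
  moreover have "f z = f' z"
    if f: "point_coloring X (\<star>) R1 R2 ?T' f" "point_coloring X (\<star>) R1 R2 ?T' f'"
    and e: "\<forall>z \<in> curve ?T' \<inter> frontier box. f z = f' z" and z:
      "z \<in> curve ?T' - crossings ?T'" for f f' :: "complex \<Rightarrow> 'a" and z
  proof -
    obtain j k where jk: "j \<in> {1..n}" "k \<le> length ls'"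
      "\<And>f :: complex \<Rightarrow> 'a. point_coloring X (\<star>) R1 R2 ?T' f \<Longrightarrow> f z = f (node j k)"
      using nearest_node[OF ls'(2) z] by metis
    have "f (node j k) = fold (act (\<star>) R1 R2) (take k ls') (\<lambda>j. f (node j 0)) j"
      by (rule node_colors[OF f(1) ls'(2) _ jk(2,1)]) simp
    moreover have "f' (node j k) = fold (act (\<star>) R1 R2) (take k ls') (\<lambda>j. f (node j 0)) j"
      by (rule node_colors[OF f(2) ls'(2) _ jk(2,1)]) (use e bd' in auto)
    ultimately show ?thesis using jk(3) f by metis
  qed
  moreover have "box_tangle ?T" "box_tangle ?T'"
    using box_tangle_tangle[OF ls(1) n(2) plain_fits[OF ls(2)]] box_tangle_tangle[OF ls'(1) n(2)
      plain_fits[OF ls'(2)]]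
    by blast+
  ultimately show ?thesis unfolding boundary_extends_def bd bd' by (intro conjI allI impI ballI refl)
qed

lemma constant_extends:
  assumes T: "box_tangle T" "box_tangle T'" and bd:
    "curve T \<inter> frontier box = curve T' \<inter> frontier box"
    and p: "p \<in> curve T \<inter> frontier box" and sng: "sng T' = {}"
    and const: "\<And>f z. point_coloring X (\<star>) R1 R2 T f \<Longrightarrow> z \<in> curve T - crossings T \<Longrightarrow> f z = f p"
    and const': "\<And>f z. point_coloring X (\<star>) R1 R2 T' f \<Longrightarrow> z \<in> curve T' - crossings T' \<Longrightarrow> f z = f p"
  shows "boundary_extends X (\<star>) R1 R2 T T'"
proof -
  have cr: "frontier box \<inter> crossings T = {}" using T by (auto simp: box_tangle_def frontier_def)
  have "\<exists>f'. point_coloring X (\<star>) R1 R2 T' f' \<and> (\<forall>z \<in> curve T \<inter> frontier box. f' z = f z)"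
    if f: "point_coloring X (\<star>) R1 R2 T f" for f
  proof (intro exI conjI ballI)
    have "f p \<in> X" using f p cr by (auto simp: point_coloring_def)
    then show "point_coloring X (\<star>) R1 R2 T' (\<lambda>_. f p)"
      using idem sng by (simp add: point_coloring_def regular_condition_constant)
    show "f p = f z" if "z \<in> curve T \<inter> frontier box" for z
    proof -
      have "z \<in> curve T - crossings T" using cr that by blast
      then show ?thesis using const[OF f] by simp
    qed
  qed
  moreover have "f z = f' z" if "point_coloring X (\<star>) R1 R2 T' f" "point_coloring X (\<star>) R1 R2 T' f'"
    "\<forall>z \<in> curve T' \<inter> frontier box. f z = f' z" "z \<in> curve T' - crossings T'"
      for f f' :: "complex \<Rightarrow> 'a" and z
    using const'[OF that(1,4)] const'[OF that(2,4)] that(3) p bd by auto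
  ultimately show ?thesis using T bd unfolding boundary_extends_def by (intro conjI allI impI ballI)
qed

text \<open>The cap, the strand at position 3 and the cup form the loop of the kink, so the two
  right ends of the crossing have the same color. The crossing relation and idempotency identify it
  with the color of the open strand.\<close>

lemma kink_constant:
  assumes f: "point_coloring X (\<star>) R1 R2 (tangle 3 [Cap 2, l, Cup 2]) f"
    and l: "l = Sigma 1 \<or> l = Sigma_bar 1"
    and z: "z \<in> curve (tangle 3 [Cap 2, l, Cup 2]) - crossings (tangle 3 [Cap 2, l, Cup 2])"
  shows "f z = f (node 1 0)"
proof -
  define ls where "ls = [Cap 2, l, Cup 2]"
  have ls: "length ls = 3" "ls ! 0 = Cap 2" "ls ! 1 = l" "ls ! 2 = Cup 2" by (simp_all add: ls_def)
  note f = f[folded ls_def] and z = z[folded ls_def]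
  have ci: "crossing_index (ls ! 1) = Some 1" and idx: "index (ls ! 1) = Some 1" using l unfolding ls by auto
  have v0: "f y = f (node 1 0)" if "y \<in> closed_segment (node 1 0) (node 1 (0 + 1))" for y
    by (rule constant_vertical[OF f _ _ _ _ that]) (simp_all add: ls)
  have v1: "f y = f (node 3 1)" if "y \<in> closed_segment (node 3 1) (node 3 (1 + 1))" for y
    by (rule constant_vertical[OF f _ _ _ _ that]) (use idx in \<open>simp_all add: ls\<close>)
  have v2: "f y = f (node 1 2)" if "y \<in> closed_segment (node 1 2) (node 1 (2 + 1))" for y
    by (rule constant_vertical[OF f _ _ _ _ that]) (simp_all add: ls)
  have cap: "f y = f (node 2 1)"
    if "y
      \<in> closed_segment (node 2 (0 + 1)) (center 2 0) \<union> closed_segment (center 2 0) (node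
      (2 + 1) (0 + 1))" for y
    using constant_cap[OF f _ _ that] by (simp add: ls)
  have cup: "f y = f (node 2 2)"
    if "y \<in> closed_segment (node 2 2) (center 2 2) \<union> closed_segment (center 2 2) (node (2 + 1) 2)" for y
    using constant_cup[OF f _ _ that] by (simp add: ls)
  have n: "f (node 1 1) = f (node 1 0)" "f (node 3 2) = f (node 3 1)" "f (node 3 1) = f (node 2 1)"
    "f (node 3 2) = f (node 2 2)"
    using v0[of "node 1 1"] v1[of "node 3 2"] cap[of "node 3 1"] cup[of "node 3 2"]
      by (simp_all add: numeral_eq_Suc)
  have X: "f (node 1 0) \<in> X" "f (node 2 1) \<in> X"
  proof -
    have "node 1 0 \<in> draw 3 0 (ls ! 0)" "node 2 1 \<in> draw 3 0 (ls ! 0)" by (auto simp: ls mem_verticals)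
    then have "node 1 0 \<in> curve (tangle 3 ls)" "node 2 1 \<in> curve (tangle 3 ls)"
      unfolding curve_tangle using ls(1) by (metis zero_less_numeral)+
    moreover have "node 1 0 \<notin> crossings (tangle 3 ls)" "node 2 1 \<notin> crossings (tangle 3 ls)"
      by (rule node_not_crossing, simp)+
    ultimately show "f (node 1 0) \<in> X" "f (node 2 1) \<in> X" using f by (simp_all add: point_coloring_def)
  qed
  have "colors_crossing (\<star>) R1 R2 l (f (node 1 1)) (f (node 2 1)) (f (node 1 2)) (f (node 2 2))"
    using crossing_colors[OF f _ ci] ls by (simp add: numeral_2_eq_2)
  then have all: "f (node 2 1) = f (node 1 0)" "f (node 1 2) = f (node 1 0)"
  proof -
    assume c: "colors_crossing (\<star>) R1 R2 l (f (node 1 1)) (f (node 2 1)) (f (node 1 2)) (f (node 2 2))"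
    have n': "f (node 2 2) = f (node 2 1)" using n by metis
    from l have "f (node 2 1) = f (node 1 0) \<and> f (node 1 2) = f (node 1 0)"
    proof
      assume s: "l = Sigma 1"
      have "f (node 2 1) = f (node 1 0)" "f (node 1 2) = f (node 2 1) \<star> f (node 1 0)"
        using c unfolding s colors_crossing_def layer.case n n' by blast+
      then show ?thesis using idem X by simp
    next
      assume s: "l = Sigma_bar 1"
      \<comment> \<open>The relation of the under-strand is read upwards: the loop color acts on
        itself, and idempotency gives the color of the top end.\<close>
      have "f (node 1 2) = f (node 2 1)" "f (node 1 0) = f (node 2 1) \<star> f (node 2 1)"
        using c unfolding s colors_crossing_def layer.case n n' by blast+
      then show ?thesis using idem X by simp
    qed
    then show "f (node 2 1) = f (node 1 0)" "f (node 1 2) = f (node 1 0)" by auto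
  qed
  have "z \<in> curve (tangle 3 ls)" using z by blast
  then obtain k where k: "k < 3" "z \<in> draw 3 k (ls ! k)" unfolding curve_tangle ls(1) by blast
  then have "k = 0 \<or> k = 1 \<or> k = 2" by linarith
  then show ?thesis
  proof (elim disjE)
    assume "k = 0"
    then have "z \<in> verticals ({1..3} - {2, 2 + 1}) 0 \<or>
      z
        \<in> closed_segment (node 2 (0 + 1)) (center 2 0) \<union> closed_segment (center 2 0)
        (node (2 + 1) (0 + 1))"
      using k(2) unfolding ls by (simp only: draw.simps ls) blast
    moreover have "{1..3} - {2, 2 + 1} = {1::nat}" by auto
    ultimately show ?thesis using v0[of z] cap[of z] all by (auto simp: verticals_def)
  next
    assume k1: "k = 1"
    show ?thesis using k(2) unfolding k1
    proof (cases rule: draw_cases)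
      case (vertical j)
      then have "j = 3" using idx by auto
      then have "z \<in> closed_segment (node 3 1) (node 3 (1 + 1))" unfolding mem_vertical using vertical by simp
      then show ?thesis using v1 n all by metis
    next
      case (diagonal i)
      then have i: "i = 1" using idx by simp
      have "center 1 1 \<in> crossings (tangle 3 ls)" using ci ls(1)
        by (auto simp: crossings_tangle intro!: exI[of _ 1])
      then have "z \<noteq> center 1 1" using z by auto
      moreover have "\<bar>Im z + (real 1 + 1/2)\<bar> \<le> 1/2" using diagonal(3,4) by linarith
      then have "z \<in> cross_at 1 1" using diagonal(2) unfolding i by (simp only: mem_cross_at)
      ultimately obtain d where d: "d \<in> corners" "z \<in> half_edge (center 1 1) d"
        using cross_half_edges by blast
      have "f z = f (center 1 1 + (1/2) *\<^sub>R d)" using ls(1) by (intro constant_half_edge[OF f _ ci d]) simp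
      moreover obtain j k'
        where jk: "j \<in> {1, 1 + 1}" "k' \<in> {1, 1 + 1}" "center 1 1 + (1/2) *\<^sub>R d = node j k'"
        using corner_node[OF d(1)] .
      moreover have "f (node j k') = f (node 1 0)" using jk(1,2) n all by (auto simp: numeral_2_eq_2)
      ultimately show ?thesis by simp
    qed
  next
    assume "k = 2"
    then have "z \<in> verticals ({1..3} - {2, 2 + 1}) 2 \<or>
      z \<in> closed_segment (node 2 2) (center 2 2) \<union> closed_segment (center 2 2) (node (2 + 1) 2)"
      using k(2) unfolding ls by (simp only: draw.simps ls) blast
    moreover have "{1..3} - {2, 2 + 1} = {1::nat}" by auto
    moreover have "f (node 2 2) = f (node 1 0)" using n all by metis
    ultimately show ?thesis using v2[of z] cup[of z] all by (auto simp: verticals_def)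
  qed
qed

text \<open>The two sides have different numbers of positions, so they are compared through their
  constant colorings instead of as words. The coordinates show that cap and cup stay away from the
  top and the bottom of the box, which leaves the two ends of position 1.\<close>

lemma kink_extends:
  assumes l: "l = Sigma 1 \<or> l = Sigma_bar 1"
  defines "T \<equiv> tangle 3 [Cap 2, l, Cup 2]" and "T' \<equiv> tangle 1 [Straight, Straight, Straight]"
  shows "boundary_extends X (\<star>) R1 R2 T T' \<and> boundary_extends X (\<star>) R1 R2 T' T"
proof -
  have fits: "list_all (fits 3) [Cap 2, l, Cup 2]" using l by (auto simp: fits_def)
  have plain: "list_all (plain 1) [Straight, Straight, Straight]" by (simp add: plain_def fits_def)
  have box: "box_tangle T" "box_tangle T'"
    unfolding T_def T'_def using fits plain_fits[OF plain] by (intro box_tangle_tangle; simp)+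
  have "{1..3} - {2, 2 + 1} = {1::nat}" by auto
  then have v: "verticals ({1..3} - {2, 2 + 1}) k = closed_segment (node 1 k) (node 1 (k + 1))" for k
    by (simp add: verticals_def)
  have d0: "z \<in> draw 3 0 (Cap 2) \<longleftrightarrow> (Re z = 1 \<and> - 1 \<le> Im z \<and> Im z \<le> 0) \<or>
      (\<bar>Re z - 5/2\<bar> = - Im z - 1/2 \<and> - Im z - 1/2 \<le> 1/2)" for z
    unfolding draw.simps v Un_assoc Un_iff[of z "closed_segment (node 1 0) (node 1 (0 + 1))"] mem_vertical mem_cap
    by simp
  then have "z \<in> draw 3 0 (Cap 2) \<and> Im z = 0 \<longleftrightarrow> Re z = 1 \<and> Im z = 0" for z using d0[of z] by argo
  then have s0: "{z \<in> draw 3 0 (Cap 2). Im z = 0} = {node 1 0}"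
    unfolding set_eq_iff mem_Collect_eq by (simp add: complex_eq_iff del: draw.simps)
  have d2: "z \<in> draw 3 2 (Cup 2) \<longleftrightarrow> (Re z = 1 \<and> - 3 \<le> Im z \<and> Im z \<le> - 2) \<or>
      (\<bar>Re z - 5/2\<bar> = Im z + 5/2 \<and> Im z + 5/2 \<le> 1/2)" for z
    unfolding draw.simps v Un_assoc Un_iff[of z "closed_segment (node 1 2) (node 1 (2 + 1))"] mem_vertical mem_cup
    by simp
  then have "z \<in> draw 3 2 (Cup 2) \<and> Im z = - 3 \<longleftrightarrow> Re z = 1 \<and> Im z = - 3" for z using d2[of z] by argo
  then have s2: "{z \<in> draw 3 2 (Cup 2). Im z = - 3} = {node 1 3}"
    unfolding set_eq_iff mem_Collect_eq by (simp add: complex_eq_iff del: draw.simps)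
  have "curve T \<inter> frontier box = {z \<in> draw 3 0 (Cap 2). Im z = 0} \<union> {z
    \<in> draw 3 2 (Cup 2). Im z = - 3}"
    unfolding T_def using tangle_boundary[OF _ _ fits] by (simp del: draw.simps)
  then have bd: "curve T \<inter> frontier box = {node 1 0, node 1 3}" unfolding s0 s2 by auto
  have bd': "curve T' \<inter> frontier box = {node 1 0, node 1 3}"
    unfolding T'_def using plain_boundary[OF _ _ plain] by auto
  have sng: "sng T = {}" "sng T' = {}" using l unfolding T_def T'_def by (auto intro!: sng_tangle_empty)
  have c: "f z = f (node 1 0)" if "point_coloring X (\<star>) R1 R2 T f" "z \<in> curve T - crossings T" for f z
    using kink_constant[OF _ l] that unfolding T_def by blast
  have c': "f z = f (node 1 0)"
    if f: "point_coloring X (\<star>) R1 R2 T' f" and z: "z \<in> curve T' - crossings T'" for f z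
  proof -
    obtain j k where jk: "j \<in> {1..1}" "k \<le> length [Straight, Straight, Straight]" "f z = f (node j k)"
      using nearest_node[OF plain z[unfolded T'_def]] f[unfolded T'_def] by metis
    have "f (node j k)
      = fold (act (\<star>) R1 R2) (take k [Straight, Straight, Straight]) (\<lambda>j. f (node j 0)) j"
      by (rule node_colors[OF f[unfolded T'_def] plain _ jk(2,1)]) simp
    also have "\<dots> = f (node j 0)"
    proof -
      have "fold (act (\<star>) R1 R2) ls s = s" if "set ls \<subseteq> {Straight}" for ls s
        using that by (induction ls) auto
      moreover have "set (take k [Straight, Straight, Straight]) \<subseteq> {Straight}"
        using set_take_subset by fastforce
      ultimately show ?thesis by metis
    qed
    finally show ?thesis using jk by simp
  qed
  show ?thesis
    using constant_extends[OF box _ _ sng(2) c c'] constant_extends[OF box(2,1) _ _ sng(1) c' c] bd bd' by simp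
qed

section \<open>Moves as identities between words\<close>

lemma plain_extends_both:
  assumes "1 \<le> n" "n \<le> 3" "length ls = 3" "list_all (plain n) ls" "length ls' = 3" "list_all (plain n) ls'"
    and "\<And>s j. (\<And>j. s j \<in> X) \<Longrightarrow> j \<in> {1..n}
      \<Longrightarrow> fold (act (\<star>) R1 R2) ls s j = fold (act (\<star>) R1 R2) ls' s j"
  shows "boundary_extends X (\<star>) R1 R2 (tangle n ls) (tangle n ls') \<and>
    boundary_extends X (\<star>) R1 R2 (tangle n ls') (tangle n ls)"
  using assms by (intro conjI plain_extends) (auto simp del: atLeastAtMost_iff)

text \<open>These are axioms 5 and 6 at the pair \<open>y\<close>, \<open>x \<star> y\<close>, which
  is what \<open>Sigma_bar 1\<close> makes of \<open>x\<close>, \<open>y\<close>. Involutivity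
  cancels the double action in \<open>(x \<star> y) \<star> y\<close>; acting once more by
  \<open>R2 x y\<close> moves this factor of axiom 6 to the other side.\<close>

lemma RV_colors:
  assumes "x \<in> X" "y \<in> X"
  shows "R1 y (x \<star> y) = R2 x y" "R2 y (x \<star> y) \<star> R2 x y = R1 x y"
proof -
  have xy: "x \<star> y \<in> X" using assms star_closed by blast
  show 1: "R1 y (x \<star> y) = R2 x y" using ax5[OF assms(2) xy] assms by (simp add: involutive)
  have "R2 y (x \<star> y) = R1 x y \<star> R2 x y" using ax6[OF assms(2) xy] assms by (simp add: involutive)
  then show "R2 y (x \<star> y) \<star> R2 x y = R1 x y" using assms by (simp add: involutive R1_closed R2_closed)
qed

lemma local_move_extends:
  assumes "local_move T T'"
  shows "boundary_extends X (\<star>) R1 R2 T T' \<and> boundary_extends X (\<star>) R1 R2 T' T"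
proof -
  have three: "j \<in> {1..3} \<longleftrightarrow> j = 1 \<or> j = 2 \<or> j = 3" and two:
    "j \<in> {1..2} \<longleftrightarrow> j = 1 \<or> j = 2" for j :: nat
    by auto
  note pl = plain_def fits_def
  show ?thesis
    using assms
  proof cases
    case RI
    then show ?thesis using kink_extends by blast
  next
    case RI_bar
    then show ?thesis using kink_extends by blast
  next
    case RII
    show ?thesis unfolding RII
      \<comment> \<open>The over-strand returns unchanged and acts twice on the other strand, which
        involutivity cancels.\<close>
      by (rule plain_extends_both) (auto simp: pl two involutive numeral_2_eq_2 numeral_3_eq_3 simp
        del: atLeastAtMost_iff)
  next
    case RII_bar
    show ?thesis unfolding RII_bar
      by (rule plain_extends_both) (auto simp: pl two involutive numeral_2_eq_2 numeral_3_eq_3 simp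
        del: atLeastAtMost_iff)
  next
    case RIII
    \<comment> \<open>For top colors \<open>x\<close>, \<open>y\<close>, \<open>z\<close> both words
      end in \<open>z\<close> and \<open>x \<star> z\<close> at the outer positions; the middle
      color is \<open>(y \<star> x) \<star> z\<close> in the first and
      \<open>(y \<star> z) \<star> (x \<star> z)\<close> in the second.\<close>
    show ?thesis unfolding RIII
      by (rule plain_extends_both) (auto simp: pl three right_distrib numeral_2_eq_2 numeral_3_eq_3
        simp del: atLeastAtMost_iff)
  next
    case RIVa
    \<comment> \<open>Both words give \<open>R1 x z\<close> and \<open>R2 x z\<close> at the outer
      positions; axiom 4 compares the colors of the strand that passes under the singular
      crossing.\<close>
    show ?thesis unfolding RIVa
      by (rule plain_extends_both) (auto simp: pl three ax4 numeral_2_eq_2 numeral_3_eq_3 simp del: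
        atLeastAtMost_iff)
  next
    case RIVb
    \<comment> \<open>The sliding strand is always the over-strand and keeps its color
      \<open>y\<close>; axioms 7 and 8 compare the two lower ends of the singular crossing.\<close>
    show ?thesis unfolding RIVb
      by (rule plain_extends_both) (auto simp: pl three ax7 ax8 numeral_2_eq_2 numeral_3_eq_3 simp
        del: atLeastAtMost_iff)
  next
    case RV
    \<comment> \<open>The first two layers produce \<open>R1 y (x \<star> y)\<close> and
      \<open>R2 y (x \<star> y)\<close>, and the former is the over-color of the final
      \<open>Sigma 1\<close>.\<close>
    show ?thesis unfolding RV
      by (rule plain_extends_both) (auto simp: pl two RV_colors numeral_2_eq_2 numeral_3_eq_3 simp
        del: atLeastAtMost_iff)
  qed
qed

end

theorem lemma4p2:
  fixes X :: "'a set" and qop R1 R2 :: "'a \<Rightarrow> 'a \<Rightarrow> 'a"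
    and D D' :: diagram and \<Delta> :: "complex set"
  assumes "singquandle X qop R1 R2"
    and "singular_link_diagram D"
    and "singular_link_diagram D'"
    and "single_move \<Delta> D D'"
  shows "(\<forall>c \<in> colorings X qop R1 R2 D.
            \<exists>!c'. c' \<in> colorings X qop R1 R2 D' \<and> same_colors_outside \<Delta> D D' c c') \<and>
         bij_betw
           (\<lambda>c. THE c'. c' \<in> colorings X qop R1 R2 D' \<and> same_colors_outside \<Delta> D D' c c')
           (colorings X qop R1 R2 D) (colorings X qop R1 R2 D')"
  using assms(2-4) singquandle.local_move_extends[OF assms(1)] by (rule single_move_colorings)

end
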